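(* Let $\mathcal{T}$ be a theory of Feynman graphs and let $C\in M_{N,|\mathcal{V}|}(\mathbb{Q})$ be a matrix such that $\deg(G)=CV_G-(C\ \ 0)S_G$ defines a connected $\mathbb{N}^N$-graduation of $\mathcal{H}_{\mathcal{FG}(\mathcal{T})}$. If $\mathrm{Rank}(C)=|\mathcal{V}|$, then $\mathcal{H}_{(S'_{\mathcal{T}})}$ is a Hopf subalgebra of $\mathcal{H}^P$; moreover, the SDSE $(S'_{\mathcal{T}})$ is associated to a deg1 pre-Lie algebra.
   Context: $\mathbb{K}$ is a field of characteristic zero. FEYNMAN GRAPHS. A theory of Feynman graphs $\mathcal{T}=(\mathcal{HE},\mathcal{V},\iota)$ is given by a finite set $\mathcal{HE}$ of half-edge types with an involution $\iota:\mathcal{HE}\to\mathcal{HE}$ and a finite set $\mathcal{V}$ of vertex types, each being a finite multiset of elements of $\mathcal{HE}$ of cardinality at least $3$. The set $\mathcal{E}$ of edge types is the set of multisets $\{t,\iota(t)\}$, $t\in\mathcal{HE}$. A 1PI Feynman graph $G$ of $\mathcal{T}$ is given by a nonempty finite set $HE$ of half-edges with a map $type:HE\to\mathcal{HE}$, a nonempty finite set $V$ of vertices, an involution $i:HE\to HE$ and a source map $s:HE\to V$ such that: (1) if $i(e)\ne e$ then $\iota(type(e))=type(i(e))$; (2) for any $v\in V$ the multiset $type(v)=\{type(e)\mid s(e)=v\}$ belongs to $\mathcal{V}$; (3) with internal edges $Int(G)=\{\{e,i(e)\}\mid i(e)\neq e\}$ (the type of such an edge being $\{type(e),type(i(e))\}\in\mathcal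 E$), the graph $(V,Int(G))$ is connected, has at least one edge, and remains connected if any one edge is deleted; (4) with external half-edges $Ext(G)=\{e\mid i(e)=e\}$, the multiset $\{type(e)\mid e\in Ext(G)\}$ is either of the form $\{t,\iota(t)\}$ (external structure of type this edge type) or an element of $\mathcal{V}$ (external structure of type this vertex type). A Feynman graph is a disjoint union of a finite number (possibly $0$, giving the empty graph $1$) of 1PI Feynman graphs, called its connected components; graphs are taken up to isomorphism. It is assumed that for every element of $\mathcal{V}\sqcup\mathcal{E}$ there exist 1PI graphs with that external structure. A Feynman graph $G'=(HE',V',i',s')$ is a subgraph of $G=(HE,V,i,s)$ if $HE'\subseteq HE$, $V'=s(HE')$, $s'=s_{|HE'}$ and, for all $e\in HE'$, $i'(e)=e$ or $i'(e)=i(e)$. For $G'$ a connected subgraph, $G/G'=(HE'',V'',i'',s'')$ is defined as follows. If the external structure of $G'$ is a vertex type: $HE''=(HE\setminus HE')\sqcup Ext(G')$, $V''=(V\setminus V')\sqcup\{0\}$, $s''=s$ on $HE\setminus HE'$ and $s''=0$ on $Ext(G')$, $i''=i$. If it is an edge type, with external half-edges $e_1,e_2$ of $G'$: $HE''=HE\setminus HE'$, $V''=V\setminus V'$, $s''=s$, $i''(i(e_1))=i(e_2)$, $i''(i(e_2))=i(e_1)$, $i''(e)=i(e)$ otherwise. For non-connected $G'$, contract its components successively. By convention $G/1=G$ and $G/G=1$ (a connected component contracted entirely disappears). $G'$ is admissible, written $G'\subseteq G$, if $G/G'$ is a Feynman graph. $\mathcal{H}_{\mathcal{FG}(\mathcal{T})}$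 is the Hopf algebra with basis the Feynman graphs of $\mathcal{T}$, product the disjoint union, coproduct $\Delta(G)=\sum_{G'\subseteq G}G'\otimes G/G'$. A graph $G$ is primitive if $\Delta(G)=G\otimes1+1\otimes G$. $V_G=(v_t(G))_{t\in\mathcal{V}}$, $v_t(G)$ being the number of vertices of type $t$; $e_t(G)$, $t\in\mathcal{E}$, is the number of internal edges of type $t$; $S_G=(s_t(G))_{t\in\mathcal{V}\sqcup\mathcal{E}}$, $s_t(G)$ being the number of connected components with external structure $t$. $(C\ \ 0)$ is $C$ completed with $|\mathcal{E}|$ zero columns. The graduation is a connected $\mathbb{N}^N$-graduation if $\deg(G)\in\mathbb{N}^N$ for all $G$, $\deg(G)\ne0$ if $G\neq 1$, and there are finitely many graphs of each degree. DECORATED TREES. For a set $D$, $\mathcal{H}^D$ is the free commutative algebra generated by isoclasses of rooted trees with vertices decorated by $D$; its basis is the set of decorated rooted forests. For $d\in D$, $B_d$ is the linear map sending a forest to the tree obtained by grafting all its trees on a common root decorated by $d$. The coproduct of $\mathcal{H}^D$ is the unique algebra morphism with $\Delta\circ B_d(x)=B_d(x)\otimes1+(\mathrm{Id}\otimes B_d)\circ\Delta(x)$. $B_d$ extends to the algebra $\widehat{\mathcal{H}^D}$ of formal series of forests. THE SYSTEM. Let $\mathcal{V}=\{t_1,\dots,t_k\}$, $\mathcal{E}=\{t_{k+1},\dots,t_{k+l}\}$, $M=k+l$, $v_j(G)=v_{t_j}(G)$ for $j\leq k$, $e_j(G)=e_{t_j}(G)$ for $j>k$. $P_i$ is the set of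 primitive 1PI Feynman graphs of external structure of type $t_i$ and $P=\bigsqcup_iP_i$, graded by $\deg$; this induces an $\mathbb{N}^N$-graduation of $\mathcal{H}^P$ (degree of a forest = sum of the degrees of its decorations). $(S'_{\mathcal{T}})$ is the system $$\forall i\in[M],\quad Y_i=\sum_{G\in P_i}B_G\left(\prod_{j=1}^k(1+Y_j)^{v_j(G)}\prod_{j=k+1}^{k+l}(1-Y_j)^{-e_j(G)}\right)$$ with unknowns $Y_i\in\widehat{\mathcal{H}^P}$; it has a unique solution. $Y_i(d)$ is the homogeneous component of $Y_i$ of degree $d$, and $\mathcal{H}_{(S'_{\mathcal{T}})}$ is the subalgebra of $\mathcal{H}^P$ generated by all the $Y_i(d)$. SDSE ASSOCIATED TO A DEG1 PRE-LIE ALGEBRA. Let $\mathbb N^N_*=\mathbb N^N\setminus\{0\}$, and $F_{a,b}(X)=\sum_{n\ge0}\frac{a(a-b)\cdots(a-b(n-1))}{n!}X^n$. Given a partition $[M]=I_0\sqcup\dots\sqcup I_m$ with $I_1,\dots,I_m\neq\emptyset$, $A_q\in\mathbb{K}^N$, $b_q\in\mathbb{K}$ ($q\in[m]$), $b^{(i)}_q\in\mathbb{K}$ ($i\in I_0$, $q\in[m]$), the (fundamental) deg1 pre-Lie algebra with these parameters has basis $(f_i(\alpha))_{i\in[M],\alpha\in\mathbb{N}^N_*}$ and product, for $i\in I_p$, $j\in I_q$: $f_j(\beta)*f_i(\alpha)=(A_q\cdot\alpha+\delta_{p,q}b_q)f_i(\alpha+\beta)$ if $p,q\neq0$, $(A_q\cdot\alpha+b^{(i)}_q)f_i(\alpha+\beta)$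 if $p=0\ne q$, and $0$ if $q=0$. The SDSE associated to it is $$Y_i=\sum_{\alpha\in\mathbb{N}^N_*}B_{i,\alpha}\Big(\prod_{q=1}^mF_{A_q\cdot\alpha,b_q}\big(\textstyle\sum_{j\in I_q}Y_j\big)\big(1+b_p\sum_{j\in I_p}Y_j\big)\Big)\quad(i\in I_p,\ p\geq1),$$ $$Y_i=\sum_{\alpha\in\mathbb{N}^N_*}B_{i,\alpha}\Big(\prod_{q=1}^mF_{A_q\cdot\alpha,b_q}\big(\textstyle\sum_{j\in I_q}Y_j\big)\prod_{q=1}^mF_{b^{(i)}_q,b_q}\big(\sum_{j\in I_q}Y_j\big)\Big)\quad(i\in I_0).$$ Saying that $(S'_{\mathcal{T}})$ is associated to a deg1 pre-Lie algebra means that it takes this form for some such parameters, with $B_{i,\alpha}=\sum_{G\in P_i,\ \deg(G)=\alpha}B_G$. *)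

theory Defs
  imports
    "Jordan_Normal_Form.DL_Rank"
    "HOL-Library.Poly_Mapping"
    "HOL-Library.Product_Plus"
    "HOL-Computational_Algebra.Formal_Power_Series"
begin

no_notation fps_nth (infixl \<open>$\<close> 75)

section \<open>Feynman graphs\<close>

record 'h feyn_theory =
  htypes :: "'h set"
  iota :: "'h \<Rightarrow> 'h"
  vtypes :: "'h multiset set"

definition etypes :: "'h feyn_theory \<Rightarrow> 'h multiset set" where
  "etypes T = {{#h, iota T h#} | h. h \<in> htypes T}"

text \<open>
  Half-edges and vertices are natural numbers. All functions are only meaningful on
  \<^term>\<open>hedges G\<close>; the values elsewhere are forgotten when passing to isomorphism classes.
\<close>

record 'h pregraph =
  hedges :: "nat set"
  verts :: "nat set"
  invol :: "nat \<Rightarrow> nat"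
  src :: "nat \<Rightarrow> nat"
  ty :: "nat \<Rightarrow> 'h"

definition wf_graph :: "'h pregraph \<Rightarrow> bool" where
  "wf_graph G \<longleftrightarrow> finite (hedges G) \<and> finite (verts G) \<and>
     (\<forall>e\<in>hedges G. invol G e \<in> hedges G \<and> invol G (invol G e) = e \<and> src G e \<in> verts G)"

definition internal :: "'h pregraph \<Rightarrow> nat set set" where
  "internal G = {{e, invol G e} | e. e \<in> hedges G \<and> invol G e \<noteq> e}"

definition external :: "'h pregraph \<Rightarrow> nat set" where
  "external G = {e \<in> hedges G. invol G e = e}"

definition type_mset :: "'h pregraph \<Rightarrow> nat set \<Rightarrow> 'h multiset" where
  "type_mset G E = image_mset (ty G) (mset_set E)"

definition vertex_type :: "'h pregraph \<Rightarrow> nat \<Rightarrow> 'h multiset" where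
  "vertex_type G v = type_mset G {e \<in> hedges G. src G e = v}"

text \<open>
  Vertex types have at least three elements and edge types have two, so the multiset of types of
  the external half-edges determines whether the external structure is a vertex or an edge type.
\<close>

definition ext_type :: "'h pregraph \<Rightarrow> 'h multiset" where
  "ext_type G = type_mset G (external G)"

definition adjacency :: "'h pregraph \<Rightarrow> nat set set \<Rightarrow> (nat \<times> nat) set" where
  "adjacency G E = {(src G a, src G b) | a b. {a, b} \<in> E}"

definition connected_by :: "'h pregraph \<Rightarrow> nat set set \<Rightarrow> bool" where
  "connected_by G E \<longleftrightarrow> (\<forall>u\<in>verts G. \<forall>v\<in>verts G. (u, v) \<in> (adjacency G E)\<^sup>*)"

definition is_1PI :: "'h feyn_theory \<Rightarrow> 'h pregraph \<Rightarrow> bool" where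
  "is_1PI T G \<longleftrightarrow>
     wf_graph G \<and> hedges G \<noteq> {} \<and> verts G \<noteq> {} \<and> ty G ` hedges G \<subseteq> htypes T \<and>
     (\<forall>e\<in>hedges G. invol G e \<noteq> e \<longrightarrow> iota T (ty G e) = ty G (invol G e)) \<and>
     (\<forall>v\<in>verts G. vertex_type G v \<in> vtypes T) \<and>
     connected_by G (internal G) \<and> internal G \<noteq> {} \<and>
     (\<forall>\<epsilon>\<in>internal G. connected_by G (internal G - {\<epsilon>})) \<and>
     ext_type G \<in> vtypes T \<union> etypes T"

definition components :: "'h pregraph \<Rightarrow> 'h pregraph set" where
  "components G =
     (\<lambda>v. let W = {w \<in> verts G. (v, w) \<in> (adjacency G (internal G))\<^sup>*}
          in G\<lparr>hedges := {e \<in> hedges G. src G e \<in> W}, verts := W\<rparr>) ` verts G"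

definition is_feynman :: "'h feyn_theory \<Rightarrow> 'h pregraph \<Rightarrow> bool" where
  "is_feynman T G \<longleftrightarrow> wf_graph G \<and> (\<forall>C\<in>components G. is_1PI T C)"

definition feynman_theory :: "'h feyn_theory \<Rightarrow> bool" where
  "feynman_theory T \<longleftrightarrow>
     finite (htypes T) \<and> (\<forall>h\<in>htypes T. iota T h \<in> htypes T \<and> iota T (iota T h) = h) \<and>
     finite (vtypes T) \<and> (\<forall>v\<in>vtypes T. set_mset v \<subseteq> htypes T \<and> 3 \<le> size v) \<and>
     (\<forall>s \<in> vtypes T \<union> etypes T. \<exists>G. is_1PI T G \<and> ext_type G = s)"

subsection \<open>Isomorphism classes\<close>

definition graph_iso :: "'h pregraph \<Rightarrow> 'h pregraph \<Rightarrow> bool" where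
  "graph_iso G H \<longleftrightarrow> wf_graph G \<and> wf_graph H \<and>
     (\<exists>f g. bij_betw f (hedges G) (hedges H) \<and> bij_betw g (verts G) (verts H) \<and>
        (\<forall>e\<in>hedges G. invol H (f e) = f (invol G e) \<and> src H (f e) = g (src G e)
                      \<and> ty H (f e) = ty G e))"

definition empty_graph :: "'h pregraph" where
  "empty_graph = \<lparr>hedges = {}, verts = {}, invol = id, src = id, ty = (\<lambda>_. undefined)\<rparr>"

lemma graph_iso_refl: "wf_graph G \<Longrightarrow> graph_iso G G"
  unfolding graph_iso_def
  by (intro conjI exI[of _ id]) auto

lemma graph_iso_sym:
  assumes "graph_iso G H" shows "graph_iso H G"
proof -
  from assms obtain f g where wf: "wf_graph G" "wf_graph H"
    and f: "bij_betw f (hedges G) (hedges H)" and g: "bij_betw g (verts G) (verts H)"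
    and c: "\<forall>e\<in>hedges G. invol H (f e) = f (invol G e) \<and> src H (f e) = g (src G e)
                      \<and> ty H (f e) = ty G e"
    unfolding graph_iso_def by blast
  let ?f = "inv_into (hedges G) f" and ?g = "inv_into (verts G) g"
  have "invol G (?f e) = ?f (invol H e) \<and> src G (?f e) = ?g (src H e) \<and> ty G (?f e) = ty H e"
    if e: "e \<in> hedges H" for e
  proof -
    obtain a where a: "a \<in> hedges G" "e = f a"
      using f e by (auto simp: bij_betw_def)
    have fa: "?f (f x) = x" if "x \<in> hedges G" for x
      using that f by (simp add: bij_betw_inv_into_left)
    have ga: "?g (g x) = x" if "x \<in> verts G" for x
      using that g by (simp add: bij_betw_inv_into_left)
    show ?thesis
      using a c fa ga wf by (auto simp: wf_graph_def)
  qed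
  then show ?thesis
    unfolding graph_iso_def using wf f g bij_betw_inv_into by blast
qed

lemma graph_iso_trans:
  assumes "graph_iso G H" "graph_iso H K" shows "graph_iso G K"
proof -
  from assms(1) obtain f g where 1: "wf_graph G" "bij_betw f (hedges G) (hedges H)"
    "bij_betw g (verts G) (verts H)"
    "\<forall>e\<in>hedges G. invol H (f e) = f (invol G e) \<and> src H (f e) = g (src G e) \<and> ty H (f e) = ty G e"
    unfolding graph_iso_def by blast
  from assms(2) obtain f' g' where 2: "wf_graph K" "bij_betw f' (hedges H) (hedges K)"
    "bij_betw g' (verts H) (verts K)"
    "\<forall>e\<in>hedges H. invol K (f' e) = f' (invol H e) \<and> src K (f' e) = g' (src H e)
                   \<and> ty K (f' e) = ty H e"
    unfolding graph_iso_def by blast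
  have "f e \<in> hedges H" if "e \<in> hedges G" for e
    using 1(2) that by (auto simp: bij_betw_def)
  then have "\<forall>e\<in>hedges G. invol K ((f' \<circ> f) e) = (f' \<circ> f) (invol G e)
      \<and> src K ((f' \<circ> f) e) = (g' \<circ> g) (src G e) \<and> ty K ((f' \<circ> f) e) = ty G e"
    using 1(4) 2(4) by auto
  then show ?thesis
    unfolding graph_iso_def
    using 1(1) 2(1) bij_betw_trans[OF 1(2) 2(2)] bij_betw_trans[OF 1(3) 2(3)] by blast
qed

quotient_type 'h fgraph = "'h pregraph" / partial: graph_iso
proof (rule part_equivpI)
  have "wf_graph empty_graph" by (simp add: wf_graph_def empty_graph_def)
  then show "\<exists>x. graph_iso x x" using graph_iso_refl by blast
  show "symp graph_iso" by (rule sympI) (rule graph_iso_sym)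
  show "transp graph_iso" by (rule transpI) (rule graph_iso_trans)
qed

definition one_graph :: "'h fgraph" where
  "one_graph = abs_fgraph empty_graph"

definition v_count :: "'h multiset \<Rightarrow> 'h fgraph \<Rightarrow> nat" where
  "v_count s x = (let G = rep_fgraph x in card {v \<in> verts G. vertex_type G v = s})"

definition e_count :: "'h multiset \<Rightarrow> 'h fgraph \<Rightarrow> nat" where
  "e_count s x = (let G = rep_fgraph x in card {\<epsilon> \<in> internal G. type_mset G \<epsilon> = s})"

definition s_count :: "'h multiset \<Rightarrow> 'h fgraph \<Rightarrow> nat" where
  "s_count s x = card {D \<in> components (rep_fgraph x). ext_type D = s}"

subsection \<open>Subgraphs, contraction, primitive graphs\<close>

text \<open>
  A subgraph of \<^term>\<open>G\<close> is given by its half-edges and its involution. The involution is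
  normalised to the identity outside the half-edges, so that each subgraph is counted once.
\<close>

definition subgraphs :: "'h feyn_theory \<Rightarrow> 'h pregraph \<Rightarrow> 'h pregraph set" where
  "subgraphs T G = {G\<lparr>hedges := H, verts := src G ` H, invol := j\<rparr> | H j.
     H \<subseteq> hedges G \<and> (\<forall>e\<in>H. j e = e \<or> j e = invol G e) \<and> (\<forall>e. e \<notin> H \<longrightarrow> j e = e) \<and>
     is_feynman T (G\<lparr>hedges := H, verts := src G ` H, invol := j\<rparr>)}"

definition is_component :: "'h pregraph \<Rightarrow> 'h pregraph \<Rightarrow> bool" where
  "is_component G C \<longleftrightarrow> hedges C = {e \<in> hedges G. src G e \<in> verts C} \<and>
     (\<forall>e\<in>hedges C. invol C e = invol G e)"

text \<open>
  Contraction of a connected subgraph \<^term>\<open>C\<close>. The new vertex is chosen outside the sources of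
  all half-edges: when \<^term>\<open>C\<close> contains some but not all half-edges at one of its vertices, the
  remaining ones are left without a source in the contracted graph, which is then not a Feynman
  graph.
\<close>

definition contract_conn :: "'h feyn_theory \<Rightarrow> 'h pregraph \<Rightarrow> 'h pregraph \<Rightarrow> 'h pregraph" where
  "contract_conn T G C =
     (let H = hedges G - hedges C; V = verts G - verts C; X = external C in
      if is_component G C then G\<lparr>hedges := H, verts := V\<rparr>
      else if ext_type C \<in> vtypes T then
        (let v0 = (LEAST v. v \<notin> verts G \<union> src G ` hedges G) in
         G\<lparr>hedges := H \<union> X, verts := insert v0 V,
           src := (\<lambda>e. if e \<in> X then v0 else src G e)\<rparr>)
      else
        G\<lparr>hedges := H, verts := V,
          invol := (\<lambda>e. if invol G e \<in> X
                        then invol G (THE e'. e' \<in> X \<and> e' \<noteq> invol G e)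
                        else invol G e)\<rparr>)"

text \<open>
  The components are contracted one after the other; up to isomorphism the order is irrelevant.
\<close>

definition contract :: "'h feyn_theory \<Rightarrow> 'h pregraph \<Rightarrow> 'h pregraph \<Rightarrow> 'h pregraph" where
  "contract T G S = foldl (contract_conn T) G (SOME Cs. distinct Cs \<and> set Cs = components S)"

definition admissible :: "'h feyn_theory \<Rightarrow> 'h pregraph \<Rightarrow> 'h pregraph set" where
  "admissible T G = {S \<in> subgraphs T G. is_feynman T (contract T G S)}"

definition fg_coproduct ::
    "'h feyn_theory \<Rightarrow> 'h fgraph \<Rightarrow> ('h fgraph \<times> 'h fgraph) \<Rightarrow>\<^sub>0 'k::field_char_0" where
  "fg_coproduct T x =
     (\<Sum>S\<in>admissible T (rep_fgraph x).
        Poly_Mapping.single (abs_fgraph S, abs_fgraph (contract T (rep_fgraph x) S)) 1)"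

definition primitive_graph :: "'k::field_char_0 itself \<Rightarrow> 'h feyn_theory \<Rightarrow> 'h fgraph \<Rightarrow> bool" where
  "primitive_graph K T x \<longleftrightarrow>
     (fg_coproduct T x :: _ \<Rightarrow>\<^sub>0 'k) =
       Poly_Mapping.single (x, one_graph) 1 + Poly_Mapping.single (one_graph, x) 1"

subsection \<open>Gradations\<close>

definition nverts :: "'h feyn_theory \<Rightarrow> nat" where
  "nverts T = card (vtypes T)"

definition ntypes :: "'h feyn_theory \<Rightarrow> nat" where
  "ntypes T = card (vtypes T) + card (etypes T)"

definition enumerates :: "'h feyn_theory \<Rightarrow> (nat \<Rightarrow> 'h multiset) \<Rightarrow> bool" where
  "enumerates T t \<longleftrightarrow>
     bij_betw t {..<nverts T} (vtypes T) \<and> bij_betw t {nverts T..<ntypes T} (etypes T)"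

definition V_vec :: "'h feyn_theory \<Rightarrow> (nat \<Rightarrow> 'h multiset) \<Rightarrow> 'h fgraph \<Rightarrow> rat vec" where
  "V_vec T t x = vec (nverts T) (\<lambda>j. of_nat (v_count (t j) x))"

definition S_vec :: "'h feyn_theory \<Rightarrow> (nat \<Rightarrow> 'h multiset) \<Rightarrow> 'h fgraph \<Rightarrow> rat vec" where
  "S_vec T t x = vec (ntypes T) (\<lambda>j. of_nat (s_count (t j) x))"

definition pad_zero :: "'h feyn_theory \<Rightarrow> rat mat \<Rightarrow> rat mat" where
  "pad_zero T C = mat (dim_row C) (ntypes T) (\<lambda>(r, j). if j < nverts T then C $$ (r, j) else 0)"

definition graph_deg ::
    "'h feyn_theory \<Rightarrow> (nat \<Rightarrow> 'h multiset) \<Rightarrow> rat mat \<Rightarrow> 'h fgraph \<Rightarrow> rat vec" where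
  "graph_deg T t C x = C *\<^sub>v V_vec T t x - pad_zero T C *\<^sub>v S_vec T t x"

definition connected_gradation ::
    "'h feyn_theory \<Rightarrow> nat \<Rightarrow> ('h fgraph \<Rightarrow> rat vec) \<Rightarrow> bool" where
  "connected_gradation T N deg \<longleftrightarrow>
     (\<forall>x. is_feynman T (rep_fgraph x) \<longrightarrow>
        (\<exists>\<alpha> \<in> carrier_vec N. deg x = map_vec (of_nat :: nat \<Rightarrow> rat) \<alpha>) \<and>
        (x \<noteq> one_graph \<longrightarrow> deg x \<noteq> 0\<^sub>v N)) \<and>
     (\<forall>\<alpha> \<in> carrier_vec N.
        finite {x. is_feynman T (rep_fgraph x) \<and> deg x = map_vec (of_nat :: nat \<Rightarrow> rat) \<alpha>})"

section \<open>Decorated rooted trees\<close>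

datatype 'd dtree = Node 'd "'d dtree multiset"

type_synonym 'd forest = "'d dtree multiset"

text \<open>
  Polynomial mappings from forests form the monoid algebra of the free commutative monoid on
  decorated rooted trees, that is, the free commutative algebra generated by these trees. Likewise
  polynomial mappings from pairs of forests form its tensor square, with the usual product.
\<close>

type_synonym ('d, 'k) tree_alg = "'d forest \<Rightarrow>\<^sub>0 'k"
type_synonym ('d, 'k) tree_alg2 = "('d forest \<times> 'd forest) \<Rightarrow>\<^sub>0 'k"

primrec tree_decs :: "'d dtree \<Rightarrow> 'd multiset" where
  "tree_decs (Node d F) = add_mset d (\<Sum>\<^sub># (image_mset tree_decs F))"

definition decs :: "'d forest \<Rightarrow> 'd multiset" where
  "decs F = \<Sum>\<^sub># (image_mset tree_decs F)"

definition H_trees :: "'d set \<Rightarrow> ('d, 'k::field_char_0) tree_alg set" where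
  "H_trees D = {x. \<forall>F\<in>Poly_Mapping.keys x. set_mset (decs F) \<subseteq> D}"

definition lin_ext ::
    "('a \<Rightarrow> 'b::comm_monoid_add \<Rightarrow>\<^sub>0 'k::field_char_0) \<Rightarrow> ('a \<Rightarrow>\<^sub>0 'k) \<Rightarrow> ('b \<Rightarrow>\<^sub>0 'k)" where
  "lin_ext f x =
     (\<Sum>a\<in>Poly_Mapping.keys x. Poly_Mapping.single 0 (Poly_Mapping.lookup x a) * f a)"

definition basis :: "'a \<Rightarrow> 'a \<Rightarrow>\<^sub>0 'k::field_char_0" where
  "basis a = Poly_Mapping.single a 1"

definition tensor ::
    "('d, 'k::field_char_0) tree_alg \<Rightarrow> ('d, 'k) tree_alg \<Rightarrow> ('d, 'k) tree_alg2" where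
  "tensor x y = lin_ext (\<lambda>F. lin_ext (\<lambda>G. basis (F, G)) y) x"

definition B_plus :: "'d \<Rightarrow> ('d, 'k::field_char_0) tree_alg \<Rightarrow> ('d, 'k) tree_alg" where
  "B_plus d = lin_ext (\<lambda>F. basis {#Node d F#})"

definition id_tensor_B_plus ::
    "'d \<Rightarrow> ('d, 'k::field_char_0) tree_alg2 \<Rightarrow> ('d, 'k) tree_alg2" where
  "id_tensor_B_plus d = lin_ext (\<lambda>(F, G). basis (F, {#Node d G#}))"

primrec tree_coproduct :: "'d dtree \<Rightarrow> ('d, 'k::field_char_0) tree_alg2" where
  "tree_coproduct (Node d F) =
     basis ({#Node d F#}, {#}) + id_tensor_B_plus d (\<Prod>\<^sub># (image_mset tree_coproduct F))"

definition coproduct :: "('d, 'k::field_char_0) tree_alg \<Rightarrow> ('d, 'k) tree_alg2" where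
  "coproduct = lin_ext (\<lambda>F. \<Prod>\<^sub># (image_mset tree_coproduct F))"

lemma lin_ext_superset:
  assumes "finite A" "Poly_Mapping.keys x \<subseteq> A"
  shows "lin_ext f x = (\<Sum>a\<in>A. Poly_Mapping.single 0 (Poly_Mapping.lookup x a) * f a)"
  unfolding lin_ext_def using assms
  by (intro sum.mono_neutral_left) (auto simp: in_keys_iff)

lemma lin_ext_add: "lin_ext f (x + y) = lin_ext f x + lin_ext f y"
proof -
  let ?A = "Poly_Mapping.keys x \<union> Poly_Mapping.keys y"
  have "Poly_Mapping.keys (x + y) \<subseteq> ?A" by (rule keys_add)
  then have "lin_ext f (x + y) =
      (\<Sum>a\<in>?A. Poly_Mapping.single 0 (Poly_Mapping.lookup (x + y) a) * f a)"
    by (intro lin_ext_superset) auto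
  moreover have "lin_ext f x = (\<Sum>a\<in>?A. Poly_Mapping.single 0 (Poly_Mapping.lookup x a) * f a)"
    "lin_ext f y = (\<Sum>a\<in>?A. Poly_Mapping.single 0 (Poly_Mapping.lookup y a) * f a)"
    by (intro lin_ext_superset; auto)+
  ultimately show ?thesis
    by (simp add: lookup_add single_add distrib_right sum.distrib)
qed

lemma lin_ext_zero [simp]: "lin_ext f 0 = 0"
  by (simp add: lin_ext_def)

lemma lin_ext_sum: "lin_ext f (\<Sum>i\<in>I. g i) = (\<Sum>i\<in>I. lin_ext f (g i))"
  by (induction I rule: infinite_finite_induct) (auto simp: lin_ext_add)

lemma lin_ext_single: "lin_ext f (Poly_Mapping.single a c) = Poly_Mapping.single 0 c * f a"
  by (subst lin_ext_superset[of "{a}"]) auto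

lemma lin_ext_basis [simp]: "lin_ext f (basis a) = f a"
  by (simp add: basis_def lin_ext_single)

lemma sum_singles: "x = (\<Sum>a\<in>Poly_Mapping.keys x. Poly_Mapping.single a (Poly_Mapping.lookup x a))"
  by (rule poly_mapping_eqI)
    (auto simp: lookup_sum lookup_single when_def in_keys_iff)

lemma lin_ext_mult:
  fixes f :: "'a::comm_monoid_add \<Rightarrow> 'b::comm_monoid_add \<Rightarrow>\<^sub>0 'k::field_char_0"
  assumes "\<And>a b. f (a + b) = f a * f b"
  shows "lin_ext f (x * y) = lin_ext f x * lin_ext f y"
proof -
  let ?s = "\<lambda>x a. Poly_Mapping.single a (Poly_Mapping.lookup x a)"
  have "x * y = (\<Sum>a\<in>Poly_Mapping.keys x. \<Sum>b\<in>Poly_Mapping.keys y. ?s x a * ?s y b)"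
    using arg_cong2[of _ _ _ _ "(*)", OF sum_singles[of x] sum_singles[of y]]
    by (simp only: sum_product)
  then have "lin_ext f (x * y) =
      (\<Sum>a\<in>Poly_Mapping.keys x. \<Sum>b\<in>Poly_Mapping.keys y. lin_ext f (?s x a * ?s y b))"
    by (simp add: lin_ext_sum)
  moreover have "lin_ext f (?s x a * ?s y b) =
     (Poly_Mapping.single 0 (Poly_Mapping.lookup x a) * f a) *
     (Poly_Mapping.single 0 (Poly_Mapping.lookup y b) * f b)" for a b
  proof -
    let ?c = "Poly_Mapping.lookup x a" and ?d = "Poly_Mapping.lookup y b"
    have "lin_ext f (?s x a * ?s y b) = Poly_Mapping.single 0 (?c * ?d) * (f a * f b)"
      by (simp only: mult_single lin_ext_single assms)
    also have "Poly_Mapping.single (0 :: 'b) (?c * ?d) =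
        Poly_Mapping.single 0 ?c * Poly_Mapping.single 0 ?d"
      by (simp add: mult_single)
    finally show ?thesis by (simp only: ac_simps)
  qed
  ultimately show ?thesis
    by (simp only: lin_ext_def[of f x] lin_ext_def[of f y] sum_product)
qed

text \<open>The recursive definition of the coproduct yields the algebra morphism characterised by the
  cocycle identity.\<close>

lemma coproduct_add: "coproduct (x + y) = coproduct x + coproduct y"
  by (simp add: coproduct_def lin_ext_add)

lemma coproduct_mult: "coproduct (x * y) = coproduct x * coproduct y"
  unfolding coproduct_def by (rule lin_ext_mult) simp

lemma coproduct_const:
  "coproduct (Poly_Mapping.single 0 c) = Poly_Mapping.single 0 c"
  by (simp add: coproduct_def lin_ext_single)

lemma lin_ext_lin_ext:
  fixes g :: "('a::comm_monoid_add \<Rightarrow>\<^sub>0 'k::field_char_0) \<Rightarrow> ('b::comm_monoid_add \<Rightarrow>\<^sub>0 'k)"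
    and x :: "'c \<Rightarrow>\<^sub>0 'k"
  assumes "\<And>c z. g (Poly_Mapping.single 0 c * z) = Poly_Mapping.single 0 c * g z"
    and "\<And>y z. g (y + z) = g y + g z"
  shows "g (lin_ext f x) = lin_ext (\<lambda>a. g (f a)) x"
proof -
  have g0: "g 0 = 0" using assms(1)[of 0 0] by simp
  have sum: "g (\<Sum>a\<in>A. h a) = (\<Sum>a\<in>A. g (h a))" for A :: "'c set" and h
    by (induction A rule: infinite_finite_induct) (simp_all add: g0 assms(2))
  show ?thesis
    unfolding lin_ext_def sum assms(1) ..
qed

lemma lookup_scale:
  "Poly_Mapping.lookup (Poly_Mapping.single 0 c * z) a = c * Poly_Mapping.lookup z a"
  for z :: "'a::comm_monoid_add \<Rightarrow>\<^sub>0 'k::field_char_0"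
  by (simp add: Poly_Mapping.map.rep_eq when_def flip: mult_map_scale_conv_mult)

lemma lin_ext_scale:
  fixes z :: "'a::comm_monoid_add \<Rightarrow>\<^sub>0 'k::field_char_0"
    and f :: "'a \<Rightarrow> 'b::comm_monoid_add \<Rightarrow>\<^sub>0 'k"
  shows "lin_ext f (Poly_Mapping.single 0 c * z) = Poly_Mapping.single 0 c * lin_ext f z"
proof -
  have "Poly_Mapping.keys (Poly_Mapping.single 0 c * z) \<subseteq> Poly_Mapping.keys z"
    by (auto simp: in_keys_iff lookup_scale)
  then have "lin_ext f (Poly_Mapping.single 0 c * z) =
     (\<Sum>a\<in>Poly_Mapping.keys z. Poly_Mapping.single 0 (c * Poly_Mapping.lookup z a) * f a)"
    by (subst lin_ext_superset[of "Poly_Mapping.keys z"]) (auto simp: lookup_scale)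
  also have "\<dots> = (\<Sum>a\<in>Poly_Mapping.keys z.
      Poly_Mapping.single 0 c * (Poly_Mapping.single 0 (Poly_Mapping.lookup z a) * f a))"
  proof (rule sum.cong)
    fix a
    have "Poly_Mapping.single (0 :: 'b) (c * Poly_Mapping.lookup z a) =
        Poly_Mapping.single 0 c * Poly_Mapping.single 0 (Poly_Mapping.lookup z a)"
      by (simp add: mult_single)
    then show "Poly_Mapping.single 0 (c * Poly_Mapping.lookup z a) * f a =
        Poly_Mapping.single 0 c * (Poly_Mapping.single 0 (Poly_Mapping.lookup z a) * f a)"
      by (simp only: mult.assoc)
  qed simp
  finally show ?thesis by (simp only: lin_ext_def sum_distrib_left)
qed

lemma tensor_one:
  fixes x :: "('d, 'k::field_char_0) tree_alg"
  shows "tensor x 1 = lin_ext (\<lambda>F. basis (F, {#})) x"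
proof -
  have one: "(1 :: ('d, 'k) tree_alg) = basis {#}"
    by (simp add: basis_def flip: single_one)
  show ?thesis
    unfolding tensor_def one lin_ext_basis ..
qed

lemma coproduct_B_plus:
  "coproduct (B_plus d x) = tensor (B_plus d x) 1 + id_tensor_B_plus d (coproduct x)"
proof -
  have "coproduct (B_plus d x) = lin_ext (\<lambda>F. tree_coproduct (Node d F)) x"
    unfolding B_plus_def coproduct_def
    by (subst lin_ext_lin_ext) (simp_all only: lin_ext_add lin_ext_scale lin_ext_basis image_mset_single prod_mset_singleton)
  also have "\<dots> = lin_ext (\<lambda>F. basis ({#Node d F#}, {#})) x
      + lin_ext (\<lambda>F. id_tensor_B_plus d (\<Prod>\<^sub># (image_mset tree_coproduct F))) x"
    by (simp add: lin_ext_def distrib_left sum.distrib)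
  also have "lin_ext (\<lambda>F. basis ({#Node d F#}, {#})) x = tensor (B_plus d x) 1"
    unfolding tensor_one B_plus_def
    by (subst lin_ext_lin_ext) (simp_all only: lin_ext_add lin_ext_scale lin_ext_basis image_mset_single prod_mset_singleton)
  also have "lin_ext (\<lambda>F. id_tensor_B_plus d (\<Prod>\<^sub># (image_mset tree_coproduct F))) x
      = id_tensor_B_plus d (coproduct x)"
    unfolding coproduct_def id_tensor_B_plus_def
    by (subst lin_ext_lin_ext[of "lin_ext (\<lambda>(F, G). basis (F, {#Node d G#}))"])
      (simp_all only: lin_ext_add lin_ext_scale)
  finally show ?thesis .
qed

subsection \<open>Hopf subalgebras\<close>

definition subalgebra :: "('d, 'k::field_char_0) tree_alg set \<Rightarrow> bool" where
  "subalgebra A \<longleftrightarrow> 1 \<in> A \<and> (\<forall>x\<in>A. \<forall>y\<in>A. x + y \<in> A \<and> x * y \<in> A) \<and>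
     (\<forall>c. \<forall>x\<in>A. Poly_Mapping.single 0 c * x \<in> A)"

inductive_set generated_subalgebra ::
    "('d, 'k::field_char_0) tree_alg set \<Rightarrow> ('d, 'k) tree_alg set"
  for S where
  one: "1 \<in> generated_subalgebra S"
| gen: "x \<in> S \<Longrightarrow> x \<in> generated_subalgebra S"
| add: "x \<in> generated_subalgebra S \<Longrightarrow> y \<in> generated_subalgebra S \<Longrightarrow>
    x + y \<in> generated_subalgebra S"
| mult: "x \<in> generated_subalgebra S \<Longrightarrow> y \<in> generated_subalgebra S \<Longrightarrow>
    x * y \<in> generated_subalgebra S"
| scale: "x \<in> generated_subalgebra S \<Longrightarrow>
    Poly_Mapping.single 0 c * x \<in> generated_subalgebra S"

definition tensor_square :: "('d, 'k::field_char_0) tree_alg set \<Rightarrow> ('d, 'k) tree_alg2 set" where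
  "tensor_square A = {\<Sum>i<n. tensor (a i) (b i) | n a b. \<forall>i<n::nat. a i \<in> A \<and> b i \<in> A}"

definition counit :: "('d, 'k::field_char_0) tree_alg \<Rightarrow> 'k" where
  "counit x = Poly_Mapping.lookup x {#}"

definition is_antipode ::
    "'d set \<Rightarrow> (('d, 'k::field_char_0) tree_alg \<Rightarrow> ('d, 'k) tree_alg) \<Rightarrow> bool" where
  "is_antipode D S \<longleftrightarrow>
     S ` H_trees D \<subseteq> H_trees D \<and>
     (\<forall>x\<in>H_trees D. \<forall>y\<in>H_trees D. S (x + y) = S x + S y) \<and>
     (\<forall>c. \<forall>x\<in>H_trees D. S (Poly_Mapping.single 0 c * x) = Poly_Mapping.single 0 c * S x) \<and>
     (\<forall>x\<in>H_trees D.
        lin_ext (\<lambda>(F, G). S (basis F) * basis G) (coproduct x)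
          = Poly_Mapping.single 0 (counit x) \<and>
        lin_ext (\<lambda>(F, G). basis F * S (basis G)) (coproduct x)
          = Poly_Mapping.single 0 (counit x))"

text \<open>
  An antipode is determined on \<^term>\<open>H_trees D\<close> by the last two equations.
\<close>

definition hopf_subalgebra :: "'d set \<Rightarrow> ('d, 'k::field_char_0) tree_alg set \<Rightarrow> bool" where
  "hopf_subalgebra D A \<longleftrightarrow>
     A \<subseteq> H_trees D \<and> subalgebra A \<and> coproduct ` A \<subseteq> tensor_square A \<and>
     (\<exists>S. is_antipode D S \<and> S ` A \<subseteq> A)"

section \<open>Formal series of forests\<close>

typedef ('d, 'k) fseries = "UNIV :: ('d forest \<Rightarrow> 'k) set"
  morphisms fcoeff Abs_fseries ..

setup_lifting type_definition_fseries

lemma fseries_eqI: "(\<And>F. fcoeff x F = fcoeff y F) \<Longrightarrow> x = y"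
  by transfer auto

lemma finite_submsets [simp]: "finite {A. A \<subseteq># F}"
proof (induction F)
  case (add a F)
  have "{A. A \<subseteq># add_mset a F} \<subseteq> {A. A \<subseteq># F} \<union> add_mset a ` {A. A \<subseteq># F}"
  proof
    fix A assume A: "A \<in> {A. A \<subseteq># add_mset a F}"
    then have "A - {#a#} \<subseteq># F" by (simp add: subset_eq_diff_conv)
    moreover have "A = A - {#a#} \<or> A = add_mset a (A - {#a#})"
      by (metis diff_single_trivial insert_DiffM)
    ultimately show "A \<in> {A. A \<subseteq># F} \<union> add_mset a ` {A. A \<subseteq># F}"
      by (metis UnCI image_eqI mem_Collect_eq)
  qed
  then show ?case using add by (meson finite_UnI finite_imageI finite_subset)
qed auto

lemma subset_mset_diff_mono: "A \<subseteq># F \<Longrightarrow> A - B \<subseteq># F - B"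
  by (simp add: subseteq_mset_def diff_le_mono)

lemma add_subset_diff: "B \<subseteq># F \<Longrightarrow> C \<subseteq># F - B \<Longrightarrow> B + C \<subseteq># F"
  by (metis subset_mset.add_left_mono subset_mset.add_diff_inverse)

lemma diff_diff_submset: "B \<subseteq># A \<Longrightarrow> F - B - (A - B) = F - A"
  by (metis diff_diff_add subset_mset.add_diff_inverse)

instantiation fseries :: (type, comm_ring_1) comm_ring_1
begin

lift_definition zero_fseries :: "('a, 'b) fseries" is "\<lambda>_. 0" .
lift_definition one_fseries :: "('a, 'b) fseries" is "\<lambda>F. if F = {#} then 1 else 0" .
lift_definition plus_fseries :: "('a, 'b) fseries \<Rightarrow> ('a, 'b) fseries \<Rightarrow> ('a, 'b) fseries"
  is "\<lambda>x y F. x F + y F" .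
lift_definition minus_fseries :: "('a, 'b) fseries \<Rightarrow> ('a, 'b) fseries \<Rightarrow> ('a, 'b) fseries"
  is "\<lambda>x y F. x F - y F" .
lift_definition uminus_fseries :: "('a, 'b) fseries \<Rightarrow> ('a, 'b) fseries" is "\<lambda>x F. - x F" .
lift_definition times_fseries :: "('a, 'b) fseries \<Rightarrow> ('a, 'b) fseries \<Rightarrow> ('a, 'b) fseries"
  is "\<lambda>x y F. \<Sum>A | A \<subseteq># F. x A * y (F - A)" .

instance
proof
  fix x y z :: "('a, 'b) fseries"
  show "x + y + z = x + (y + z)" by transfer (simp add: add.assoc)
  show "x + y = y + x" by transfer (simp add: add.commute)
  show "0 + x = x" by transfer simp
  show "- x + x = 0" by transfer simp
  show "x - y = x + - y" by transfer simp
  show "(0 :: ('a, 'b) fseries) \<noteq> 1" by transfer (metis zero_neq_one)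
  show "(x + y) * z = x * z + y * z" by transfer (simp add: distrib_right sum.distrib)
  show "x * y = y * x"
  proof (transfer, rule ext)
    fix x y :: "'a forest \<Rightarrow> 'b" and F
    show "(\<Sum>A | A \<subseteq># F. x A * y (F - A)) = (\<Sum>A | A \<subseteq># F. y A * x (F - A))"
      by (rule sum.reindex_bij_witness[of _ "\<lambda>A. F - A" "\<lambda>A. F - A"])
        (auto simp: mult.commute subset_mset.diff_diff_right)
  qed
  show "1 * x = x"
  proof (transfer, rule ext)
    fix x :: "'a forest \<Rightarrow> 'b" and F
    have "(\<Sum>A | A \<subseteq># F. (if A = {#} then 1 else 0) * x (F - A))
        = (\<Sum>A\<in>{{#}}. (if A = {#} then 1 else 0) * x (F - A))"
      by (rule sum.mono_neutral_right) auto
    then show "(\<Sum>A | A \<subseteq># F. (if A = {#} then 1 else 0) * x (F - A)) = x F" by simp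
  qed
  show "x * y * z = x * (y * z)"
  proof (transfer, rule ext)
    fix x y z :: "'a forest \<Rightarrow> 'b" and F
    have "(\<Sum>A | A \<subseteq># F. (\<Sum>B | B \<subseteq># A. x B * y (A - B)) * z (F - A))
       = (\<Sum>(A, B)\<in>(SIGMA A:{A. A \<subseteq># F}. {B. B \<subseteq># A}). x B * y (A - B) * z (F - A))"
      by (simp add: sum_distrib_right sum.Sigma)
    also have "\<dots> = (\<Sum>(B, C)\<in>(SIGMA B:{B. B \<subseteq># F}. {C. C \<subseteq># F - B}).
        x B * (y C * z (F - B - C)))"
    proof (rule sum.reindex_bij_witness
          [of _ "\<lambda>(B, C). (B + C, B)" "\<lambda>(A, B). (B, A - B)"], goal_cases)
      case (2 p)
      then show ?case by (auto dest: subset_mset.order_trans subset_mset_diff_mono)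
    next
      case (4 p)
      then show ?case by (auto simp: add_subset_diff)
    next
      case (5 p)
      then show ?case by (auto simp: diff_diff_submset mult.assoc)
    qed auto
    also have "\<dots> = (\<Sum>B | B \<subseteq># F. x B * (\<Sum>C | C \<subseteq># F - B. y C * z (F - B - C)))"
      by (simp add: sum_distrib_left sum.Sigma)
    finally show "(\<Sum>A | A \<subseteq># F. (\<Sum>B | B \<subseteq># A. x B * y (A - B)) * z (F - A))
       = (\<Sum>B | B \<subseteq># F. x B * (\<Sum>C | C \<subseteq># F - B. y C * z (F - B - C)))" .
  qed
qed

end

lift_definition fconst :: "'k::zero \<Rightarrow> ('d, 'k) fseries" is "\<lambda>c F. if F = {#} then c else 0" .

text \<open>
  Sum of a family of series of which only finitely many have a nonzero coefficient at any given
  forest.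
\<close>

definition fsum :: "'i set \<Rightarrow> ('i \<Rightarrow> ('d, 'k::field_char_0) fseries) \<Rightarrow> ('d, 'k) fseries" where
  "fsum I x = Abs_fseries (\<lambda>F. \<Sum>i | i \<in> I \<and> fcoeff (x i) F \<noteq> 0. fcoeff (x i) F)"

text \<open>
  Substitution of a series without constant term into a power series in one indeterminate: the
  power \<^term>\<open>x ^ n\<close> has no coefficient at forests with fewer than \<^term>\<open>n\<close> trees.
\<close>

definition fps_eval :: "'k::field_char_0 fps \<Rightarrow> ('d, 'k) fseries \<Rightarrow> ('d, 'k) fseries" where
  "fps_eval f x = Abs_fseries (\<lambda>F. \<Sum>n\<le>size F. fps_nth f n * fcoeff (x ^ n) F)"

text \<open>The sum has at most one summand.\<close>

definition graft :: "'d \<Rightarrow> ('d, 'k::field_char_0) fseries \<Rightarrow> ('d, 'k) fseries" where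
  "graft d x = Abs_fseries (\<lambda>F. \<Sum>F' | F = {#Node d F'#}. fcoeff x F')"

definition forest_deg :: "nat \<Rightarrow> ('d \<Rightarrow> rat vec) \<Rightarrow> 'd forest \<Rightarrow> rat vec" where
  "forest_deg N deg F = vec N (\<lambda>r. \<Sum>d\<in>#decs F. deg d $ r)"

definition hom_component ::
    "nat \<Rightarrow> ('d \<Rightarrow> rat vec) \<Rightarrow> ('d, 'k::field_char_0) fseries \<Rightarrow> nat vec \<Rightarrow> ('d, 'k) tree_alg" where
  "hom_component N deg x \<alpha> =
     Abs_poly_mapping (\<lambda>F. if forest_deg N deg F = map_vec of_nat \<alpha> then fcoeff x F else 0)"

section \<open>The Dyson-Schwinger system of a theory\<close>
definition primitives ::
    "'k::field_char_0 itself \<Rightarrow> 'h feyn_theory \<Rightarrow> (nat \<Rightarrow> 'h multiset) \<Rightarrow> nat \<Rightarrow> 'h fgraph set" where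
  "primitives K T t i =
     {x. is_1PI T (rep_fgraph x) \<and> primitive_graph K T x \<and> ext_type (rep_fgraph x) = t i}"

definition all_primitives ::
    "'k::field_char_0 itself \<Rightarrow> 'h feyn_theory \<Rightarrow> (nat \<Rightarrow> 'h multiset) \<Rightarrow> 'h fgraph set" where
  "all_primitives K T t = (\<Union>i<ntypes T. primitives K T t i)"

definition dse_rhs ::
    "'h feyn_theory \<Rightarrow> (nat \<Rightarrow> 'h multiset) \<Rightarrow> nat \<Rightarrow>
     (nat \<Rightarrow> ('h fgraph, 'k::field_char_0) fseries) \<Rightarrow> ('h fgraph, 'k) fseries" where
  "dse_rhs T t i Y =
     fsum (primitives TYPE('k) T t i) (\<lambda>x. graft x
       ((\<Prod>j<nverts T. (1 + Y j) ^ v_count (t j) x) *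
        (\<Prod>j=nverts T..<ntypes T.
           fps_eval (inverse (1 - fps_X) ^ e_count (t j) x) (Y j))))"

text \<open>
  There are \<^term>\<open>ntypes T\<close> unknowns, numbered from \<open>0\<close>; the entries beyond them are set to
  zero so that the solution is unique as a function.
\<close>

definition dse_solves ::
    "'h feyn_theory \<Rightarrow> (nat \<Rightarrow> 'h multiset) \<Rightarrow>
     (nat \<Rightarrow> ('h fgraph, 'k::field_char_0) fseries) \<Rightarrow> bool" where
  "dse_solves T t Y \<longleftrightarrow> (\<forall>i<ntypes T. Y i = dse_rhs T t i Y) \<and> (\<forall>i\<ge>ntypes T. Y i = 0)"

definition dse_solution ::
    "'h feyn_theory \<Rightarrow> (nat \<Rightarrow> 'h multiset) \<Rightarrow> nat \<Rightarrow>
     ('h fgraph, 'k::field_char_0) fseries" where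
  "dse_solution T t = (THE Y. dse_solves T t Y)"

text \<open>Existence and uniqueness of the solution.\<close>

definition agree :: "nat \<Rightarrow> ('d, 'k) fseries \<Rightarrow> ('d, 'k) fseries \<Rightarrow> bool" where
  "agree n x y \<longleftrightarrow> (\<forall>F. size (decs F) < n \<longrightarrow> fcoeff x F = fcoeff y F)"

lemma agree_refl [simp]: "agree n x x"
  by (simp add: agree_def)

lemma agree_eqI: "(\<And>n. agree n x y) \<Longrightarrow> x = y"
  by (rule fseries_eqI) (meson agree_def lessI)

lemma agree_add: "agree n x y \<Longrightarrow> agree n x' y' \<Longrightarrow> agree n (x + x') (y + y')"
  for x :: "('d, 'k::field_char_0) fseries"
  by (simp add: agree_def plus_fseries.rep_eq)

lemma size_decs_mono: "A \<subseteq># F \<Longrightarrow> size (decs A) \<le> size (decs F)"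
  by (metis decs_def image_mset_union le_add1 size_union subset_mset.add_diff_inverse
      sum_mset.union)

lemma agree_mult:
  fixes x :: "('d, 'k::field_char_0) fseries"
  assumes "agree n x y" "agree n x' y'"
  shows "agree n (x * x') (y * y')"
  unfolding agree_def times_fseries.rep_eq
proof (intro allI impI sum.cong refl)
  fix F A :: "'d forest"
  assume "size (decs F) < n" "A \<in> {A. A \<subseteq># F}"
  then have "size (decs A) < n" "size (decs (F - A)) < n"
    using size_decs_mono[of A F] size_decs_mono[of "F - A" F] by auto
  then show "fcoeff x A * fcoeff x' (F - A) = fcoeff y A * fcoeff y' (F - A)"
    using assms by (simp add: agree_def)
qed

lemma agree_power: "agree n x y \<Longrightarrow> agree n (x ^ m) (y ^ m)"
  for x :: "('d, 'k::field_char_0) fseries"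
  by (induction m) (auto intro: agree_mult)

lemma agree_prod:
  fixes f :: "'i \<Rightarrow> ('d, 'k::field_char_0) fseries"
  assumes "\<And>i. i \<in> I \<Longrightarrow> agree n (f i) (g i)"
  shows "agree n (\<Prod>i\<in>I. f i) (\<Prod>i\<in>I. g i)"
  using assms by (induction I rule: infinite_finite_induct) (auto intro: agree_mult)

lemma agree_fps_eval: "agree n x y \<Longrightarrow> agree n (fps_eval f x) (fps_eval f y)"
  using agree_power[of n x y] unfolding agree_def fps_eval_def by (simp add: Abs_fseries_inverse)

lemma agree_graft:
  assumes "agree n x y" shows "agree (Suc n) (graft d x) (graft d y)"
  unfolding agree_def graft_def
  using assms by (auto simp: Abs_fseries_inverse agree_def decs_def intro!: sum.cong)

lemma agree_fsum:
  assumes "\<And>i. i \<in> I \<Longrightarrow> agree n (x i) (y i)"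
  shows "agree n (fsum I x) (fsum I y)"
  unfolding agree_def fsum_def
proof (intro allI impI)
  fix F :: "'b forest" assume "size (decs F) < n"
  then have "fcoeff (x i) F = fcoeff (y i) F" if "i \<in> I" for i
    using assms[OF that] by (simp add: agree_def)
  then show "fcoeff (Abs_fseries (\<lambda>F. \<Sum>i | i \<in> I \<and> fcoeff (x i) F \<noteq> 0. fcoeff (x i) F)) F =
        fcoeff (Abs_fseries (\<lambda>F. \<Sum>i | i \<in> I \<and> fcoeff (y i) F \<noteq> 0. fcoeff (y i) F)) F"
    by (auto simp: Abs_fseries_inverse intro!: sum.cong)
qed

lemma agree_dse_rhs:
  assumes "\<And>j. agree n (Y j) (Z j)"
  shows "agree (Suc n) (dse_rhs T t i Y) (dse_rhs T t i Z)"
  unfolding dse_rhs_def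
  by (intro agree_fsum agree_graft agree_mult agree_prod agree_power agree_add agree_fps_eval
      agree_refl assms)

lemma dse_solution_unique:
  fixes T :: "'h feyn_theory"
  shows "\<exists>!Y :: nat \<Rightarrow> ('h fgraph, 'k::field_char_0) fseries. dse_solves T t Y"
proof (rule ex_ex1I)
  define W :: "nat \<Rightarrow> nat \<Rightarrow> ('h fgraph, 'k) fseries" where "W = rec_nat (\<lambda>_. 0) (\<lambda>_ Z i. if i < ntypes T then dse_rhs T t i Z else 0)"
  have W0: "W 0 = (\<lambda>_. 0)"
    and W_Suc: "W (Suc n) = (\<lambda>i. if i < ntypes T then dse_rhs T t i (W n) else 0)" for n
    unfolding W_def by simp_all
  have step: "agree n (W n i) (W (Suc n) i)" for n i
  proof (induction n arbitrary: i)
    case 0 show ?case by (simp add: agree_def)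
  next
    case (Suc n)
    then show ?case
      unfolding W_Suc[of n] W_Suc[of "Suc n"] by (auto intro: agree_dse_rhs)
  qed
  have W_agree: "agree n (W n i) (W (n + m) i)" for n m i
  proof (induction m)
    case (Suc m)
    then show ?case using step[of "n + m" i] by (auto simp: agree_def)
  qed simp
  define Y where "Y = (\<lambda>i. Abs_fseries (\<lambda>F. fcoeff (W (Suc (size (decs F))) i) F))"
  have Y: "agree n (Y i) (W n i)" for n i
    unfolding agree_def
  proof (intro allI impI)
    fix F :: "'h fgraph forest" assume "size (decs F) < n"
    then obtain m where n: "n = Suc (size (decs F)) + m"
      using less_imp_Suc_add by auto
    have "fcoeff (Y i) F = fcoeff (W (Suc (size (decs F))) i) F"
      by (simp add: Y_def Abs_fseries_inverse)
    also have "\<dots> = fcoeff (W n i) F"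
      using W_agree[of "Suc (size (decs F))" i m] unfolding n agree_def by blast
    finally show "fcoeff (Y i) F = fcoeff (W n i) F" .
  qed
  have "dse_solves T t Y"
    unfolding dse_solves_def
  proof (intro conjI allI impI)
    fix i assume i: "i < ntypes T"
    show "Y i = dse_rhs T t i Y"
    proof (rule agree_eqI)
      fix n
      have "agree (Suc n) (Y i) (dse_rhs T t i (W n))"
        using Y[of "Suc n" i] i by (simp add: W_Suc)
      moreover have "agree (Suc n) (dse_rhs T t i Y) (dse_rhs T t i (W n))"
        by (rule agree_dse_rhs) (rule Y)
      ultimately show "agree n (Y i) (dse_rhs T t i Y)" by (simp add: agree_def)
    qed
  next
    fix i assume "ntypes T \<le> i"
    then have "fcoeff (Y i) F = 0" for F
      by (simp add: Y_def W_Suc zero_fseries.rep_eq Abs_fseries_inverse)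
    then show "Y i = 0"
      by (intro fseries_eqI) (simp add: zero_fseries.rep_eq)
  qed
  then show "\<exists>Y :: nat \<Rightarrow> ('h fgraph, 'k) fseries. dse_solves T t Y" by (rule exI[of _ Y])
next
  fix Y Z :: "nat \<Rightarrow> ('h fgraph, 'k) fseries"
  assume Y: "dse_solves T t Y" and Z: "dse_solves T t Z"
  have "agree n (Y i) (Z i)" for n i
  proof (induction n arbitrary: i)
    case 0 show ?case by (simp add: agree_def)
  next
    case (Suc n)
    then have "agree (Suc n) (dse_rhs T t i Y) (dse_rhs T t i Z)"
      by (rule agree_dse_rhs)
    then show ?case
      using Y Z unfolding dse_solves_def by (metis agree_refl not_less)
  qed
  then show "Y = Z" using agree_eqI by blast
qed

definition dse_algebra ::
    "'h feyn_theory \<Rightarrow> (nat \<Rightarrow> 'h multiset) \<Rightarrow> nat \<Rightarrow> ('h fgraph \<Rightarrow> rat vec) \<Rightarrow>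
     ('h fgraph, 'k::field_char_0) tree_alg set" where
  "dse_algebra T t N deg = generated_subalgebra
     {hom_component N deg (dse_solution T t i) \<alpha> | i \<alpha>. i < ntypes T \<and> \<alpha> \<in> carrier_vec N}"

section \<open>Systems associated to deg1 pre-Lie algebras\<close>

definition F_series :: "'k::field_char_0 \<Rightarrow> 'k \<Rightarrow> 'k fps" where
  "F_series a b = Abs_fps (\<lambda>n. (\<Prod>r<n. a - b * of_nat r) / fact n)"

record 'k deg1_params =
  parts :: nat
  part :: "nat \<Rightarrow> nat set"
  vecA :: "nat \<Rightarrow> 'k vec"
  scb :: "nat \<Rightarrow> 'k"
  scb0 :: "nat \<Rightarrow> nat \<Rightarrow> 'k"

text \<open>
  \<^term>\<open>parts p\<close> is \<open>m\<close>, \<^term>\<open>part p q\<close> is \<open>I\<^sub>q\<close>, \<^term>\<open>vecA p q\<close> is \<open>A\<^sub>q\<close>,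
  \<^term>\<open>scb p q\<close> is \<open>b\<^sub>q\<close>, and \<^term>\<open>scb0 p i q\<close> is \<open>b\<^sub>q\<close> with upper index \<open>(i)\<close>, which
  matters for \<^term>\<open>i \<in> part p 0\<close> only.
\<close>

definition is_deg1_params :: "nat \<Rightarrow> nat \<Rightarrow> 'k::field_char_0 deg1_params \<Rightarrow> bool" where
  "is_deg1_params N M p \<longleftrightarrow>
     (\<Union>q\<le>parts p. part p q) = {..<M} \<and> disjoint_family_on (part p) {..parts p} \<and>
     (\<forall>q\<in>{1..parts p}. part p q \<noteq> {} \<and> vecA p q \<in> carrier_vec N)"

definition pair_deg :: "'k::field_char_0 vec \<Rightarrow> nat vec \<Rightarrow> 'k" where
  "pair_deg a \<alpha> = a \<bullet> map_vec of_nat \<alpha>"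

definition part_of :: "'k deg1_params \<Rightarrow> nat \<Rightarrow> nat" where
  "part_of p i = (THE q. q \<le> parts p \<and> i \<in> part p q)"

text \<open>
  \<^term>\<open>star\<close> is the product of two basis elements; the pair \<^term>\<open>(i, \<alpha>)\<close> is the basis
  element \<open>f\<^sub>i(\<alpha>)\<close>.
\<close>

definition is_deg1_prelie ::
    "nat \<Rightarrow> nat \<Rightarrow> 'k::field_char_0 deg1_params \<Rightarrow>
     (nat \<times> nat vec \<Rightarrow> nat \<times> nat vec \<Rightarrow> (nat \<times> nat vec) \<Rightarrow>\<^sub>0 'k) \<Rightarrow> bool" where
  "is_deg1_prelie N M p star \<longleftrightarrow> is_deg1_params N M p \<and>
     (\<forall>i<M. \<forall>j<M. \<forall>\<alpha>\<in>carrier_vec N - {0\<^sub>v N}. \<forall>\<beta>\<in>carrier_vec N - {0\<^sub>v N}.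
        let q = part_of p j; r = part_of p i in
        star (j, \<beta>) (i, \<alpha>) = Poly_Mapping.single (i, \<alpha> + \<beta>)
          (if q = 0 then 0
           else if r = 0 then pair_deg (vecA p q) \<alpha> + scb0 p i q
           else pair_deg (vecA p q) \<alpha> + (if r = q then scb p q else 0)))"

definition deg1_rhs ::
    "nat \<Rightarrow> 'k::field_char_0 deg1_params \<Rightarrow>
     (nat \<Rightarrow> nat vec \<Rightarrow> ('d, 'k) fseries \<Rightarrow> ('d, 'k) fseries) \<Rightarrow>
     nat \<Rightarrow> (nat \<Rightarrow> ('d, 'k) fseries) \<Rightarrow> ('d, 'k) fseries" where
  "deg1_rhs N p B i Y =
     (let Z = (\<lambda>q. \<Sum>j\<in>part p q. Y j) in
      fsum (carrier_vec N - {0\<^sub>v N}) (\<lambda>\<alpha>. B i \<alpha>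
        ((\<Prod>q=1..parts p. fps_eval (F_series (pair_deg (vecA p q) \<alpha>) (scb p q)) (Z q)) *
         (if i \<in> part p 0
          then \<Prod>q=1..parts p. fps_eval (F_series (scb0 p i q) (scb p q)) (Z q)
          else 1 + fconst (scb p (part_of p i)) * Z (part_of p i)))))"

definition dse_B ::
    "'h feyn_theory \<Rightarrow> (nat \<Rightarrow> 'h multiset) \<Rightarrow> ('h fgraph \<Rightarrow> rat vec) \<Rightarrow> nat \<Rightarrow> nat vec \<Rightarrow>
     ('h fgraph, 'k::field_char_0) fseries \<Rightarrow> ('h fgraph, 'k) fseries" where
  "dse_B T t deg i \<alpha> y =
     fsum {x \<in> primitives TYPE('k) T t i. deg x = map_vec of_nat \<alpha>} (\<lambda>x. graft x y)"

text \<open>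
  The two systems have the same right-hand sides, as functions of arbitrary unknowns without
  constant term.
\<close>

definition dse_is_deg1 ::
    "'k::field_char_0 itself \<Rightarrow> 'h feyn_theory \<Rightarrow> (nat \<Rightarrow> 'h multiset) \<Rightarrow> nat \<Rightarrow>
     ('h fgraph \<Rightarrow> rat vec) \<Rightarrow> bool" where
  "dse_is_deg1 K T t N deg \<longleftrightarrow>
     (\<exists>(p :: 'k deg1_params) star. is_deg1_prelie N (ntypes T) p star \<and>
        (\<forall>i<ntypes T. \<forall>Y. (\<forall>j<ntypes T. fcoeff (Y j) {#} = 0) \<longrightarrow>
           dse_rhs T t i Y = deg1_rhs N p (dse_B T t deg) i Y))"

end

theory Submission
  imports Defs
begin

text \<open>
  Give a primitive graph \<open>G\<close> with external structure of the \<open>i\<close>-th type the exponents \<open>n\<^sub>j(G)\<close>: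
  the numbers of its vertices, respectively of its internal edges, of the \<open>j\<close>-th type. Counting
  the half-edges of a fixed type once at their vertices, and once as external half-edges and
  halves of internal edges, shows that the numbers of edges are determined linearly by the numbers
  of vertices and by the external structure. As \<open>C\<close> has full rank, it has a left inverse, so the
  numbers of vertices are in turn determined by the degree and the external structure. The outcome
  (\<open>exponents_linear\<close>) is \<open>n\<^sub>j(G) = A\<^sub>j \<cdot> deg(G) + \<delta>\<^sub>i\<^sub>j b\<^sub>j\<close> with \<open>b\<^sub>j = 1\<close> for vertex types and
  \<open>b\<^sub>j = -1\<close> for edge types.

  The series \<open>F\<^bsub>a,b\<^esub>\<close> satisfy \<open>F\<^bsub>a,b\<^esub> F\<^bsub>c,b\<^esub> = F\<^bsub>a+c,b\<^esub>\<close>, by the Vandermonde identity, and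
  \<open>F\<^bsub>b,b\<^esub> = 1 + b X\<close>. So \<open>1 + Y\<^sub>j\<close> and \<open>1 / (1 - Y\<^sub>j)\<close> are the values \<open>F\<^bsub>1,b\<^esub>(Y\<^sub>j)\<close> for \<open>b = b\<^sub>j\<close>,
  and the coefficient of \<open>B\<^sub>G\<close> in the \<open>i\<close>-th equation is \<open>W\<^sub>i U(deg G)\<close>
  (\<open>prod_F_series_exponents\<close>), where \<open>W\<^sub>i = 1 + b\<^sub>i Y\<^sub>i\<close> and \<open>U(\<alpha>)\<close> is the product of the
  \<open>F\<^bsub>a,b\<^esub>(Y\<^sub>j)\<close> for \<open>a = A\<^sub>j \<cdot> \<alpha>\<close>, \<open>b = b\<^sub>j\<close>. This is the form of the system of a deg1 pre-Lie
  algebra in which every class of unknowns is a singleton and the class \<open>I\<^sub>0\<close> is empty.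

  For the Hopf property, note that \<open>U(\<alpha> + \<beta>) = U(\<alpha>) U(\<beta>)\<close>. Writing \<open>x(\<beta>)\<close> for homogeneous
  components, call a series \<open>x\<close> twisted grouplike if \<open>\<Delta>(x) = \<Sum>\<^sub>\<beta> x U(\<beta>) \<otimes> x(\<beta>)\<close>. Products and
  inverses of such series have the same property, and if the coefficients \<open>W\<^sub>i U(deg G)\<close> have it,
  then the cocycle identity for \<open>B\<^sub>G\<close> gives \<open>\<Delta>(Y\<^sub>i) = Y\<^sub>i \<otimes> 1 + \<Sum>\<^sub>\<beta> W\<^sub>i U(\<beta>) \<otimes> Y\<^sub>i(\<beta>)\<close>, whence
  \<open>W\<^sub>i\<close> has it as well. Since grafting adds a vertex, this is a proof by induction on the number
  of vertices (\<open>twisted_grouplike_W\<close>). In the resulting formula for \<open>\<Delta>(Y\<^sub>i)\<close> the homogeneous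
  components of \<open>W\<^sub>i U(\<beta>)\<close> are polynomials in those of the \<open>Y\<^sub>j\<close>, so the subalgebra is stable
  under \<open>\<Delta>\<close> (\<open>coproduct_hom_Y\<close>); and the formula expresses the antipode of \<open>Y\<^sub>i(\<alpha>)\<close> by antipodes
  of components of smaller degree (\<open>antipode_hom_Y\<close>).
\<close>

section \<open>Binomial series and formal series of forests\<close>

text \<open>
  For \<open>b \<noteq> 0\<close> the series \<open>F\<^bsub>a,b\<^esub>\<close> is the binomial series \<open>(1 + b X)\<^bsup>a / b\<^esup>\<close>, for \<open>b = 0\<close> it is
  \<open>exp (a X)\<close>.
\<close>

lemma F_series_mult:
  fixes a c b :: "'k::field_char_0"
  shows "F_series a b * F_series c b = F_series (a + c) b"
proof (cases "b = 0")
  case True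
  have "F_series x b = fps_exp x" for x :: 'k
    by (rule fps_ext) (simp add: F_series_def True)
  then show ?thesis by (simp add: fps_exp_add_mult)
next
  case False
  have coeff: "fps_nth (F_series x b) n = b ^ n * ((x / b) gchoose n)" for x :: 'k and n
  proof -
    have "x - b * of_nat r = b * (x / b - of_nat r)" for r
      using False by (simp add: algebra_simps)
    then have "(\<Prod>r<n. x - b * of_nat r) = b ^ n * (\<Prod>r<n. x / b - of_nat r)"
      by (simp add: prod.distrib)
    then show ?thesis
      by (simp add: F_series_def gbinomial_prod_rev atLeast0LessThan)
  qed
  show ?thesis
  proof (rule fps_ext)
    fix n
    have "fps_nth (F_series a b * F_series c b) n =
       (\<Sum>i=0..n. b ^ n * (((a / b) gchoose i) * ((c / b) gchoose (n - i))))"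
      unfolding fps_mult_nth coeff
      by (intro sum.cong refl) (auto simp: algebra_simps simp flip: power_add)
    also have "\<dots> = fps_nth (F_series (a + c) b) n"
      unfolding coeff add_divide_distrib
      by (simp only: gbinomial_Vandermonde flip: sum_distrib_left)
    finally show "fps_nth (F_series a b * F_series c b) n = fps_nth (F_series (a + c) b) n" .
  qed
qed

lemma F_series_0: "F_series 0 b = 1"
proof (rule fps_ext)
  fix n show "fps_nth (F_series 0 b) n = fps_nth 1 n"
    by (cases n) (simp_all add: F_series_def lessThan_Suc_eq_insert_0)
qed

lemma F_series_self: "F_series b b = 1 + fps_const b * fps_X"
proof (rule fps_ext)
  fix n
  have *: "(\<Prod>r<n. b - b * of_nat r) = 0" if "n \<ge> 2"
    using that by (intro prod_zero) (auto intro!: bexI[of _ 1])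
  show "fps_nth (F_series b b) n = fps_nth (1 + fps_const b * fps_X) n"
    using * by (cases "n \<ge> 2") (auto simp: F_series_def fps_X_def not_le less_2_cases_iff)
qed

lemma F_series_of_nat: "F_series (of_nat n * a) b = F_series a b ^ n"
proof (induction n)
  case (Suc n)
  then show ?case
    using F_series_mult[of a b "of_nat n * a"] by (simp add: distrib_right)
qed (simp add: F_series_0)

lemma F_series_vertex: "F_series 1 1 = 1 + fps_X"
  using F_series_self[of 1] by simp

lemma F_series_edge: "F_series 1 (-1) = inverse (1 - fps_X :: 'k::field_char_0 fps)"
proof -
  have "F_series (-1) (-1) = (1 - fps_X :: 'k fps)"
    using F_series_self[of "-1 :: 'k"] by (simp flip: fps_const_neg)
  then have "(1 - fps_X) * F_series 1 (-1) = (1 :: 'k fps)"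
    using F_series_mult[of "-1" "-1 :: 'k" 1] by (simp add: F_series_0)
  then show ?thesis
    by (metis fps_inverse_unique mult.commute)
qed

lemmas fcoeff_simps = plus_fseries.rep_eq minus_fseries.rep_eq zero_fseries.rep_eq
  one_fseries.rep_eq fconst.rep_eq

lemma fcoeff_fconst_mult: "fcoeff (fconst c * x) F = (c :: 'k::field_char_0) * fcoeff x F"
proof -
  have "fcoeff (fconst c * x) F = (\<Sum>A\<in>{{#}}. c * fcoeff x (F - A))"
    unfolding times_fseries.rep_eq fconst.rep_eq
    by (rule sum.mono_neutral_cong_right) auto
  then show ?thesis by simp
qed

lemma fcoeff_mult_empty: "fcoeff (x * y) {#} = fcoeff x {#} * fcoeff (y
    :: ('d, 'k::field_char_0) fseries) {#}"
  by (simp add: times_fseries.rep_eq)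

lemma fcoeff_power_small:
  fixes x :: "('d, 'k::field_char_0) fseries"
  assumes "fcoeff x {#} = 0" "size F < n"
  shows "fcoeff (x ^ n) F = 0"
  using assms(2)
proof (induction n arbitrary: F)
  case (Suc n)
  have "fcoeff x A * fcoeff (x ^ n) (F - A) = 0" if "A \<subseteq># F" for A
  proof (cases "A = {#}")
    case False
    then have "size (F - A) < size F"
      using that size_mset_mono[OF that] by (simp add: size_Diff_submset nonempty_has_size)
    then show ?thesis using Suc by simp
  qed (simp add: assms)
  then show ?case by (simp only: power_Suc times_fseries.rep_eq) (intro sum.neutral, simp)
qed simp

lemma fcoeff_fps_eval:
  fixes x :: "('d, 'k::field_char_0) fseries"
  assumes "fcoeff x {#} = 0" "size F \<le> m"
  shows "fcoeff (fps_eval f x) F = (\<Sum>n\<le>m. fps_nth f n * fcoeff (x ^ n) F)"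
  unfolding fps_eval_def Abs_fseries_inverse[OF UNIV_I]
  using assms by (intro sum.mono_neutral_left) (auto simp: fcoeff_power_small)

lemma fps_eval_mult:
  fixes x :: "('d, 'k::field_char_0) fseries"
  assumes x: "fcoeff x {#} = 0"
  shows "fps_eval (f * g) x = fps_eval f x * fps_eval g x"
proof (rule fseries_eqI)
  fix F :: "'d forest"
  let ?m = "size F"
  have "fcoeff (fps_eval f x * fps_eval g x) F =
     (\<Sum>A | A \<subseteq># F. (\<Sum>p\<le>?m. fps_nth f p * fcoeff (x ^ p) A) * (\<Sum>q\<le>?m. fps_nth g q *
       fcoeff (x ^ q) (F - A)))"
    unfolding times_fseries.rep_eq
    by (intro sum.cong refl arg_cong2[of _ _ _ _ "(*)"] fcoeff_fps_eval x)
       (auto simp: size_mset_mono)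
  also have "\<dots> = (\<Sum>p\<le>?m. \<Sum>q\<le>?m. \<Sum>A | A \<subseteq># F. fps_nth f p * fps_nth g q * (fcoeff (x ^ p) A *
      fcoeff (x ^ q) (F - A)))"
    unfolding sum_product by (subst sum.swap, intro sum.cong refl, subst sum.swap)
      (simp add: mult_ac)
  also have "\<dots> = (\<Sum>p\<le>?m. \<Sum>q\<le>?m. fps_nth f p * fps_nth g q * fcoeff (x ^ (p + q)) F)"
    by (simp add: power_add times_fseries.rep_eq sum_distrib_left)
  also have "\<dots> = (\<Sum>p\<le>?m. \<Sum>q\<le>?m - p. fps_nth f p * fps_nth g q * fcoeff (x ^ (p + q)) F)"
    using x by (intro sum.cong refl sum.mono_neutral_right) (auto simp: fcoeff_power_small)
  also have "\<dots> = (\<Sum>(p, q)\<in>(SIGMA p:{..?m}. {..?m - p}). fps_nth f p * fps_nth g q *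
      fcoeff (x ^ (p + q)) F)"
    by (simp add: sum.Sigma)
  also have "\<dots> = (\<Sum>(n, p)\<in>(SIGMA n:{..?m}. {0..n}). fps_nth f p * fps_nth g (n - p) *
      fcoeff (x ^ n) F)"
    by (rule sum.reindex_bij_witness[of _ "\<lambda>(n, p). (p, n - p)" "\<lambda>(p, q). (p + q, p)"]) auto
  also have "\<dots> = fcoeff (fps_eval (f * g) x) F"
    by (simp add: fcoeff_fps_eval[OF x, of F ?m] fps_mult_nth sum_distrib_right sum.Sigma)
  finally show "fcoeff (fps_eval (f * g) x) F = fcoeff (fps_eval f x * fps_eval g x) F" by simp
qed

lemma fps_eval_linear:
  fixes x :: "('d, 'k::field_char_0) fseries"
  assumes x: "fcoeff x {#} = 0"
  shows "fps_eval (1 + fps_const b * fps_X) x = 1 + fconst b * x"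
proof (rule fseries_eqI)
  fix F :: "'d forest"
  have "fcoeff (fps_eval (1 + fps_const b * fps_X) x) F =
     (\<Sum>n\<le>Suc (size F). fps_nth (1 + fps_const b * fps_X) n * fcoeff (x ^ n) F)"
    by (rule fcoeff_fps_eval[OF x]) simp
  also have "\<dots> = (\<Sum>n\<in>{0, 1}. fps_nth (1 + fps_const b * fps_X) n * fcoeff (x ^ n) F)"
    by (rule sum.mono_neutral_right) (auto simp: fps_X_def)
  also have "\<dots> = fcoeff (1 + fconst b * x) F"
    by (simp add: fcoeff_simps fcoeff_fconst_mult)
  finally show "fcoeff (fps_eval (1 + fps_const b * fps_X) x) F = fcoeff (1 + fconst b * x) F" .
qed

lemma fconst_0 [simp]: "fconst 0 = 0"
  by (rule fseries_eqI) (simp add: fcoeff_simps)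

lemma fconst_1 [simp]: "fconst 1 = 1"
  by (rule fseries_eqI) (simp add: fcoeff_simps)

lemma fps_eval_1:
  fixes x :: "('d, 'k::field_char_0) fseries"
  assumes "fcoeff x {#} = 0"
  shows "fps_eval 1 x = 1"
  using fps_eval_linear[OF assms, of 0] by simp

lemma fps_eval_power:
  fixes x :: "('d, 'k::field_char_0) fseries"
  assumes "fcoeff x {#} = 0"
  shows "fps_eval (f ^ n) x = fps_eval f x ^ n"
  using assms by (induction n) (simp_all add: fps_eval_1 fps_eval_mult)

lemma fcoeff_graft:
  "fcoeff (graft d (x :: ('d, 'k::field_char_0) fseries)) {#Node e F#} =
    (if e = d then fcoeff x F else 0)"
proof -
  have "{F'. {#Node e F#} = {#Node d F'#}} = (if e = d then {F} else {})" by auto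
  then show ?thesis by (simp add: graft_def Abs_fseries_inverse)
qed

lemma fcoeff_graft_nontree:
  assumes "\<nexists>e G. F = {#Node e G#}"
  shows "fcoeff (graft d (x :: ('d, 'k::field_char_0) fseries)) F = 0"
proof -
  have "{F'. F = {#Node d F'#}} = {}" using assms by auto
  then show ?thesis by (simp add: graft_def Abs_fseries_inverse)
qed

text \<open>
  At a tree the sum has at most one nonzero summand, the one indexed by the decoration of the
  root.
\<close>

lemma fcoeff_fsum_graft:
  fixes f :: "'d \<Rightarrow> ('d, 'k::field_char_0) fseries"
  shows "fcoeff (fsum P (\<lambda>d. graft d (f d))) {#Node e F#} = (if e \<in> P then fcoeff (f e) F else 0)"
proof -
  have "{i \<in> P. fcoeff (graft i (f i)) {#Node e F#} \<noteq> 0} \<subseteq> {e}"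
    by (auto simp: fcoeff_graft split: if_splits)
  then have "fcoeff (fsum P (\<lambda>d. graft d (f d))) {#Node e F#} =
     (\<Sum>d\<in>(if e \<in> P then {e} else {}). fcoeff (graft d (f d)) {#Node e F#})"
    unfolding fsum_def Abs_fseries_inverse[OF UNIV_I]
    by (intro sum.mono_neutral_left) (auto simp: subset_iff)
  then show ?thesis by (auto simp: fcoeff_graft)
qed

lemma fcoeff_fsum_graft_nontree:
  fixes f :: "'d \<Rightarrow> ('d, 'k::field_char_0) fseries"
  assumes "\<nexists>e G. F = {#Node e G#}"
  shows "fcoeff (fsum P (\<lambda>d. graft d (f d))) F = 0"
  unfolding fsum_def Abs_fseries_inverse[OF UNIV_I]
  using assms by (intro sum.neutral) (auto simp: fcoeff_graft_nontree)

lemma fsum_cong: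
  "(\<And>i. i \<in> I \<Longrightarrow> x i = y i) \<Longrightarrow> fsum I x = fsum I (y :: _ \<Rightarrow> ('d, 'k::field_char_0) fseries)"
  by (intro agree_eqI agree_fsum) simp

text \<open>
  With exponents of the form \<open>c\<^sub>j + \<delta>\<^sub>i\<^sub>j b\<^sub>i\<close>, a product of powers takes the shape of the
  right-hand sides of the system of a deg1 pre-Lie algebra.
\<close>

lemma prod_F_series_exponents:
  fixes Z :: "nat \<Rightarrow> ('d, 'k::field_char_0) fseries"
  assumes i: "i < M" and Z: "\<And>j. j < M \<Longrightarrow> fcoeff (Z j) {#} = 0"
    and n: "\<And>j. j < M \<Longrightarrow> of_nat (n j) = c j + (if j = i then b i else 0)"
  shows "(\<Prod>j<M. fps_eval (F_series 1 (b j)) (Z j) ^ n j) =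
    (1 + fconst (b i) * Z i) * (\<Prod>j<M. fps_eval (F_series (c j) (b j)) (Z j))"
proof -
  have "fps_eval (F_series 1 (b j)) (Z j) ^ n j =
      (if j = i then 1 + fconst (b i) * Z i else 1) * fps_eval (F_series (c j) (b j)) (Z j)"
    if "j < M" for j
  proof -
    have "fps_eval (F_series 1 (b j)) (Z j) ^ n j = fps_eval (F_series (of_nat (n j)) (b j)) (Z j)"
      using F_series_of_nat[of "n j" 1 "b j"] by (simp add: fps_eval_power Z that)
    also have "F_series (of_nat (n j)) (b j) =
        F_series (if j = i then b i else 0) (b j) * F_series (c j) (b j)"
      by (simp only: n[OF that] F_series_mult add.commute)
    finally show ?thesis
      using that by (auto simp: fps_eval_mult fps_eval_1 fps_eval_linear F_series_self Z F_series_0)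
  qed
  then have "(\<Prod>j<M. fps_eval (F_series 1 (b j)) (Z j) ^ n j) =
      (\<Prod>j<M. if j = i then 1 + fconst (b i) * Z i else 1) *
        (\<Prod>j<M. fps_eval (F_series (c j) (b j)) (Z j))"
    by (simp flip: prod.distrib)
  then show ?thesis using i by (simp add: prod.delta)
qed

text \<open>Sorting a sum of grafted series by the degree \<open>a x\<close> of the new root \<open>x\<close>.\<close>

lemma fsum_fsum_graft:
  fixes f :: "'a \<Rightarrow> ('d, 'k::field_char_0) fseries"
  assumes a: "\<And>x. x \<in> P \<Longrightarrow> a x \<in> A" "\<And>x \<alpha>. x \<in> P \<Longrightarrow> \<alpha> \<in> A \<Longrightarrow> g x \<alpha> \<longleftrightarrow> \<alpha> = a x"
  shows "fsum A (\<lambda>\<alpha>. fsum {x \<in> P. g x \<alpha>} (\<lambda>x. graft x (f \<alpha>))) = fsum P (\<lambda>x. graft x (f (a x)))"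
proof (rule fseries_eqI)
  fix F
  let ?s = "\<lambda>\<alpha>. fsum {x \<in> P. g x \<alpha>} (\<lambda>x. graft x (f \<alpha>))"
  have outer: "fcoeff (fsum A ?s) F = (\<Sum>\<alpha> | \<alpha> \<in> A \<and> fcoeff (?s \<alpha>) F \<noteq> 0. fcoeff (?s \<alpha>) F)"
    by (simp add: fsum_def[of A] Abs_fseries_inverse)
  show "fcoeff (fsum A ?s) F = fcoeff (fsum P (\<lambda>x. graft x (f (a x)))) F"
  proof (cases "\<exists>e G. F = {#Node e G#}")
    case True
    then obtain e G where F: "F = {#Node e G#}" by blast
    have s: "fcoeff (?s \<alpha>) F = (if e \<in> P \<and> \<alpha> = a e then fcoeff (f \<alpha>) G else 0)" if "\<alpha> \<in> A" for \<alpha>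
      using a(2)[OF _ that, of e] by (cases "e \<in> P") (simp_all add: F fcoeff_fsum_graft)
    have "fcoeff (fsum A ?s) F = (\<Sum>\<alpha>\<in>(if e \<in> P then {a e} else {}). fcoeff (?s \<alpha>) F)"
      unfolding outer using a(1) s by (intro sum.mono_neutral_left) (auto split: if_splits)
    also have "\<dots> = fcoeff (fsum P (\<lambda>x. graft x (f (a x)))) F"
    proof (cases "e \<in> P")
      case True
      have "fcoeff (?s (a e)) F = fcoeff (f (a e)) G"
        using s[OF a(1)[OF True]] True by (simp only: simp_thms if_True)
      then show ?thesis using True by (simp only: F fcoeff_fsum_graft if_True sum.insert) simp
    qed (simp add: F fcoeff_fsum_graft)
    finally show ?thesis .
  next
    case False
    then show ?thesis by (simp add: outer fcoeff_fsum_graft_nontree)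
  qed
qed

section \<open>Linear extensions and homogeneous elements\<close>

lemma basis_mult: "basis a * basis b = (basis (a + b) :: 'a::comm_monoid_add \<Rightarrow>\<^sub>0 'k::field_char_0)"
  by (simp add: basis_def mult_single)

lemma basis_zero: "basis 0 = (1 :: 'a::comm_monoid_add \<Rightarrow>\<^sub>0 'k::field_char_0)"
  by (simp add: basis_def)

lemma lin_ext_comp:
  fixes h :: "'b::comm_monoid_add \<Rightarrow> 'c::comm_monoid_add \<Rightarrow>\<^sub>0 'k::field_char_0"
  shows "lin_ext h (lin_ext f x) = lin_ext (\<lambda>a. lin_ext h (f a)) x"
  by (rule lin_ext_lin_ext) (simp_all only: lin_ext_scale lin_ext_add)

lemma lin_ext_fun_add:
  "lin_ext (\<lambda>a. f a + g a) x = lin_ext f x + lin_ext g x"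
  by (simp add: lin_ext_def distrib_left sum.distrib)

lemma lin_ext_fun_uminus: "lin_ext (\<lambda>a. - f a) x = - lin_ext f x"
  by (simp add: lin_ext_def sum_negf)

lemma lin_ext_uminus: "lin_ext f (- x) = - lin_ext f x"
  using lin_ext_add[of f x "- x"] by (simp add: eq_neg_iff_add_eq_0 add.commute)

lemma lin_ext_diff: "lin_ext f (x - y) = lin_ext f x - lin_ext f y"
  using lin_ext_add[of f x "- y"] by (simp add: lin_ext_uminus)

lemma mult_lin_ext: "z * lin_ext f x = lin_ext (\<lambda>a. z * f a) x"
  by (simp add: lin_ext_def sum_distrib_left mult_ac)

lemma lin_ext_cong_keys:
  "(\<And>a. a \<in> Poly_Mapping.keys x \<Longrightarrow> f a = g a) \<Longrightarrow> lin_ext f x = lin_ext g x"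
  by (simp add: lin_ext_def)

lemma lin_ext_one:
  fixes f :: "'a::comm_monoid_add \<Rightarrow> 'b::comm_monoid_add \<Rightarrow>\<^sub>0 'k::field_char_0"
  shows "lin_ext f 1 = f 0"
  by (simp flip: basis_zero)

lemma lin_ext_basis_id: "lin_ext basis x = (x :: 'a::comm_monoid_add \<Rightarrow>\<^sub>0 'k::field_char_0)"
  using sum_singles[of x] by (simp add: lin_ext_def basis_def mult_single)

lemma lin_ext_prod_mset:
  fixes f :: "'a::comm_monoid_add \<Rightarrow> 'b::comm_monoid_add \<Rightarrow>\<^sub>0 'k::field_char_0"
  assumes "f 0 = 1" "\<And>a b. f (a + b) = f a * f b"
  shows "lin_ext f (\<Prod>\<^sub># (image_mset g M)) = (\<Prod>x\<in>#M. lin_ext f (g x))"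
  by (induction M) (simp_all add: lin_ext_mult assms lin_ext_one)

lemma keys_lin_ext:
  fixes f :: "'a \<Rightarrow> 'b::comm_monoid_add \<Rightarrow>\<^sub>0 'k::field_char_0"
  assumes "\<And>a. a \<in> Poly_Mapping.keys x \<Longrightarrow> Poly_Mapping.keys (f a) \<subseteq> S"
  shows "Poly_Mapping.keys (lin_ext f x) \<subseteq> S"
proof
  fix b assume "b \<in> Poly_Mapping.keys (lin_ext f x)"
  then have "(\<Sum>a\<in>Poly_Mapping.keys x. Poly_Mapping.lookup x a * Poly_Mapping.lookup (f a) b) \<noteq> 0"
    by (simp add: in_keys_iff lin_ext_def lookup_sum lookup_scale)
  then obtain a where "a \<in> Poly_Mapping.keys x" "Poly_Mapping.lookup (f a) b \<noteq> 0"
    by (metis (no_types, lifting) mult_eq_0_iff sum.neutral)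
  then show "b \<in> S" using assms[of a] by (auto simp: in_keys_iff subset_iff)
qed

text \<open>An element is homogeneous of degree \<open>m\<close> for a weight function on the basis.\<close>

definition homog :: "('a \<Rightarrow> 'm) \<Rightarrow> 'm \<Rightarrow> ('a \<Rightarrow>\<^sub>0 'k::zero) \<Rightarrow> bool" where
  "homog w m x \<longleftrightarrow> Poly_Mapping.keys x \<subseteq> {a. w a = m}"

lemma homog_mult:
  fixes x y :: "'a::comm_monoid_add \<Rightarrow>\<^sub>0 'k::field_char_0"
  assumes "homog w m x" "homog w n y" "\<And>a b. w (a + b) = w a + w b"
  shows "homog w (m + n) (x * y)"
  using keys_mult[of x y] assms unfolding homog_def by fastforce

lemma homog_prod_mset:
  fixes g :: "'i \<Rightarrow> 'a::comm_monoid_add \<Rightarrow>\<^sub>0 'k::field_char_0" and w :: "'a \<Rightarrow> 'm::comm_monoid_add"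
  assumes "\<And>i. i \<in># M \<Longrightarrow> homog w (m i) (g i)" "\<And>a b. w (a + b) = w a + w b" "w 0 = 0"
  shows "homog w (\<Sum>i\<in>#M. m i) (\<Prod>\<^sub># (image_mset g M))"
  using assms(1)
proof (induction M)
  case empty
  show ?case using assms(3) by (auto simp: homog_def)
next
  case (add i M)
  then show ?case by (auto intro!: homog_mult simp: assms(2))
qed

lemma homog_add:
  "homog w m x \<Longrightarrow> homog w m y \<Longrightarrow> homog w m (x + (y :: 'a \<Rightarrow>\<^sub>0 'k::field_char_0))"
  using keys_add[of x y] by (auto simp: homog_def)

lemma homog_uminus: "homog w m x \<Longrightarrow> homog w m (- x :: 'a \<Rightarrow>\<^sub>0 'k::field_char_0)"
  by (simp add: homog_def)

lemma homog_diff: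
  "homog w m x \<Longrightarrow> homog w m y \<Longrightarrow> homog w m (x - (y :: 'a \<Rightarrow>\<^sub>0 'k::field_char_0))"
  using homog_add[of w m x "- y"] homog_uminus[of w m y] by simp

lemma homog_lin_ext:
  fixes f :: "'a \<Rightarrow> 'b::comm_monoid_add \<Rightarrow>\<^sub>0 'k::field_char_0"
  assumes "homog w m x" "\<And>a. w a = m \<Longrightarrow> homog w' m' (f a)"
  shows "homog w' m' (lin_ext f x)"
  using assms unfolding homog_def by (intro keys_lin_ext) auto

lemma homog_basis: "w a = m \<Longrightarrow> homog w m (basis a :: 'a \<Rightarrow>\<^sub>0 'k::field_char_0)"
  by (simp add: homog_def basis_def)

lemma decs_add [simp]: "decs (F + G) = decs F + decs G"
  and decs_empty [simp]: "decs {#} = {#}"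
  and decs_single [simp]: "decs {#T#} = tree_decs T"
  by (simp_all add: decs_def)

lemma tree_decs_Node: "tree_decs (Node d F) = add_mset d (decs F)"
  by (simp add: decs_def)

declare tree_decs.simps [simp del]

text \<open>The decorations of a pair of forests.\<close>

definition decs2 :: "'d forest \<times> 'd forest \<Rightarrow> 'd multiset" where
  "decs2 p = decs (fst p) + decs (snd p)"

lemma decs2_simps [simp]: "decs2 (F, G) = decs F + decs G" "decs2 (p + q) = decs2 p + decs2 q"
  "decs2 0 = {#}"
  by (simp_all add: decs2_def)

section \<open>The bialgebra of forests\<close>

text \<open>The coproduct of a basis element.\<close>

definition forest_coproduct :: "'d forest \<Rightarrow> ('d, 'k::field_char_0) tree_alg2" where
  "forest_coproduct F = \<Prod>\<^sub># (image_mset tree_coproduct F)"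

lemma coproduct_eq: "coproduct = lin_ext forest_coproduct"
  unfolding coproduct_def forest_coproduct_def ..

lemma forest_coproduct_simps [simp]:
  "forest_coproduct {#} = 1" "forest_coproduct (F + G) = forest_coproduct F * forest_coproduct G"
  "forest_coproduct {#T#} = tree_coproduct T"
  by (simp_all add: forest_coproduct_def)

lemma tree_coproduct_Node:
  "tree_coproduct (Node d F) = basis ({#Node d F#}, {#}) + id_tensor_B_plus d (forest_coproduct F)"
  by (simp add: forest_coproduct_def)

declare tree_coproduct.simps [simp del]

lemma homog_id_tensor_B_plus:
  "homog decs2 m z \<Longrightarrow> homog decs2 (add_mset d m) (id_tensor_B_plus d z)"
  unfolding id_tensor_B_plus_def
  by (rule homog_lin_ext) (auto intro!: homog_basis simp: tree_decs_Node)

lemma homog_tree_coproduct: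
  "homog decs2 (tree_decs T) (tree_coproduct T :: ('d, 'k::field_char_0) tree_alg2)"
proof (induction T)
  case (Node d F)
  then have "homog decs2 (decs F) (forest_coproduct F :: ('d, 'k) tree_alg2)"
    unfolding forest_coproduct_def decs_def by (intro homog_prod_mset) auto
  then show ?case
    unfolding tree_coproduct_Node tree_decs_Node
    by (intro homog_add homog_id_tensor_B_plus) (auto intro!: homog_basis simp: tree_decs_Node)
qed

lemma homog_forest_coproduct:
  "homog decs2 (decs F) (forest_coproduct F :: ('d, 'k::field_char_0) tree_alg2)"
  unfolding forest_coproduct_def decs_def by (intro homog_prod_mset homog_tree_coproduct) auto

subsection \<open>Coassociativity\<close>

type_synonym ('d, 'k) tree_alg3 = "('d forest \<times> 'd forest \<times> 'd forest) \<Rightarrow>\<^sub>0 'k"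

text \<open>The maps \<open>\<Delta> \<otimes> Id\<close> and \<open>Id \<otimes> \<Delta>\<close>, on pairs of forests.\<close>

definition coprod_left ::
    "'d forest \<times> 'd forest \<Rightarrow> ('d, 'k::field_char_0) tree_alg3" where
  "coprod_left p = lin_ext (\<lambda>a. basis (fst a, snd a, snd p)) (forest_coproduct (fst p))"

definition coprod_right ::
    "'d forest \<times> 'd forest \<Rightarrow> ('d, 'k::field_char_0) tree_alg3" where
  "coprod_right p = lin_ext (\<lambda>a. basis (fst p, fst a, snd a)) (forest_coproduct (snd p))"

lemma coprod_left_hom:
  fixes p q :: "'d forest \<times> 'd forest"
  defines "c \<equiv> coprod_left :: _ \<Rightarrow> ('d, 'k::field_char_0) tree_alg3"
  shows "c 0 = 1" "c (p + q) = c p * c q"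
proof -
  let ?l = "lin_ext (\<lambda>a. basis (fst a, snd a, {#})) :: _ \<Rightarrow> ('d, 'k) tree_alg3"
  have l: "?l (x * y) = ?l x * ?l y" for x y
    by (rule lin_ext_mult) (simp add: basis_mult)
  have c: "c p = basis ({#}, {#}, snd p) * ?l (forest_coproduct (fst p))" for p
    unfolding c_def coprod_left_def mult_lin_ext basis_mult by simp
  show "c 0 = 1"
    by (simp add: c_def coprod_left_def lin_ext_one flip: basis_zero zero_prod_def)
  have b: "basis ({#}, {#}, snd p + snd q) = basis ({#}, {#}, snd p) * (basis ({#}, {#}, snd q)
      :: ('d, 'k) tree_alg3)"
    by (simp add: basis_mult)
  show "c (p + q) = c p * c q"
    unfolding c fst_add snd_add forest_coproduct_simps l b by (simp only: mult_ac)
qed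

lemma coprod_right_hom:
  fixes p q :: "'d forest \<times> 'd forest"
  defines "c \<equiv> coprod_right :: _ \<Rightarrow> ('d, 'k::field_char_0) tree_alg3"
  shows "c 0 = 1" "c (p + q) = c p * c q"
proof -
  let ?l = "lin_ext (\<lambda>a. basis ({#}, fst a, snd a)) :: _ \<Rightarrow> ('d, 'k) tree_alg3"
  have l: "?l (x * y) = ?l x * ?l y" for x y
    by (rule lin_ext_mult) (clarsimp simp: basis_mult)
  have c: "c p = basis (fst p, {#}, {#}) * ?l (forest_coproduct (snd p))" for p
    unfolding c_def coprod_right_def mult_lin_ext basis_mult by (simp flip: zero_prod_def)
  show "c 0 = 1"
    by (simp add: c_def coprod_right_def lin_ext_one flip: basis_zero zero_prod_def)
  have b: "basis (fst p + fst q, {#}, {#}) = basis (fst p, {#}, {#}) * (basis (fst q, {#}, {#})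
      :: ('d, 'k) tree_alg3)"
    by (simp add: basis_mult)
  show "c (p + q) = c p * c q"
    unfolding c fst_add snd_add forest_coproduct_simps l b by (simp only: mult_ac)
qed

lemma coassoc_forest:
  assumes "\<And>T. T \<in># F \<Longrightarrow> lin_ext coprod_left (tree_coproduct T) =
      (lin_ext coprod_right (tree_coproduct T) :: ('d, 'k::field_char_0) tree_alg3)"
  shows "lin_ext coprod_left (forest_coproduct F) =
      (lin_ext coprod_right (forest_coproduct F) :: ('d, 'k) tree_alg3)"
  unfolding forest_coproduct_def
  using assms
  by (simp add: lin_ext_prod_mset coprod_left_hom coprod_right_hom cong: image_mset_cong)

lemma coassoc_tree:
  "lin_ext coprod_left (tree_coproduct T) =
    (lin_ext coprod_right (tree_coproduct T) :: ('d, 'k::field_char_0) tree_alg3)"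
proof (induction T)
  case (Node d F)
  define B3 where "B3 = lin_ext (\<lambda>a. basis (fst a, fst (snd a), {#Node d (snd (snd a))#})
    :: ('d, 'k) tree_alg3)"
  define z :: "('d, 'k) tree_alg3"
    where "z = lin_ext (\<lambda>a. basis (fst a, {#Node d (snd a)#}, {#})) (forest_coproduct F)"
  have L: "coprod_left (A, {#Node d B#}) = B3 (coprod_left (A, B))" for A B
    unfolding B3_def coprod_left_def lin_ext_comp lin_ext_basis fst_conv snd_conv ..
  have idB: "lin_ext f (id_tensor_B_plus d x) = lin_ext (\<lambda>a. f (fst a, {#Node d (snd a)#})) x"
    for f :: "'d forest \<times> 'd forest \<Rightarrow> ('d, 'k) tree_alg3" and x
    unfolding id_tensor_B_plus_def lin_ext_comp case_prod_unfold lin_ext_basis ..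
  have R: "coprod_right (A, {#Node d B#}) = basis (A, {#Node d B#}, {#}) +
      B3 (coprod_right (A, B))" for A B
    unfolding B3_def coprod_right_def lin_ext_comp lin_ext_basis fst_conv snd_conv
      forest_coproduct_simps tree_coproduct_Node lin_ext_add idB ..
  have "lin_ext coprod_left (tree_coproduct (Node d F)) =
     coprod_left ({#Node d F#}, {#}) + lin_ext (\<lambda>a. B3 (coprod_left a)) (forest_coproduct F)"
    unfolding tree_coproduct_Node lin_ext_add idB L lin_ext_basis prod.collapse ..
  also have "coprod_left ({#Node d F#}, {#}) = basis ({#Node d F#}, {#}, {#}) + z"
    unfolding coprod_left_def z_def fst_conv snd_conv
      forest_coproduct_simps tree_coproduct_Node lin_ext_add idB lin_ext_basis ..
  also have "lin_ext (\<lambda>a. B3 (coprod_left a)) (forest_coproduct F)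
      = B3 (lin_ext coprod_left (forest_coproduct F))"
    by (simp only: B3_def lin_ext_comp)
  also have "lin_ext coprod_left (forest_coproduct F) =
      (lin_ext coprod_right (forest_coproduct F) :: ('d, 'k) tree_alg3)"
    using Node by (rule coassoc_forest)
  also have "basis ({#Node d F#}, {#}, {#}) + z + B3 (lin_ext coprod_right (forest_coproduct F)) =
     basis ({#Node d F#}, {#}, {#}) + lin_ext (\<lambda>a. coprod_right (fst a, {#Node d (snd a)#}))
       (forest_coproduct F)"
    unfolding R lin_ext_fun_add prod.collapse by (simp only: z_def B3_def lin_ext_comp add.assoc)
  also have "\<dots> = lin_ext coprod_right (tree_coproduct (Node d F))"
    unfolding tree_coproduct_Node lin_ext_add idB lin_ext_basis
    by (simp add: coprod_right_def lin_ext_one zero_prod_def)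
  finally show ?case .
qed

lemma coassoc:
  "lin_ext coprod_left (forest_coproduct F) =
    (lin_ext coprod_right (forest_coproduct F) :: ('d, 'k::field_char_0) tree_alg3)"
  by (rule coassoc_forest) (rule coassoc_tree)

subsection \<open>The antipode\<close>

text \<open>The product as a linear map on the tensor square.\<close>

definition forest_mult :: "('d, 'k::field_char_0) tree_alg2 \<Rightarrow> ('d, 'k) tree_alg" where
  "forest_mult = lin_ext (\<lambda>p. basis (fst p + snd p))"

lemma forest_mult_prod_mset:
  "forest_mult (\<Prod>\<^sub># (image_mset f M)) = (\<Prod>x\<in>#M. forest_mult (f x))"
  unfolding forest_mult_def by (rule lin_ext_prod_mset)
    (simp_all add: basis_mult ac_simps basis_zero)

text \<open>
  The element \<open>(S \<otimes> Id) (\<Delta> T)\<close> for the antipode \<open>S\<close>, which can be defined by structural recursion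
  on the tree, and from which \<open>S T\<close> itself is obtained.
\<close>

primrec antipode_coproduct :: "'d dtree \<Rightarrow> ('d, 'k::field_char_0) tree_alg2" where
  "antipode_coproduct (Node d F) =
     id_tensor_B_plus d (\<Prod>\<^sub># (image_mset antipode_coproduct F)) -
     lin_ext (\<lambda>A. basis (A, {#}))
       (forest_mult (id_tensor_B_plus d (\<Prod>\<^sub># (image_mset antipode_coproduct F))))"

text \<open>Multiplying out \<open>(S \<otimes> Id) (\<Delta> T) = S T \<otimes> 1 + \<dots>\<close> has to give \<open>0\<close>, which determines \<open>S T\<close>.\<close>

primrec tree_antipode :: "'d dtree \<Rightarrow> ('d, 'k::field_char_0) tree_alg" where
  "tree_antipode (Node d F) =
     - forest_mult (id_tensor_B_plus d (\<Prod>\<^sub># (image_mset antipode_coproduct F)))"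

text \<open>The antipode as an algebra morphism, first on basis elements.\<close>

definition forest_antipode :: "'d forest \<Rightarrow> ('d, 'k::field_char_0) tree_alg" where
  "forest_antipode F = \<Prod>\<^sub># (image_mset tree_antipode F)"

definition antipode :: "('d, 'k::field_char_0) tree_alg \<Rightarrow> ('d, 'k) tree_alg" where
  "antipode = lin_ext forest_antipode"

lemma forest_antipode_simps [simp]:
  "forest_antipode {#} = 1" "forest_antipode (F + G) = forest_antipode F * forest_antipode G"
  "forest_antipode {#T#} = tree_antipode T"
  by (simp_all add: forest_antipode_def)

lemma antipode_basis: "antipode (basis F) = forest_antipode F"
  by (simp add: antipode_def)

lemma antipode_add: "antipode (x + y) = antipode x + antipode y"
  and antipode_scale: "antipode (Poly_Mapping.single 0 c * x) = Poly_Mapping.single 0 c *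
    antipode x"
  and antipode_mult: "antipode (x * y) = antipode x * antipode y"
  and antipode_one: "antipode 1 = 1"
  by (simp_all add: antipode_def lin_ext_add lin_ext_scale lin_ext_mult lin_ext_one)

lemma homog_forest_mult: "homog decs2 m z \<Longrightarrow> homog decs m (forest_mult z)"
  unfolding forest_mult_def by (rule homog_lin_ext) (auto intro!: homog_basis simp: decs2_def)

lemma homog_antipode_coproduct:
  "homog decs2 (tree_decs T) (antipode_coproduct T :: ('d, 'k::field_char_0) tree_alg2)"
proof (induction T)
  case (Node d F)
  then have "homog decs2 (decs F) (\<Prod>\<^sub># (image_mset antipode_coproduct F) :: ('d, 'k) tree_alg2)"
    unfolding decs_def by (intro homog_prod_mset) auto
  then have "homog decs2 (tree_decs (Node d F))
      (id_tensor_B_plus d (\<Prod>\<^sub># (image_mset antipode_coproduct F)) :: ('d, 'k) tree_alg2)"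
    unfolding tree_decs_Node by (rule homog_id_tensor_B_plus)
  then show ?case
    unfolding antipode_coproduct.simps
    by (intro homog_diff homog_lin_ext[OF homog_forest_mult]) (auto intro!: homog_basis)
qed

lemma homog_tree_antipode:
  "homog decs (tree_decs T) (tree_antipode T :: ('d, 'k::field_char_0) tree_alg)"
proof (cases T)
  case (Node d F)
  have "homog decs2 (decs F) (\<Prod>\<^sub># (image_mset antipode_coproduct F) :: ('d, 'k) tree_alg2)"
    unfolding decs_def by (intro homog_prod_mset homog_antipode_coproduct) auto
  then show ?thesis
    unfolding Node tree_antipode.simps tree_decs_Node
    by (intro homog_uminus homog_forest_mult homog_id_tensor_B_plus)
qed

lemma homog_forest_antipode:
  "homog decs (decs F) (forest_antipode F :: ('d, 'k::field_char_0) tree_alg)"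
  using homog_prod_mset[of F decs tree_decs "tree_antipode :: _ \<Rightarrow> ('d, 'k) tree_alg"]
  by (simp add: forest_antipode_def homog_tree_antipode flip: decs_def)

lemma antipode_H_trees: "x \<in> H_trees D \<Longrightarrow> antipode x \<in> H_trees D"
proof -
  assume x: "x \<in> H_trees D"
  have "Poly_Mapping.keys (antipode x) \<subseteq> {F. set_mset (decs F) \<subseteq> D}"
    unfolding antipode_def
  proof (rule keys_lin_ext)
    fix F assume "F \<in> Poly_Mapping.keys x"
    then show "Poly_Mapping.keys (forest_antipode F) \<subseteq> {F. set_mset (decs F) \<subseteq> D}"
      using homog_forest_antipode[of F] x by (fastforce simp: homog_def H_trees_def)
  qed
  then show ?thesis by (auto simp: H_trees_def)
qed

text \<open>The map \<open>S \<otimes> Id\<close>, on pairs of forests.\<close>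

definition antipode_left :: "'d forest \<times> 'd forest \<Rightarrow> ('d, 'k::field_char_0) tree_alg2" where
  "antipode_left p = lin_ext (\<lambda>A. basis (A, snd p)) (forest_antipode (fst p))"

lemma antipode_left_hom:
  fixes p q :: "'d forest \<times> 'd forest"
  defines "c \<equiv> antipode_left :: _ \<Rightarrow> ('d, 'k::field_char_0) tree_alg2"
  shows "c 0 = 1" "c (p + q) = c p * c q"
proof -
  let ?l = "lin_ext (\<lambda>A. basis (A, {#})) :: _ \<Rightarrow> ('d, 'k) tree_alg2"
  have l: "?l (x * y) = ?l x * ?l y" for x y
    by (rule lin_ext_mult) (simp add: basis_mult)
  have c: "c p = basis ({#}, snd p) * ?l (forest_antipode (fst p))" for p
    unfolding c_def antipode_left_def mult_lin_ext basis_mult by simp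
  show "c 0 = 1"
    by (simp add: c_def antipode_left_def lin_ext_one flip: basis_zero zero_prod_def)
  have b: "basis ({#}, snd p + snd q) = basis ({#}, snd p) * (basis ({#}, snd q)
      :: ('d, 'k) tree_alg2)"
    by (simp add: basis_mult)
  show "c (p + q) = c p * c q"
    unfolding c fst_add snd_add forest_antipode_simps l b by (simp only: mult_ac)
qed

lemma lin_ext_id_tensor_B_plus:
  fixes f :: "'d forest \<times> 'd forest \<Rightarrow> 'b::comm_monoid_add \<Rightarrow>\<^sub>0 'k::field_char_0"
  shows "lin_ext f (id_tensor_B_plus d x) = lin_ext (\<lambda>a. f (fst a, {#Node d (snd a)#})) x"
  unfolding id_tensor_B_plus_def lin_ext_comp case_prod_unfold lin_ext_basis ..

lemma antipode_left_tree:
  "lin_ext antipode_left (tree_coproduct T) = (antipode_coproduct T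
    :: ('d, 'k::field_char_0) tree_alg2)"
proof (induction T)
  case (Node d F)
  let ?z = "id_tensor_B_plus d (\<Prod>\<^sub># (image_mset antipode_coproduct F)) :: ('d, 'k) tree_alg2"
  have F: "lin_ext antipode_left (forest_coproduct F) =
      (\<Prod>\<^sub># (image_mset antipode_coproduct F) :: ('d, 'k) tree_alg2)"
    unfolding forest_coproduct_def using Node
    by (simp add: lin_ext_prod_mset antipode_left_hom cong: image_mset_cong)
  have "lin_ext antipode_left (id_tensor_B_plus d (forest_coproduct F)) =
      (id_tensor_B_plus d (lin_ext antipode_left (forest_coproduct F)) :: ('d, 'k) tree_alg2)"
    unfolding lin_ext_id_tensor_B_plus
    by (simp add: id_tensor_B_plus_def lin_ext_comp antipode_left_def)
  then have "lin_ext antipode_left (tree_coproduct (Node d F)) = antipode_left ({#Node d F#}, {#})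
      + ?z"
    by (simp add: tree_coproduct_Node lin_ext_add F)
  also have "antipode_left ({#Node d F#}, {#}) = - lin_ext (\<lambda>A. basis (A, {#})) (forest_mult ?z)"
    by (simp add: antipode_left_def lin_ext_uminus)
  finally show ?case by simp
qed

lemma antipode_left_forest:
  "lin_ext antipode_left (forest_coproduct F) =
     (\<Prod>\<^sub># (image_mset antipode_coproduct F) :: ('d, 'k::field_char_0) tree_alg2)"
  unfolding forest_coproduct_def
  by (simp add: lin_ext_prod_mset antipode_left_hom antipode_left_tree)

lemma forest_mult_antipode_left:
  fixes x :: "('a, 'b::field_char_0) tree_alg2"
  shows "forest_mult (lin_ext antipode_left x) = lin_ext (\<lambda>p. forest_antipode (fst p) *
      basis (snd p)) x"
proof -
  have "forest_mult (antipode_left p) = (forest_antipode (fst p) * basis (snd p)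
      :: ('a, 'b) tree_alg)" for p :: "'a forest \<times> 'a forest"
  proof -
    have "forest_mult (antipode_left p) = lin_ext (\<lambda>A. basis (snd p) * basis A) (forest_antipode
        (fst p) :: ('a, 'b) tree_alg)"
      by (simp add: forest_mult_def antipode_left_def lin_ext_comp basis_mult add.commute)
    also have "\<dots> = basis (snd p) * forest_antipode (fst p)"
      by (simp only: lin_ext_basis_id flip: mult_lin_ext)
    finally show ?thesis by (simp only: mult.commute)
  qed
  then show ?thesis unfolding forest_mult_def lin_ext_comp by simp
qed

lemma antipode_left_inverse_forest:
  "lin_ext (\<lambda>p. forest_antipode (fst p) * basis (snd p)) (forest_coproduct F) =
     (if F = {#} then 1 else 0 :: ('d, 'k::field_char_0) tree_alg)"
proof -
  have "forest_mult (antipode_coproduct T) = (0 :: ('d, 'k) tree_alg)" for T :: "'d dtree"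
  proof (cases T)
    case (Node d F)
    have "forest_mult (lin_ext (\<lambda>A. basis (A, {#})) x) = x" for x :: "('d, 'k) tree_alg"
      by (simp add: forest_mult_def lin_ext_comp lin_ext_basis_id)
    then show ?thesis
      unfolding Node antipode_coproduct.simps by (simp add: forest_mult_def lin_ext_diff)
  qed
  then have "forest_mult (\<Prod>\<^sub># (image_mset antipode_coproduct F)) = (if F = {#} then 1 else 0
      :: ('d, 'k) tree_alg)"
    unfolding forest_mult_prod_mset by (cases F) simp_all
  then show ?thesis
    unfolding forest_mult_antipode_left[symmetric] antipode_left_forest .
qed

text \<open>The counit is a left counit.\<close>

lemma counit_left:
  "lin_ext (\<lambda>p. if fst p = {#} then basis (snd p) else 0) (forest_coproduct F) =
     (basis F :: ('d, 'k::field_char_0) tree_alg)"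
proof -
  let ?e = "\<lambda>p. if fst p = {#} then basis (snd p) else 0 :: ('d, 'k) tree_alg"
  have hom: "?e 0 = 1" "?e (p + q) = ?e p * ?e q" for p q
    by (simp_all add: basis_zero basis_mult)
  have T: "lin_ext ?e (tree_coproduct T) = (basis {#T#} :: ('d, 'k) tree_alg)" for T
  proof (induction T)
    case (Node d F)
    then have "lin_ext ?e (forest_coproduct F) = (\<Prod>T\<in>#F. basis {#T#})"
      unfolding forest_coproduct_def
      by (simp only: lin_ext_prod_mset[of ?e, OF hom] cong: image_mset_cong)
    also have "\<dots> = basis F"
      by (induction F) (simp_all add: basis_mult flip: basis_zero)
    finally have *: "lin_ext ?e (forest_coproduct F) = basis F" .
    have "lin_ext ?e (id_tensor_B_plus d (forest_coproduct F)) =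
        B_plus d (lin_ext ?e (forest_coproduct F))"
      unfolding lin_ext_id_tensor_B_plus B_plus_def lin_ext_comp
      by (intro lin_ext_cong_keys) simp
    then show ?case
      by (simp add: tree_coproduct_Node lin_ext_add * B_plus_def)
  qed
  have "lin_ext ?e (forest_coproduct F) = (\<Prod>T\<in>#F. basis {#T#})"
    unfolding forest_coproduct_def by (simp only: lin_ext_prod_mset[of ?e, OF hom] T)
  also have "\<dots> = basis F"
    by (induction F) (simp_all add: basis_mult flip: basis_zero)
  finally show ?thesis .
qed

text \<open>
  That the left inverse of the identity for the convolution product is also a right inverse uses
  coassociativity; the induction is on the number of vertices.
\<close>

lemma antipode_right_inverse_forest:
  "lin_ext (\<lambda>p. basis (fst p) * forest_antipode (snd p)) (forest_coproduct F) =
     (if F = {#} then 1 else 0 :: ('d, 'k::field_char_0) tree_alg)"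
proof (induction "size (decs F)" arbitrary: F rule: less_induct)
  case less
  let ?r = "\<lambda>p. basis (fst p) * forest_antipode (snd p) :: ('d, 'k) tree_alg"
  have hom: "?r 0 = 1" "?r (p + q) = ?r p * ?r q" for p q
    by (simp_all add: basis_zero mult_ac flip: basis_mult)
  have tree: "lin_ext ?r (tree_coproduct T) = 0" if "T \<in># F" for T
  proof (cases T)
    case (Node d G)
    have smaller: "size (decs A) < size (decs F)" if
        "(A, B) \<in> Poly_Mapping.keys (forest_coproduct G :: ('d, 'k) tree_alg2)" for A B
    proof -
      have "decs A + decs B = decs G"
        using homog_forest_coproduct[of G] that by (auto simp: homog_def)
      then have "size (decs A) \<le> size (decs G)" by (metis le_add1 size_union)
      moreover have "decs {#T#} \<subseteq># decs F"
        using \<open>T \<in># F\<close> by (metis decs_add insert_DiffM2 mset_subset_eq_add_right)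
      then have "size (decs G) < size (decs F)"
        using size_mset_mono[of "decs {#T#}" "decs F"] by (simp add: Node tree_decs_Node)
      ultimately show ?thesis by simp
    qed
    \<comment> \<open>Substituting this and using coassociativity, an antipode acts on the middle factor of a
      triple
      only, and the induction hypothesis applies to the first two factors.\<close>
    have S: "forest_antipode {#Node d B#} =
        - lin_ext (\<lambda>a. forest_antipode (fst a) * basis {#Node d (snd a)#}
          :: ('d, 'k) tree_alg) (forest_coproduct B)"
      for B :: "'d forest"
    proof -
      have "forest_mult (id_tensor_B_plus d (antipode_left p)) =
         (forest_antipode (fst p) * basis {#Node d (snd p)#} :: ('d, 'k) tree_alg)" for p ::
           "'d forest \<times> 'd forest"
      proof -
        have "forest_mult (id_tensor_B_plus d (antipode_left p)) =
          (lin_ext (\<lambda>A. basis {#Node d (snd p)#} * basis A) (forest_antipode (fst p))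
            :: ('d, 'k) tree_alg)"
          unfolding forest_mult_def lin_ext_id_tensor_B_plus antipode_left_def lin_ext_comp
          by (simp add: basis_mult)
        also have "\<dots> = basis {#Node d (snd p)#} * forest_antipode (fst p)"
          by (simp only: lin_ext_basis_id flip: mult_lin_ext)
        finally show ?thesis by (simp only: mult.commute)
      qed
      then show ?thesis
        unfolding forest_antipode_simps tree_antipode.simps antipode_left_forest[symmetric]
        by (simp add: id_tensor_B_plus_def forest_mult_def lin_ext_comp)
    qed
    let ?t = "\<lambda>a. basis (fst a) * forest_antipode (fst (snd a)) * basis {#Node d (snd (snd a))#}
      :: ('d, 'k) tree_alg"
    have "lin_ext ?r (id_tensor_B_plus d (forest_coproduct G)) =
      - lin_ext (\<lambda>a. lin_ext ?t (coprod_right a)) (forest_coproduct G)"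
      unfolding lin_ext_id_tensor_B_plus fst_conv snd_conv S coprod_right_def lin_ext_comp
        lin_ext_basis
      by (simp add: mult_lin_ext lin_ext_fun_uminus mult.assoc)
    also have "\<dots> = - lin_ext ?t (lin_ext coprod_left (forest_coproduct G))"
      unfolding coassoc lin_ext_comp ..
    also have "lin_ext ?t (lin_ext coprod_left (forest_coproduct G)) =
       lin_ext (\<lambda>p. basis {#Node d (snd p)#} * lin_ext ?r (forest_coproduct (fst p)))
         (forest_coproduct G)"
      unfolding coprod_left_def lin_ext_comp lin_ext_basis fst_conv snd_conv
      by (simp add: mult_lin_ext mult_ac)
    also have "\<dots> = lin_ext (\<lambda>p. if fst p = {#} then basis {#Node d (snd p)#} else 0)
        (forest_coproduct G)"
      using less smaller by (intro lin_ext_cong_keys) (auto simp: lin_ext_one basis_zero)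
    also have "\<dots> = B_plus d (lin_ext (\<lambda>p. if fst p = {#} then basis (snd p) else 0)
        (forest_coproduct G))"
      unfolding B_plus_def lin_ext_comp by (intro lin_ext_cong_keys) simp
    also have "\<dots> = basis {#T#}"
      by (simp add: counit_left B_plus_def Node)
    finally show ?thesis
      by (simp add: Node tree_coproduct_Node lin_ext_add)
  qed
  have "lin_ext ?r (forest_coproduct F) = (\<Prod>T\<in>#F. lin_ext ?r (tree_coproduct T))"
    unfolding forest_coproduct_def by (rule lin_ext_prod_mset[of ?r, OF hom])
  also have "\<dots> = (if F = {#} then 1 else 0)"
    using tree by (cases F) simp_all
  finally show ?case .
qed

lemma is_antipode_antipode: "is_antipode D (antipode :: ('d, 'k::field_char_0) tree_alg \<Rightarrow> ('d, 'k)
    tree_alg)"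
proof -
  have counit: "lin_ext (\<lambda>F. if F = {#} then 1 else 0) x = (Poly_Mapping.single 0 (counit x)
      :: ('d, 'k) tree_alg)" for x
  proof -
    have "lin_ext (\<lambda>F. if F = {#} then 1 else 0 :: ('d, 'k) tree_alg) x =
      (\<Sum>F\<in>insert {#} (Poly_Mapping.keys x). Poly_Mapping.single 0 (Poly_Mapping.lookup x F) *
        (if F = {#} then 1 else 0))"
      by (rule lin_ext_superset) auto
    also have "\<dots> = (\<Sum>F\<in>{{#}}. Poly_Mapping.single 0 (Poly_Mapping.lookup x F) *
        (if F = {#} then 1 else 0))"
      by (rule sum.mono_neutral_right) auto
    finally show ?thesis by (simp add: counit_def)
  qed
  have "lin_ext (\<lambda>(F, G). antipode (basis F) * basis G) (coproduct x) =
      (Poly_Mapping.single 0 (counit x) :: ('d, 'k) tree_alg)" for x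
    unfolding coproduct_eq lin_ext_comp counit[symmetric]
    by (simp add: case_prod_unfold antipode_basis antipode_left_inverse_forest)
  moreover have "lin_ext (\<lambda>(F, G). basis F * antipode (basis G)) (coproduct x) =
      (Poly_Mapping.single 0 (counit x) :: ('d, 'k) tree_alg)" for x
    unfolding coproduct_eq lin_ext_comp counit[symmetric]
    by (simp add: case_prod_unfold antipode_basis antipode_right_inverse_forest)
  ultimately show ?thesis
    unfolding is_antipode_def by (auto simp: antipode_add antipode_scale antipode_H_trees)
qed

section \<open>The coproduct of formal series\<close>

lemma size_le_size_decs: "size F \<le> size (decs F)"
proof (induction F)
  case (add T F)
  have "size (tree_decs T) \<ge> 1" by (cases T) (simp add: tree_decs_Node)
  then show ?case using add decs_add[of "{#T#}" F] by simp
qed simp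

lemma decs_eq_empty_iff [simp]: "decs F = {#} \<longleftrightarrow> F = {#}"
  using size_le_size_decs[of F] by (auto dest: arg_cong[of _ _ size])

lemma finite_bounded_forests:
  assumes "finite S"
  shows "finite {F. set_mset (decs F) \<subseteq> S \<and> size (decs F) \<le> n}"
proof (induction n)
  case 0
  have "{F. set_mset (decs F) \<subseteq> S \<and> size (decs F) \<le> 0} \<subseteq> {{#}}" by auto
  then show ?case by (rule finite_subset) simp
next
  case (Suc n)
  define \<T> where "\<T> = (\<lambda>(d, F). Node d F) ` (S \<times> {F. set_mset (decs F) \<subseteq> S \<and> size (decs F) \<le> n})"
  have "finite \<T>" unfolding \<T>_def using assms Suc by blast
  have "F \<in> mset ` {xs. set xs \<subseteq> \<T> \<and> length xs \<le> Suc n}"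
    if F: "set_mset (decs F) \<subseteq> S" "size (decs F) \<le> Suc n" for F
  proof -
    obtain xs where xs: "F = mset xs" by (metis ex_mset)
    have "T \<in> \<T>" if T: "T \<in> set xs" for T
    proof -
      obtain d G where dG: "T = Node d G" by (cases T)
      have "tree_decs T \<subseteq># decs F"
        using T decs_add[of "{#T#}" "F - {#T#}"] by (simp add: xs)
      then have "add_mset d (decs G) \<subseteq># decs F" by (simp add: dG tree_decs_Node)
      with F have "d \<in> S" "set_mset (decs G) \<subseteq> S" "size (decs G) \<le> n"
        using set_mset_mono[of "add_mset d (decs G)" "decs F"] size_mset_mono[of
          "add_mset d (decs G)" "decs F"] by auto
      then show ?thesis unfolding \<T>_def dG by auto
    qed
    moreover have "length xs \<le> Suc n" using size_le_size_decs[of F] F by (simp add: xs)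
    ultimately show ?thesis using xs by blast
  qed
  moreover have "finite (mset ` {xs. set xs \<subseteq> \<T> \<and> length xs \<le> Suc n})"
    using finite_lists_length_le[OF \<open>finite \<T>\<close>] by (rule finite_imageI)
  ultimately have "{F. set_mset (decs F) \<subseteq> S \<and> size (decs F) \<le> Suc n} \<subseteq> mset ` {xs. set xs \<subseteq>
      \<T> \<and> length xs \<le> Suc n}"
    by blast
  then show ?case using \<open>finite (mset ` _)\<close> by (rule finite_subset)
qed

lemma finite_forests_decs [simp]: "finite {F. decs F = M}"
  by (rule finite_subset[OF _ finite_bounded_forests[of "set_mset M" "size M"]]) auto

text \<open>
  The coefficient of a product in a monoid algebra at an element \<open>c\<close> with finitely many
  decompositions \<open>c = a + b\<close>, in which \<open>b\<close> is determined by \<open>a\<close>.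
\<close>

lemma lookup_mult_decompose:
  fixes p q :: "'a::{comm_monoid_add, minus} \<Rightarrow>\<^sub>0 'k::field_char_0"
  assumes fin: "finite S" and S: "\<And>a b. a + b = c \<longleftrightarrow> a \<in> S \<and> b = c - a"
  shows "Poly_Mapping.lookup (p * q) c =
    (\<Sum>a\<in>S. Poly_Mapping.lookup p a * Poly_Mapping.lookup q (c - a))"
proof -
  let ?l = Poly_Mapping.lookup
  have "?l (p * q) c = (\<Sum>a\<in>Poly_Mapping.keys p. \<Sum>b\<in>Poly_Mapping.keys q.
      (?l p a * ?l q b when a + b = c))"
    by (subst (1) sum_singles[of p], subst (1) sum_singles[of q])
      (simp add: sum_product lookup_sum mult_single lookup_single)
  also have "\<dots> = (\<Sum>a\<in>Poly_Mapping.keys p. if a \<in> S then ?l p a * ?l q (c - a) else 0)"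
  proof (rule sum.cong[OF refl])
    fix a
    have "(\<Sum>b\<in>Poly_Mapping.keys q. (?l p a * ?l q b when a + b = c)) =
       (\<Sum>b\<in>Poly_Mapping.keys q. if b = c - a then (if a \<in> S then ?l p a * ?l q (c - a) else 0)
         else 0)"
      by (intro sum.cong refl) (auto simp: S when_def)
    also have "\<dots> = (if a \<in> S then ?l p a * ?l q (c - a) else 0)"
      by (auto simp: in_keys_iff)
    finally show "(\<Sum>b\<in>Poly_Mapping.keys q. (?l p a * ?l q b when a + b = c)) =
       (if a \<in> S then ?l p a * ?l q (c - a) else 0)" .
  qed
  also have "\<dots> = (\<Sum>a\<in>S. ?l p a * ?l q (c - a))"
    using fin by (subst sum.inter_filter[symmetric])
      (auto simp: in_keys_iff intro!: sum.mono_neutral_left)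
  finally show ?thesis .
qed

lemma add_eq_forest_iff: "A + B = F \<longleftrightarrow> A \<subseteq># F \<and> B = F - A" for A B F :: "'a multiset"
  by auto

lemma lookup_mult_forest:
  fixes p q :: "('d, 'k::field_char_0) tree_alg"
  shows "Poly_Mapping.lookup (p * q) F =
    (\<Sum>A | A \<subseteq># F. Poly_Mapping.lookup p A * Poly_Mapping.lookup q (F - A))"
  by (rule lookup_mult_decompose) (simp_all add: add_eq_forest_iff)

lemma lookup_mult_pairs:
  fixes p q :: "('d, 'k::field_char_0) tree_alg2"
  shows "Poly_Mapping.lookup (p * q) (F, G) =
    (\<Sum>(A, B)\<in>{A. A \<subseteq># F} \<times> {B. B \<subseteq># G}.
       Poly_Mapping.lookup p (A, B) * Poly_Mapping.lookup q (F - A, G - B))"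
  by (subst lookup_mult_decompose[of "{A. A \<subseteq># F} \<times> {B. B \<subseteq># G}"])
    (auto simp: add_eq_forest_iff intro!: sum.cong)

text \<open>
  The coefficient at the pair \<open>(F, G)\<close> of the coproduct of a formal series; only the finitely many
  forests with the same decorations as \<open>F\<close> and \<open>G\<close> together contribute.
\<close>

definition series_coproduct ::
    "('d, 'k::field_char_0) fseries \<Rightarrow> 'd forest \<Rightarrow> 'd forest \<Rightarrow> 'k" where
  "series_coproduct x F G = (\<Sum>H | decs H = decs F + decs G.
     fcoeff x H * Poly_Mapping.lookup (forest_coproduct H) (F, G))"

lemma lookup_forest_coproduct_eq_0:
  "decs H \<noteq> decs F + decs G \<Longrightarrow> Poly_Mapping.lookup (forest_coproduct H
    :: ('d, 'k::field_char_0) tree_alg2) (F, G) = 0"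
  using homog_forest_coproduct[of H] unfolding homog_def
  by (metis (mono_tags, lifting) decs2_simps(1) in_keys_iff mem_Collect_eq subsetD)

lemma series_coproduct_add:
  "series_coproduct (x + y) F G = series_coproduct x F G + series_coproduct y F G"
  by (simp add: series_coproduct_def fcoeff_simps distrib_right sum.distrib)

lemma series_coproduct_fconst_mult:
  "series_coproduct (fconst c * x) F G = c * series_coproduct x F G"
  by (simp add: series_coproduct_def fcoeff_fconst_mult sum_distrib_left mult.assoc)

lemma series_coproduct_one:
  "series_coproduct 1 F G = (if F = {#} \<and> G = {#} then 1 else 0)"
proof -
  have "series_coproduct 1 F G = (\<Sum>H\<in>{H. decs H = decs F + decs G} \<inter> {{#}}.
      (1::'a) * Poly_Mapping.lookup (forest_coproduct H) (F, G))"
    unfolding series_coproduct_def by (rule sum.mono_neutral_cong_right) (auto simp: fcoeff_simps)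
  also have "\<dots> = (if F = {#} \<and> G = {#} then 1 else 0)"
    by (auto simp: lookup_one zero_prod_def when_def Int_insert_right)
  finally show ?thesis .
qed

lemma series_coproduct_mult:
  "series_coproduct (x * y) F G = (\<Sum>(A, B)\<in>{A. A \<subseteq># F} \<times> {B. B \<subseteq># G}.
     series_coproduct x A B * series_coproduct y (F - A) (G - B))"
proof -
  let ?c = "\<lambda>H. Poly_Mapping.lookup (forest_coproduct H)"
  let ?S = "{A. A \<subseteq># F} \<times> {B. B \<subseteq># G}"
  let ?D = "{H. decs H = decs F + decs G}"
  let ?KL = "(\<lambda>(H, K). (K, H - K)) ` (SIGMA H:?D. {K. K \<subseteq># H})"
  have fin: "finite ?KL" by (intro finite_imageI finite_SigmaI) auto
  have KL: "(K, L) \<in> ?KL \<longleftrightarrow> decs (K + L) = decs F + decs G" for K L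
    by (force simp: image_iff subset_mset.add_diff_inverse simp flip: decs_add intro!: bexI[of _
        "(K + L, K)"])
  have "series_coproduct (x * y) F G =
      (\<Sum>H\<in>?D. \<Sum>K | K \<subseteq># H. fcoeff x K * fcoeff y (H - K) * ?c (K + (H - K)) (F, G))"
    unfolding series_coproduct_def times_fseries.rep_eq sum_distrib_right
    by (intro sum.cong refl) (simp add: subset_mset.add_diff_inverse del: forest_coproduct_simps)
  also have "\<dots> = (\<Sum>(K, L)\<in>?KL. fcoeff x K * fcoeff y L * ?c (K + L) (F, G))"
  proof -
    have "inj_on (\<lambda>(H, K). (K, H - K)) (SIGMA H:?D. {K. K \<subseteq># H})"
      by (rule inj_on_inverseI[of _ "\<lambda>(K, L). (K + L, K)"])
          (auto simp: subset_mset.add_diff_inverse)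
    then show ?thesis
      by (subst sum.reindex, assumption, subst sum.Sigma)
        (auto simp: subset_mset.add_diff_inverse simp del: forest_coproduct_simps intro!: sum.cong)
  qed
  also have "\<dots> = (\<Sum>(K, L)\<in>?KL. \<Sum>(A, B)\<in>?S.
      (fcoeff x K * ?c K (A, B)) * (fcoeff y L * ?c L (F - A, G - B)))"
    by (simp add: lookup_mult_pairs sum_distrib_left case_prod_unfold mult_ac)
  also have "\<dots> = (\<Sum>(A, B)\<in>?S. \<Sum>(K, L)\<in>?KL.
      (fcoeff x K * ?c K (A, B)) * (fcoeff y L * ?c L (F - A, G - B)))"
    unfolding case_prod_unfold by (rule sum.swap)
  also have "\<dots> = (\<Sum>(A, B)\<in>?S. series_coproduct x A B * series_coproduct y (F - A) (G - B))"
  proof (intro sum.cong refl, clarify)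
    fix A B assume AB: "A \<subseteq># F" "B \<subseteq># G"
    have "decs F = decs A + decs (F - A)" "decs G = decs B + decs (G - B)"
      using AB by (simp_all flip: decs_add add: subset_mset.add_diff_inverse)
    then have sub: "{H. decs H = decs A + decs B} \<times> {H. decs H = decs (F - A) + decs (G - B)} \<subseteq> ?KL"
    proof clarify
      fix K L
      assume "decs K = decs A + decs B" "decs L = decs (F - A) + decs (G - B)"
        "decs F = decs A + decs (F - A)" "decs G = decs B + decs (G - B)"
      then have "decs (K + L) = decs F + decs G" by simp
      then show "(K, L) \<in> ?KL" unfolding KL .
    qed
    show "(\<Sum>(K, L)\<in>?KL. (fcoeff x K * ?c K (A, B)) * (fcoeff y L * ?c L (F - A, G - B))) =
        series_coproduct x A B * series_coproduct y (F - A) (G - B)"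
      unfolding series_coproduct_def sum_product sum.cartesian_product
      by (rule sum.mono_neutral_right[OF fin sub]) (use lookup_forest_coproduct_eq_0 in fastforce)
  qed
  finally show ?thesis .
qed

lemma lookup_id_tensor_B_plus:
  "Poly_Mapping.lookup (id_tensor_B_plus d z) (F, {#Node d G#}) = Poly_Mapping.lookup z (F, G)"
  for z :: "('d, 'k::field_char_0) tree_alg2"
proof -
  have "Poly_Mapping.lookup (id_tensor_B_plus d z) (F, {#Node d G#}) =
    (\<Sum>a\<in>Poly_Mapping.keys z. if a = (F, G) then Poly_Mapping.lookup z a else 0)"
    unfolding id_tensor_B_plus_def lin_ext_def lookup_sum lookup_scale
    by (intro sum.cong refl) (auto simp: basis_def lookup_single when_def split: prod.splits)
  then show ?thesis by (simp add: in_keys_iff)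
qed

lemma lookup_id_tensor_B_plus_eq_0:
  assumes "\<nexists>G'. G = {#Node d G'#}"
  shows "Poly_Mapping.lookup (id_tensor_B_plus d z) (F, G) = 0"
  unfolding id_tensor_B_plus_def lin_ext_def lookup_sum lookup_scale
  using assms by (intro sum.neutral) (auto simp: basis_def lookup_single when_def split:
    prod.splits)

text \<open>The cocycle property of grafting, for a sum of grafted series.\<close>

lemma series_coproduct_fsum_graft:
  fixes f :: "'d \<Rightarrow> ('d, 'k::field_char_0) fseries" and P :: "'d set"
  defines "y \<equiv> fsum P (\<lambda>d. graft d (f d))"
  shows series_coproduct_fsum_graft_empty: "series_coproduct y F {#} = fcoeff y F"
    and series_coproduct_fsum_graft_tree:
      "series_coproduct y F {#Node d G#} = (if d \<in> P then series_coproduct (f d) F G else 0)"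
    and series_coproduct_fsum_graft_nontree:
      "G \<noteq> {#} \<Longrightarrow> \<nexists>d G'. G = {#Node d G'#} \<Longrightarrow> series_coproduct y F G = 0"
proof -
  let ?c = "\<lambda>H. Poly_Mapping.lookup (forest_coproduct H) :: _ \<Rightarrow> 'k"
  have y0: "fcoeff y H = 0" if "\<nexists>e G. H = {#Node e G#}" for H
    unfolding y_def by (rule fcoeff_fsum_graft_nontree[of H P f, OF that])
  have c: "?c {#Node e H#} (F, G) = (if F = {#Node e H#} \<and> G = {#} then 1 else 0) +
      Poly_Mapping.lookup (id_tensor_B_plus e (forest_coproduct H)) (F, G)" for e H F G
    by (simp add: tree_coproduct_Node lookup_add basis_def lookup_single when_def)
  show "series_coproduct y F {#} = fcoeff y F"
  proof -
    have "fcoeff y H * ?c H (F, {#}) = (if H = F then fcoeff y H else 0)" for H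
    proof (cases "\<exists>e G. H = {#Node e G#}")
      case True
      then obtain e H' where H: "H = {#Node e H'#}" by blast
      show ?thesis
        by (simp add: H c lookup_id_tensor_B_plus_eq_0 eq_commute[of F] del: forest_coproduct_simps)
    next
      case False
      then have "fcoeff y H = 0" by (rule y0)
      then show ?thesis by auto
    qed
    then have "series_coproduct y F {#} = (\<Sum>H | decs H = decs F. if H = F then fcoeff y H else 0)"
      unfolding series_coproduct_def by simp
    then show ?thesis by simp
  qed
  show "series_coproduct y F {#Node d G#} = (if d \<in> P then series_coproduct (f d) F G else 0)"
  proof -
    let ?N = "\<lambda>H. {#Node d H#}"
    have eq0: "fcoeff y H * ?c H (F, ?N G) = 0" if "H \<notin> range ?N" for H
    proof (cases "\<exists>e G. H = {#Node e G#}")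
      case True
      then obtain e H' where H: "H = {#Node e H'#}" by blast
      then have "e \<noteq> d" using that by auto
      then show ?thesis
        by (simp add: H c lookup_id_tensor_B_plus_eq_0 del: forest_coproduct_simps)
    next
      case False
      then have "fcoeff y H = 0" by (rule y0)
      then show ?thesis by auto
    qed
    have "series_coproduct y F (?N G) =
      (\<Sum>H\<in>?N ` {H. decs H = decs F + decs G}. fcoeff y H * ?c H (F, ?N G))"
      unfolding series_coproduct_def
    proof (rule sum.mono_neutral_right)
      show "\<forall>H\<in>{H. decs H = decs F + decs (?N G)} - ?N ` {H. decs H = decs F + decs G}.
          fcoeff y H * ?c H (F, ?N G) = 0"
      proof
        fix H assume H: "H \<in> {H. decs H = decs F + decs (?N G)} - ?N ` {H. decs H = decs F +
            decs G}"
        have "H \<notin> range ?N"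
        proof
          assume "H \<in> range ?N"
          then obtain H' where "H = ?N H'" by blast
          with H show False by (auto simp: tree_decs_Node)
        qed
        then show "fcoeff y H * ?c H (F, ?N G) = 0" by (rule eq0)
      qed
    qed (auto simp: tree_decs_Node)
    also have "\<dots> = (\<Sum>H | decs H = decs F + decs G. fcoeff y (?N H) * ?c H (F, G))"
      by (subst sum.reindex)
        (simp_all add: inj_on_def c lookup_id_tensor_B_plus del: forest_coproduct_simps)
    also have "\<dots> = (if d \<in> P then series_coproduct (f d) F G else 0)"
      by (simp add: y_def fcoeff_fsum_graft series_coproduct_def)
    finally show ?thesis .
  qed
  show "series_coproduct y F G = 0" if "G \<noteq> {#}" "\<nexists>d G'. G = {#Node d G'#}"
  proof -
    have "fcoeff y H * ?c H (F, G) = 0" for H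
    proof (cases "\<exists>e G. H = {#Node e G#}")
      case True
      then obtain e H' where H: "H = {#Node e H'#}" by blast
      then show ?thesis
        using that by (simp add: c lookup_id_tensor_B_plus_eq_0 del: forest_coproduct_simps)
    next
      case False
      then have "fcoeff y H = 0" by (rule y0)
      then show ?thesis by auto
    qed
    then show ?thesis by (simp add: series_coproduct_def)
  qed
qed

section \<open>Systems with exponents linear in the degree\<close>

lemma forest_deg_carrier [simp]: "forest_deg N deg F \<in> carrier_vec N"
  by (simp add: forest_deg_def)

lemma forest_deg_empty [simp]: "forest_deg N deg {#} = 0\<^sub>v N"
  by (auto simp: forest_deg_def)

lemma forest_deg_add: "forest_deg N deg (F + G) = forest_deg N deg F + forest_deg N deg G"
  by (auto simp: forest_deg_def)

lemma forest_deg_Node: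
  "deg d \<in> carrier_vec N \<Longrightarrow> forest_deg N deg {#Node d F#} = deg d + forest_deg N deg F"
  by (auto simp: forest_deg_def tree_decs_Node)

lemma forest_deg_cong_decs: "decs F = decs G \<Longrightarrow> forest_deg N deg F = forest_deg N deg G"
  by (simp add: forest_deg_def)

text \<open>
  The system \<open>Y\<^sub>i = \<Sum>\<^bsub>d \<in> P\<^sub>i\<^esub> B\<^sub>d (\<Prod>\<^sub>j E\<^sub>j ^ n\<^sub>j(d))\<close>, where \<open>E\<^sub>j\<close> is \<open>1 + Y\<^sub>j\<close> or
  \<open>1 / (1 - Y\<^sub>j)\<close> according to the sign \<open>b\<^sub>j\<close>, and where the exponents are, up to a correction for
  \<open>j = i\<close>, linear functions \<open>\<l>\<^sub>j\<close> of the degree of \<open>d\<close>. The degrees of decorations are nonzero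
  vectors of natural numbers, and each degree occurs finitely often in every \<open>P\<^sub>i\<close>.
\<close>

locale graded_system =
  fixes M N :: nat and P :: "nat \<Rightarrow> 'd set" and deg :: "'d \<Rightarrow> rat vec"
    and b :: "nat \<Rightarrow> 'k::field_char_0" and \<l> :: "nat \<Rightarrow> rat vec \<Rightarrow> 'k" and n :: "'d \<Rightarrow> nat \<Rightarrow> nat"
    and Y :: "nat \<Rightarrow> ('d, 'k) fseries"
  assumes sign: "j < M \<Longrightarrow> b j = 1 \<or> b j = -1"
    and linear: "j < M \<Longrightarrow> u \<in> carrier_vec N \<Longrightarrow> v \<in> carrier_vec N \<Longrightarrow> \<l> j (u + v) = \<l> j u + \<l> j v"
    and exponent: "i < M \<Longrightarrow> j < M \<Longrightarrow> d \<in> P i \<Longrightarrow>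
      of_nat (n d j) = \<l> j (deg d) + (if j = i then b i else 0)"
    and deg_nat: "i < M \<Longrightarrow> d \<in> P i \<Longrightarrow> \<exists>\<alpha>\<in>carrier_vec N. deg d = map_vec of_nat (\<alpha> :: nat vec)"
    and deg_nonzero: "i < M \<Longrightarrow> d \<in> P i \<Longrightarrow> deg d \<noteq> 0\<^sub>v N"
    and deg_finite: "i < M \<Longrightarrow> \<alpha> \<in> carrier_vec N \<Longrightarrow> finite {d \<in> P i. deg d = map_vec of_nat (\<alpha>
      :: nat vec)}"
    and solution: "i < M \<Longrightarrow> Y i = fsum (P i) (\<lambda>d. graft d
      (\<Prod>j<M. fps_eval (F_series 1 (b j)) (Y j) ^ n d j))"
begin

abbreviation \<delta> :: "'d forest \<Rightarrow> rat vec" where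
  "\<delta> \<equiv> forest_deg N deg"

definition E :: "nat \<Rightarrow> ('d, 'k) fseries" where
  "E j = fps_eval (F_series 1 (b j)) (Y j)"

text \<open>This is \<open>E\<^sub>j\<close> for the sign \<open>1\<close>, and its inverse for the sign \<open>-1\<close>.\<close>

definition W :: "nat \<Rightarrow> ('d, 'k) fseries" where
  "W j = 1 + fconst (b j) * Y j"

text \<open>
  The part of the coefficient of \<open>B\<^sub>d\<close> that depends on the degree of \<open>d\<close> only. It is defined for
  all rational vectors, so that it can be applied to the degrees of arbitrary forests.
\<close>

definition U :: "rat vec \<Rightarrow> ('d, 'k) fseries" where
  "U v = (\<Prod>j<M. fps_eval (F_series (\<l> j v) (b j)) (Y j))"

lemma Y_nontree: "i < M \<Longrightarrow> \<nexists>d F'. F = {#Node d F'#} \<Longrightarrow> fcoeff (Y i) F = 0"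
  by (subst solution) (simp_all add: fcoeff_fsum_graft_nontree)

lemma Y_tree: "i < M \<Longrightarrow>
    fcoeff (Y i) {#Node d F#} = (if d \<in> P i then fcoeff (\<Prod>j<M. E j ^ n d j) F else 0)"
  by (subst solution) (simp_all add: fcoeff_fsum_graft E_def)

lemma Y_empty: "i < M \<Longrightarrow> fcoeff (Y i) {#} = 0"
  by (simp add: Y_nontree)

lemma W_eq: "j < M \<Longrightarrow> W j = fps_eval (F_series (b j) (b j)) (Y j)"
  by (simp add: W_def F_series_self fps_eval_linear Y_empty)

lemma linear_zero: "j < M \<Longrightarrow> \<l> j (0\<^sub>v N) = 0"
  using linear[of j "0\<^sub>v N" "0\<^sub>v N"] by simp

lemma U_zero: "U (0\<^sub>v N) = 1"
  by (simp add: U_def linear_zero F_series_0 fps_eval_1 Y_empty)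

lemma U_add: "u \<in> carrier_vec N \<Longrightarrow> v \<in> carrier_vec N \<Longrightarrow> U (u + v) = U u * U v"
  unfolding U_def prod.distrib[symmetric]
  by (intro prod.cong refl) (simp only: lessThan_iff linear Y_empty fps_eval_mult[symmetric]
      F_series_mult)

lemma deg_carrier: "i < M \<Longrightarrow> d \<in> P i \<Longrightarrow> deg d \<in> carrier_vec N"
  using deg_nat by fastforce

lemma exponents_eq:
  assumes "i < M" "d \<in> P i"
  shows "(\<Prod>j<M. E j ^ n d j) = W i * U (deg d)"
  unfolding E_def W_def U_def
  using prod_F_series_exponents[where Z = Y and n = "n d" and b = b and c = "\<lambda>j. \<l> j (deg d)",
      OF assms(1) Y_empty exponent[OF assms(1) _ assms(2)]] .

text \<open>
  The identity \<open>\<Delta>(x) = \<Sum>\<^sub>\<beta> x U\<^sub>\<beta> \<otimes> x(\<beta>)\<close>, with \<open>x(\<beta>)\<close> the homogeneous component of degree \<open>\<beta>\<close> of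
  \<open>x\<close>, at the pairs of forests with less than \<open>m\<close> vertices in total. Since \<open>U\<close> turns sums into
  products, it is stable under products.
\<close>

definition twisted_grouplike :: "nat \<Rightarrow> ('d, 'k) fseries \<Rightarrow> bool" where
  "twisted_grouplike m x \<longleftrightarrow> (\<forall>F G. size (decs F) + size (decs G) < m \<longrightarrow>
     series_coproduct x F G = fcoeff (x * U (\<delta> G)) F * fcoeff x G)"

lemma twisted_mult:
  "fcoeff (x * y * U (\<delta> G)) F * fcoeff (x * y) G =
    (\<Sum>(A, B)\<in>{A. A \<subseteq># F} \<times> {B. B \<subseteq># G}.
       (fcoeff (x * U (\<delta> B)) A * fcoeff x B) *
       (fcoeff (y * U (\<delta> (G - B))) (F - A) * fcoeff y (G - B)))"
proof -
  have "fcoeff (x * y * U (\<delta> G)) F * fcoeff (x * y) G =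
     (\<Sum>B | B \<subseteq># G. fcoeff ((x * U (\<delta> B)) * (y * U (\<delta> (G - B)))) F *
       (fcoeff x B * fcoeff y (G - B)))"
    unfolding times_fseries.rep_eq[of x y] sum_distrib_left
  proof (intro sum.cong refl)
    fix B assume "B \<in> {B. B \<subseteq># G}"
    then have "\<delta> G = \<delta> B + \<delta> (G - B)" by (simp flip: forest_deg_add)
    then have "U (\<delta> G) = U (\<delta> B) * U (\<delta> (G - B))" by (simp add: U_add)
    then show "fcoeff (x * y * U (\<delta> G)) F * (fcoeff x B * fcoeff y (G - B)) =
       fcoeff ((x * U (\<delta> B)) * (y * U (\<delta> (G - B)))) F * (fcoeff x B * fcoeff y (G - B))"
      by (simp only: mult_ac)
  qed
  also have "\<dots> = (\<Sum>B | B \<subseteq># G. \<Sum>A | A \<subseteq># F. (fcoeff (x * U (\<delta> B)) A * fcoeff x B) *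
       (fcoeff (y * U (\<delta> (G - B))) (F - A) * fcoeff y (G - B)))"
    unfolding times_fseries.rep_eq[of "x * U _" "y * U _"] sum_distrib_right
    by (intro sum.cong refl) (simp only: mult_ac)
  also have "\<dots> = (\<Sum>A | A \<subseteq># F. \<Sum>B | B \<subseteq># G. (fcoeff (x * U (\<delta> B)) A * fcoeff x B) *
       (fcoeff (y * U (\<delta> (G - B))) (F - A) * fcoeff y (G - B)))"
    by (rule sum.swap)
  finally show ?thesis by (simp add: sum.cartesian_product)
qed

lemma size_decs_diff:
  "A \<subseteq># F \<Longrightarrow> size (decs A) + size (decs (F - A)) = size (decs F)"
  by (metis decs_add size_union subset_mset.add_diff_inverse)

lemma twisted_grouplike_mult:
  assumes "twisted_grouplike m x" "twisted_grouplike m y"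
  shows "twisted_grouplike m (x * y)"
  unfolding twisted_grouplike_def twisted_mult series_coproduct_mult
proof (intro allI impI sum.cong refl, clarify)
  fix F G A B :: "'d forest"
  assume "size (decs F) + size (decs G) < m" "A \<subseteq># F" "B \<subseteq># G"
  then have "size (decs A) + size (decs B) < m" "size (decs (F - A)) + size (decs (G - B)) < m"
    using size_decs_diff[of A F] size_decs_diff[of B G] by linarith+
  then show "series_coproduct x A B * series_coproduct y (F - A) (G - B) =
     fcoeff (x * U (\<delta> B)) A * fcoeff x B * (fcoeff (y * U (\<delta> (G - B))) (F - A) * fcoeff y (G - B))"
    using assms by (simp add: twisted_grouplike_def)
qed

lemma twisted_grouplike_one: "twisted_grouplike m 1"
  by (auto simp: twisted_grouplike_def series_coproduct_one U_zero fcoeff_simps)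

lemma twisted_grouplike_prod:
  "(\<And>i. i \<in> I \<Longrightarrow> twisted_grouplike m (f i)) \<Longrightarrow> twisted_grouplike m (\<Prod>i\<in>I. f i)"
  by (induction I rule: infinite_finite_induct)
      (simp_all add: twisted_grouplike_one twisted_grouplike_mult)

lemma twisted_grouplike_power: "twisted_grouplike m x \<Longrightarrow> twisted_grouplike m (x ^ p)"
  by (induction p) (simp_all add: twisted_grouplike_one twisted_grouplike_mult)

text \<open>
  For an inverse, both sides of the identity are inverse to those for \<open>x\<close>, so they agree by
  induction on the number of vertices.
\<close>

lemma twisted_grouplike_inverse:
  assumes x: "twisted_grouplike m x" and xy: "x * y = 1" and x0: "fcoeff x {#} = 1"
  shows "twisted_grouplike m y"
  unfolding twisted_grouplike_def
proof (intro allI impI)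
  fix F G :: "'d forest"
  assume "size (decs F) + size (decs G) < m"
  then show "series_coproduct y F G = fcoeff (y * U (\<delta> G)) F * fcoeff y G"
  proof (induction "size (decs F) + size (decs G)" arbitrary: F G rule: less_induct)
    case less
    let ?S = "{A. A \<subseteq># F} \<times> {B. B \<subseteq># G}"
    let ?c = "\<lambda>z A B. fcoeff (z * U (\<delta> B)) A * fcoeff z B"
    have m: "size (decs {#}) + size (decs {#}) < m" using less.prems by simp
    have one: "series_coproduct 1 F G = ?c 1 F G"
      using twisted_grouplike_one[of "Suc (size (decs F) + size (decs G))"]
      by (simp add: twisted_grouplike_def)
    have x00: "series_coproduct x {#} {#} = 1" "?c x {#} {#} = 1"
      using x m x0 unfolding twisted_grouplike_def
      by (simp_all add: U_zero)
    have rest: "(\<Sum>(A, B)\<in>?S - {({#}, {#})}. series_coproduct x A B * series_coproduct y (F - A)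
        (G - B)) =
      (\<Sum>(A, B)\<in>?S - {({#}, {#})}. ?c x A B * ?c y (F - A) (G - B))"
    proof (rule sum.cong[OF refl], unfold case_prod_unfold)
      fix p assume "p \<in> ?S - {({#}, {#})}"
      then obtain A B where p: "p = (A, B)" and AB: "A \<subseteq># F" "B \<subseteq># G" "(A, B) \<noteq> ({#}, {#})" by auto
      then have "0 < size (decs A) + size (decs B)" by (auto simp flip: nonempty_has_size)
      then have *: "size (decs (F - A)) + size (decs (G - B)) < size (decs F) + size (decs G)"
        "size (decs A) + size (decs B) < m"
        using less.prems size_decs_diff[OF AB(1)] size_decs_diff[OF AB(2)] by linarith+
      then have "series_coproduct y (F - A) (G - B) = ?c y (F - A) (G - B)"
        using less.prems by (intro less.hyps) auto
      moreover have "series_coproduct x A B = ?c x A B"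
        using x *(2) by (simp add: twisted_grouplike_def)
      ultimately show "series_coproduct x (fst p) (snd p) * series_coproduct y (F - fst p)
          (G - snd p) =
         ?c x (fst p) (snd p) * ?c y (F - fst p) (G - snd p)" by (simp add: p)
    qed
    have "({#}, {#}) \<in> ?S" "finite ?S" by auto
    note remove = sum.remove[OF this(2) this(1)]
    have "series_coproduct (x * y) F G = ?c (x * y) F G"
      using one by (simp add: xy)
    then show ?case
      unfolding series_coproduct_mult twisted_mult remove rest
      using x00 by simp
  qed
qed

lemma W_empty: "j < M \<Longrightarrow> fcoeff (W j) {#} = 1"
  by (simp add: W_def fcoeff_simps fcoeff_mult_empty Y_empty)

lemma twisted_grouplike_E:
  assumes j: "j < M" and W: "twisted_grouplike m (W j)"
  shows "twisted_grouplike m (E j)"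
proof -
  have "E j = W j" if "b j = 1" using that by (simp add: W_eq j E_def)
  moreover have "W j * E j = 1" if "b j = -1"
    using that F_series_mult[of "b j" "b j" 1]
    by (simp add: W_eq j E_def Y_empty F_series_0 fps_eval_1 flip: fps_eval_mult)
  ultimately show ?thesis
    using sign[OF j] W twisted_grouplike_inverse[OF W _ W_empty[OF j]] by auto
qed

text \<open>
  The cocycle property of grafting turns the identity below \<open>m\<close> vertices into the coproduct of
  \<open>Y\<^sub>i\<close> up to \<open>m\<close> vertices: the identity is needed only after the root of \<open>G\<close> has been removed.
\<close>

lemma series_coproduct_Y_step:
  assumes W: "\<And>j. j < M \<Longrightarrow> twisted_grouplike m (W j)" and i: "i < M"
    and m: "size (decs F) + size (decs G) \<le> m"
  shows "series_coproduct (Y i) F G =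
    (if G = {#} then fcoeff (Y i) F else 0) + fcoeff (W i * U (\<delta> G)) F * fcoeff (Y i) G"
proof (cases "\<exists>d G'. G = {#Node d G'#}")
  case True
  then obtain d G' where G: "G = {#Node d G'#}" by blast
  show ?thesis
  proof (cases "d \<in> P i")
    case d: True
    have "twisted_grouplike m (\<Prod>j<M. E j ^ n d j)"
      using W by (intro twisted_grouplike_prod twisted_grouplike_power twisted_grouplike_E) auto
    moreover have "size (decs F) + size (decs G') < m"
      using m by (simp add: G tree_decs_Node)
    ultimately have "series_coproduct (\<Prod>j<M. E j ^ n d j) F G' =
        fcoeff (W i * U (deg d) * U (\<delta> G')) F * fcoeff (Y i) G"
      using i d by (simp add: twisted_grouplike_def exponents_eq[OF i d] G Y_tree)
    moreover have "U (deg d) * U (\<delta> G') = U (\<delta> G)"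
      using deg_carrier[OF i d] by (simp add: G forest_deg_Node U_add)
    moreover have "series_coproduct (Y i) F G = series_coproduct (\<Prod>j<M. E j ^ n d j) F G'"
      using d by (subst solution[OF i]) (simp add: G series_coproduct_fsum_graft_tree flip: E_def)
    ultimately show ?thesis by (simp add: G mult.assoc)
  next
    case False
    then show ?thesis using i
      by (subst solution[OF i]) (simp add: G series_coproduct_fsum_graft_tree Y_tree)
  qed
next
  case False
  have "series_coproduct (Y i) F {#} = fcoeff (Y i) F"
    by (subst (1 2) solution[OF i]) (rule series_coproduct_fsum_graft_empty)
  moreover have "series_coproduct (Y i) F G = 0" if "G \<noteq> {#}"
    using that False by (subst solution[OF i]) (rule series_coproduct_fsum_graft_nontree)
  ultimately show ?thesis
    using i False by (auto simp: Y_nontree)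
qed

lemma twisted_grouplike_W: "j < M \<Longrightarrow> twisted_grouplike m (W j)"
proof (induction m arbitrary: j)
  case (Suc m)
  show ?case unfolding twisted_grouplike_def
  proof (intro allI impI)
    fix F G :: "'d forest"
    assume m: "size (decs F) + size (decs G) < Suc m"
    then have "series_coproduct (W j) F G = (if F = {#} \<and> G = {#} then 1 else 0) + b j *
      ((if G = {#} then fcoeff (Y j) F else 0) + fcoeff (W j * U (\<delta> G)) F * fcoeff (Y j) G)"
      using series_coproduct_Y_step[OF Suc.IH Suc.prems, of F G]
      by (simp add: W_def series_coproduct_add series_coproduct_one series_coproduct_fconst_mult)
    also have "\<dots> = fcoeff (W j * U (\<delta> G)) F * fcoeff (W j) G"
    proof (cases "G = {#}")
      case True
      then show ?thesis
        using Suc.prems by (simp add: U_zero Y_empty W_empty)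
          (simp add: W_def fcoeff_simps fcoeff_fconst_mult)
    next
      case False
      then have "fcoeff (W j) G = b j * fcoeff (Y j) G"
        by (simp add: W_def fcoeff_simps fcoeff_fconst_mult)
      then show ?thesis using False by simp
    qed
    finally show "series_coproduct (W j) F G = fcoeff (W j * U (\<delta> G)) F * fcoeff (W j) G" .
  qed
qed (simp add: twisted_grouplike_def)

lemma series_coproduct_Y:
  "i < M \<Longrightarrow> series_coproduct (Y i) F G =
    (if G = {#} then fcoeff (Y i) F else 0) + fcoeff (W i * U (\<delta> G)) F * fcoeff (Y i) G"
  by (rule series_coproduct_Y_step[OF twisted_grouplike_W _ order_refl])

end

section \<open>Tensor squares and generated subalgebras\<close>

lemma lookup_tensor:
  fixes x y :: "('d, 'k::field_char_0) tree_alg"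
  shows "Poly_Mapping.lookup (tensor x y) (F, G) = Poly_Mapping.lookup x F *
      Poly_Mapping.lookup y G"
proof -
  let ?l = Poly_Mapping.lookup
  have 1: "?l (lin_ext (\<lambda>G. basis (F', G)) y) (F, G) = (if F' = F then ?l y G else 0)" for F'
  proof -
    have "?l (lin_ext (\<lambda>G. basis (F', G)) y) (F, G) =
      (\<Sum>G'\<in>Poly_Mapping.keys y. if G' = G then (if F' = F then ?l y G' else 0) else 0)"
      unfolding lin_ext_def lookup_sum lookup_scale
      by (intro sum.cong refl) (auto simp: basis_def lookup_single when_def)
    then show ?thesis by (simp add: in_keys_iff)
  qed
  have "?l (tensor x y) (F, G) = (\<Sum>F'\<in>Poly_Mapping.keys x. if F' = F then ?l x F' * ?l y G else 0)"
    unfolding tensor_def lin_ext_def[of _ x] lookup_sum lookup_scale 1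
    by (intro sum.cong refl) auto
  then show ?thesis by (simp add: in_keys_iff)
qed

lemma tensor_mult: "tensor a c * tensor b d = tensor (a * b) (c * d)"
  for a b c d :: "('d, 'k::field_char_0) tree_alg"
proof -
  have t: "tensor x y = lin_ext (\<lambda>F. basis (F, {#})) x * lin_ext (\<lambda>G. basis ({#}, G)) y" for x y
      :: "('d, 'k) tree_alg"
  proof -
    define z :: "('d, 'k) tree_alg2" where "z = lin_ext (\<lambda>G. basis ({#}, G)) y"
    have "lin_ext (\<lambda>G. basis (F, G)) y = basis (F, {#}) * z" for F
      unfolding z_def mult_lin_ext basis_mult by simp
    then have "lin_ext (\<lambda>G. basis (F, G)) y = z * basis (F, {#})" for F
      by (simp only: mult.commute)
    then have "tensor x y = z * lin_ext (\<lambda>F. basis (F, {#})) x"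
      by (simp add: tensor_def mult_lin_ext)
    then show ?thesis unfolding z_def by (simp only: mult.commute)
  qed
  have 1: "lin_ext (\<lambda>F. basis (F, {#})) (a * b) =
      (lin_ext (\<lambda>F. basis (F, {#})) a * lin_ext (\<lambda>F. basis (F, {#})) b :: ('d, 'k) tree_alg2)"
    by (rule lin_ext_mult) (simp add: basis_mult)
  have 2: "lin_ext (\<lambda>F. basis ({#}, F)) (c * d) =
      (lin_ext (\<lambda>F. basis ({#}, F)) c * lin_ext (\<lambda>F. basis ({#}, F)) d :: ('d, 'k) tree_alg2)"
    by (rule lin_ext_mult) (simp add: basis_mult)
  show ?thesis unfolding t 1 2 by (simp only: mult_ac)
qed

lemma tensor_scale: "tensor (Poly_Mapping.single 0 c * x) y = Poly_Mapping.single 0 c * tensor x y"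
  unfolding tensor_def by (rule lin_ext_scale)

lemma tensor_one_one: "tensor 1 1 = 1"
  by (simp add: tensor_one lin_ext_one basis_zero flip: zero_prod_def)

lemma tensor_squareI:
  assumes "finite I" "\<And>i. i \<in> I \<Longrightarrow> a i \<in> A \<and> b i \<in> A"
  shows "(\<Sum>i\<in>I. tensor (a i) (b i)) \<in> tensor_square A"
proof -
  obtain h where h: "bij_betw h {..<card I} I"
    using ex_bij_betw_nat_finite[OF assms(1)] by (auto simp: lessThan_atLeast0)
  then have sum: "(\<Sum>i\<in>I. tensor (a i) (b i)) = (\<Sum>i<card I. tensor (a (h i)) (b (h i)))"
    by (intro sum.reindex_bij_betw[symmetric])
  have mem: "\<forall>i<card I. a (h i) \<in> A \<and> b (h i) \<in> A"
    using h assms(2) by (auto simp: bij_betw_def)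
  show ?thesis
    unfolding tensor_square_def mem_Collect_eq
    by (rule exI[of _ "card I"], rule exI[of _ "\<lambda>i. a (h i)"], rule exI[of _ "\<lambda>i. b (h i)"])
      (simp add: sum mem)
qed

lemma tensor_squareE:
  assumes "z \<in> tensor_square A"
  obtains a b and n :: nat where "z = (\<Sum>i<n. tensor (a i) (b i))" "\<forall>i<n. a i \<in> A \<and> b i \<in> A"
  using assms unfolding tensor_square_def by auto

lemma tensor_in_square: "a \<in> A \<Longrightarrow> b \<in> A \<Longrightarrow> tensor a b \<in> tensor_square A"
  using tensor_squareI[of "{()}" "\<lambda>_. a" A "\<lambda>_. b"] by simp

lemma tensor_square_add:
  assumes "y \<in> tensor_square A" "z \<in> tensor_square A"
  shows "y + z \<in> tensor_square A"
proof -
  obtain a b and m :: nat where y: "y = (\<Sum>i<m. tensor (a i) (b i))" "\<forall>i<m. a i \<in> A \<and> b i \<in> A"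
    using assms(1) by (rule tensor_squareE)
  obtain c d and n :: nat where z: "z = (\<Sum>i<n. tensor (c i) (d i))" "\<forall>i<n. c i \<in> A \<and> d i \<in> A"
    using assms(2) by (rule tensor_squareE)
  have "y + z = (\<Sum>i\<in>{..<m} <+> {..<n}. tensor (case_sum a c i) (case_sum b d i))"
    by (simp add: y z sum.Plus)
  moreover have "\<dots> \<in> tensor_square A"
    by (rule tensor_squareI) (use y z in auto)
  ultimately show ?thesis by simp
qed

lemma subalgebra_generated: "subalgebra (generated_subalgebra S)"
  unfolding subalgebra_def by (auto intro: generated_subalgebra.intros)

lemma subalgebra_closed:
  assumes "subalgebra A"
  shows "1 \<in> A" "x \<in> A \<Longrightarrow> y \<in> A \<Longrightarrow> x + y \<in> A" "x \<in> A \<Longrightarrow> y \<in> A \<Longrightarrow> x * y \<in> A"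
    "x \<in> A \<Longrightarrow> Poly_Mapping.single 0 c * x \<in> A" "0 \<in> A"
    "(\<And>i. i \<in> I \<Longrightarrow> f i \<in> A) \<Longrightarrow> sum f I \<in> A" "x \<in> A \<Longrightarrow> - x \<in> A"
proof -
  show closed: "1 \<in> A" "x \<in> A \<Longrightarrow> y \<in> A \<Longrightarrow> x + y \<in> A" "x \<in> A \<Longrightarrow> y \<in> A \<Longrightarrow> x * y \<in> A"
    "x \<in> A \<Longrightarrow> Poly_Mapping.single 0 c * x \<in> A" for x y c
    using assms by (auto simp: subalgebra_def)
  show "0 \<in> A" using closed(4)[of 1 0] closed(1) by simp
  then show "(\<And>i. i \<in> I \<Longrightarrow> f i \<in> A) \<Longrightarrow> sum f I \<in> A"
    by (induction I rule: infinite_finite_induct) (auto intro: closed)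
  have "Poly_Mapping.single 0 (- 1) * x = - x" for x :: "('a, 'b) tree_alg"
    by (rule poly_mapping_eqI) (simp add: lookup_scale)
  then show "x \<in> A \<Longrightarrow> - x \<in> A" using closed(4)[of x "-1"] by simp
qed

lemma generated_subalgebra_minimal:
  assumes "x \<in> generated_subalgebra S" "subalgebra A" "S \<subseteq> A"
  shows "x \<in> A"
  using assms(1) by induction (use assms(2,3) in \<open>auto simp: subalgebra_def\<close>)

lemma generated_subalgebra_mono:
  "S \<subseteq> S' \<Longrightarrow> generated_subalgebra S \<subseteq> generated_subalgebra S'"
  using generated_subalgebra_minimal[of _ S "generated_subalgebra S'"] subalgebra_generated[of S']
  by (auto intro: generated_subalgebra.gen)

lemma subalgebra_H_trees: "subalgebra (H_trees D :: ('d, 'k::field_char_0) tree_alg set)"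
proof -
  have add: "x + y \<in> H_trees D" if "x \<in> H_trees D" "y \<in> H_trees D" for x y :: "('d, 'k) tree_alg"
    using that keys_add[of x y] unfolding H_trees_def by auto
  have mult: "x * y \<in> H_trees D" if "x \<in> H_trees D" "y \<in> H_trees D" for x y :: "('d, 'k) tree_alg"
    using that keys_mult[of x y] unfolding H_trees_def by fastforce
  have scale: "Poly_Mapping.single 0 c * x \<in> H_trees D" if "x \<in> H_trees D" for c and x ::
      "('d, 'k) tree_alg"
    using that unfolding H_trees_def by (auto simp: in_keys_iff lookup_scale)
  have one: "(1 :: ('d, 'k) tree_alg) \<in> H_trees D" by (simp add: H_trees_def)
  show ?thesis
    unfolding subalgebra_def using one add mult scale by blast
qed

text \<open>Stability under the coproduct can be checked on generators.\<close>

lemma coproduct_generated_subalgebra: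
  fixes S :: "('d, 'k::field_char_0) tree_alg set"
  assumes gen: "\<And>x. x \<in> S \<Longrightarrow> coproduct x \<in> tensor_square (generated_subalgebra S)"
    and x: "x \<in> generated_subalgebra S"
  shows "coproduct x \<in> tensor_square (generated_subalgebra S)"
  using x
proof induction
  case one
  have "coproduct (1 :: ('d, 'k) tree_alg) = 1"
    using coproduct_const[of 1] by simp
  then show ?case
    using tensor_in_square[of 1 "generated_subalgebra S" 1]
      by (simp add: tensor_one_one generated_subalgebra.one)
next
  case (mult x y)
  obtain a b and m :: nat where y: "coproduct x = (\<Sum>i<m. tensor (a i) (b i))"
      "\<forall>i<m. a i \<in> generated_subalgebra S \<and> b i \<in> generated_subalgebra S"
    using mult.IH(1) by (rule tensor_squareE)
  obtain c d and n :: nat where z: "coproduct y = (\<Sum>i<n. tensor (c i) (d i))"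
      "\<forall>i<n. c i \<in> generated_subalgebra S \<and> d i \<in> generated_subalgebra S"
    using mult.IH(2) by (rule tensor_squareE)
  have "coproduct (x * y) = (\<Sum>p\<in>{..<m} \<times> {..<n}. tensor (a (fst p) * c (snd p)) (b (fst p) *
      d (snd p)))"
    by (simp add: coproduct_mult y z sum_product tensor_mult sum.cartesian_product case_prod_unfold)
  moreover have "\<dots> \<in> tensor_square (generated_subalgebra S)"
    by (rule tensor_squareI) (use y z in \<open>auto intro: generated_subalgebra.mult\<close>)
  ultimately show ?case by simp
next
  case (scale x c)
  obtain a b and m :: nat where y: "coproduct x = (\<Sum>i<m. tensor (a i) (b i))"
      "\<forall>i<m. a i \<in> generated_subalgebra S \<and> b i \<in> generated_subalgebra S"
    using scale.IH by (rule tensor_squareE)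
  have "coproduct (Poly_Mapping.single 0 c * x) = (\<Sum>i<m. tensor (Poly_Mapping.single 0 c *
      a i) (b i))"
    by (simp add: coproduct_mult coproduct_const y sum_distrib_left tensor_scale)
  moreover have "\<dots> \<in> tensor_square (generated_subalgebra S)"
    by (rule tensor_squareI) (use y in \<open>auto intro: generated_subalgebra.scale\<close>)
  ultimately show ?case by simp
qed (auto simp: coproduct_add intro: gen tensor_square_add)

section \<open>The subalgebra of homogeneous components\<close>

text \<open>The sum of the entries of a degree.\<close>

definition total :: "nat vec \<Rightarrow> nat" where
  "total \<alpha> = (\<Sum>r<dim_vec \<alpha>. \<alpha> $ r)"

text \<open>The degrees \<open>\<beta>\<close> with \<open>\<beta> \<le> \<alpha>\<close> entrywise, for which \<open>\<alpha> - \<beta>\<close> is not truncated.\<close>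

definition below :: "nat vec \<Rightarrow> nat vec set" where
  "below \<alpha> = {\<beta> \<in> carrier_vec (dim_vec \<alpha>). \<forall>r<dim_vec \<alpha>. \<beta> $ r \<le> \<alpha> $ r}"

lemma finite_below: "finite (below \<alpha>)"
proof -
  have "below \<alpha> \<subseteq> vec_of_list ` {xs. set xs \<subseteq> {..total \<alpha>} \<and> length xs = dim_vec \<alpha>}"
  proof
    fix \<beta> assume \<beta>: "\<beta> \<in> below \<alpha>"
    have "\<beta> $ r \<le> total \<alpha>" if "r < dim_vec \<alpha>" for r
    proof -
      have "\<beta> $ r \<le> \<alpha> $ r" using \<beta> that by (simp add: below_def)
      also have "\<dots> \<le> total \<alpha>" unfolding total_def using that by (intro member_le_sum) auto
      finally show ?thesis .
    qed
    then have "set (list_of_vec \<beta>) \<subseteq> {..total \<alpha>}"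
      using \<beta> by (auto simp: below_def set_list_of_vec vec_set_def)
    moreover have "length (list_of_vec \<beta>) = dim_vec \<alpha>"
      using \<beta> by (simp add: below_def)
    ultimately show "\<beta> \<in> vec_of_list ` {xs. set xs \<subseteq> {..total \<alpha>} \<and> length xs = dim_vec \<alpha>}"
      by (intro image_eqI[of _ _ "list_of_vec \<beta>"]) (auto simp: vec_list)
  qed
  then show ?thesis
    by (rule finite_subset) (intro finite_imageI finite_lists_length_eq; simp)
qed

abbreviation of_nat_vec :: "nat vec \<Rightarrow> rat vec" where
  "of_nat_vec \<equiv> map_vec of_nat"

lemma of_nat_vec_eq_iff: "of_nat_vec \<alpha> = of_nat_vec \<beta> \<longleftrightarrow> \<alpha> = \<beta>"
  by (auto simp: vec_eq_iff)

lemma of_nat_vec_add: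
  "\<alpha> \<in> carrier_vec N \<Longrightarrow> \<beta> \<in> carrier_vec N \<Longrightarrow> of_nat_vec (\<alpha> + \<beta>) = of_nat_vec \<alpha> + of_nat_vec \<beta>"
  by (auto simp: vec_eq_iff)

lemma below_add_diff:
  "\<alpha> \<in> carrier_vec N \<Longrightarrow> \<beta> \<in> below \<alpha> \<Longrightarrow> \<beta> + (\<alpha> - \<beta>) = \<alpha>" "\<alpha> \<in> carrier_vec N \<Longrightarrow> \<beta> \<in> below \<alpha> \<Longrightarrow>
    \<beta> \<in> carrier_vec N"
  by (auto simp: vec_eq_iff below_def)

lemma total_add: "\<alpha> \<in> carrier_vec N \<Longrightarrow> \<beta> \<in> carrier_vec N \<Longrightarrow> total (\<alpha> + \<beta>) = total \<alpha> + total \<beta>"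
  by (auto simp: total_def sum.distrib)

lemma total_eq_0_iff: "\<alpha> \<in> carrier_vec N \<Longrightarrow> total \<alpha> = 0 \<longleftrightarrow> \<alpha> = 0\<^sub>v N"
  by (auto simp: total_def vec_eq_iff)

context graded_system
begin

text \<open>All decorations that occur in the system.\<close>

definition D :: "'d set" where
  "D = (\<Union>i<M. P i)"

text \<open>
  Every vertex adds at least one to the total degree; so the degree bounds the number of vertices.
\<close>

lemma forest_deg_nat:
  assumes "set_mset (decs F) \<subseteq> D"
  obtains \<alpha> where "\<alpha> \<in> carrier_vec N" "\<delta> F = of_nat_vec \<alpha>" "size (decs F) \<le> total \<alpha>"
    "\<And>d. d \<in># decs F \<Longrightarrow> \<exists>\<beta>\<in>below \<alpha>. deg d = of_nat_vec \<beta>"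
proof -
  have "\<forall>d\<in>D. \<exists>\<beta>. \<beta> \<in> carrier_vec N \<and> deg d = of_nat_vec \<beta>"
    using deg_nat by (force simp: D_def)
  then obtain \<beta> where \<beta>: "\<And>d. d \<in> D \<Longrightarrow> \<beta> d \<in> carrier_vec N" "\<And>d. d \<in> D \<Longrightarrow> deg d = of_nat_vec (\<beta> d)"
    by metis
  have pos: "total (\<beta> d) \<ge> 1" if "d \<in> D" for d
  proof -
    have "deg d \<noteq> 0\<^sub>v N" using that deg_nonzero by (auto simp: D_def)
    then have "\<beta> d \<noteq> 0\<^sub>v N" using \<beta>(2)[OF that] by (auto simp: vec_eq_iff)
    then show ?thesis using total_eq_0_iff[OF \<beta>(1)[OF that]] by simp
  qed
  define \<alpha> where "\<alpha> = vec N (\<lambda>r. \<Sum>d\<in>#decs F. \<beta> d $ r)"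
  have \<alpha>: "\<alpha> \<in> carrier_vec N" by (simp add: \<alpha>_def)
  moreover have "\<delta> F = of_nat_vec \<alpha>"
  proof -
    have "(\<Sum>d\<in>#decs F. deg d $ r) = of_nat (\<Sum>d\<in>#decs F. \<beta> d $ r)" if "r < N" for r
    proof -
      have "(\<Sum>d\<in>#decs F. deg d $ r) = (\<Sum>d\<in>#decs F. of_nat (\<beta> d $ r))"
      proof (intro arg_cong[of _ _ sum_mset] image_mset_cong)
        fix d assume "d \<in># decs F"
        then have "d \<in> D" using assms by auto
        then show "deg d $ r = of_nat (\<beta> d $ r)"
          using \<beta>[of d] that by simp
      qed
      then show ?thesis by (simp add: image_mset.compositionality o_def)
    qed
    then show ?thesis by (auto simp: forest_deg_def \<alpha>_def)
  qed
  moreover have "size (decs F) \<le> total \<alpha>"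
  proof -
    have "size X \<le> (\<Sum>r<N. \<Sum>d\<in>#X. \<beta> d $ r)" if "set_mset X \<subseteq> D" for X
      using that
    proof (induction X)
      case (add d X)
      then have "1 + size X \<le> total (\<beta> d) + (\<Sum>r<N. \<Sum>d\<in>#X. \<beta> d $ r)"
        using pos[of d] by (intro add_mono) auto
      then show ?case using add.prems \<beta>(1)[of d] by (simp add: total_def sum.distrib)
    qed simp
    then show ?thesis using assms by (simp add: total_def \<alpha>_def)
  qed
  moreover have "\<exists>\<gamma>\<in>below \<alpha>. deg d = of_nat_vec \<gamma>" if d: "d \<in># decs F" for d
  proof -
    have "\<beta> d $ r \<le> \<alpha> $ r" if "r < N" for r
      using multi_member_split[OF d] that by (auto simp: \<alpha>_def)
    then have "\<beta> d \<in> below \<alpha>"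
      using \<beta>(1) d assms \<alpha> by (auto simp: below_def)
    then show ?thesis using \<beta>(2) d assms by auto
  qed
  ultimately show ?thesis by (rule that)
qed

end

context graded_system
begin

lemma finite_degree:
  assumes "\<alpha> \<in> carrier_vec N"
  shows "finite {F. set_mset (decs F) \<subseteq> D \<and> \<delta> F = of_nat_vec \<alpha>}"
proof -
  define S where "S = (\<Union>\<beta>\<in>below \<alpha>. \<Union>i<M. {d \<in> P i. deg d = of_nat_vec \<beta>})"
  have "finite S"
    unfolding S_def using assms
    by (intro finite_UN_I finite_below finite_lessThan deg_finite) (auto simp: below_add_diff)
  have "{F. set_mset (decs F) \<subseteq> D \<and> \<delta> F = of_nat_vec \<alpha>} \<subseteq>
      {F. set_mset (decs F) \<subseteq> S \<and> size (decs F) \<le> total \<alpha>}"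
  proof clarify
    fix F assume F: "set_mset (decs F) \<subseteq> D" "\<delta> F = of_nat_vec \<alpha>"
    obtain \<alpha>' where \<alpha>': "\<delta> F = of_nat_vec \<alpha>'" "size (decs F) \<le> total \<alpha>'"
      "\<And>d. d \<in># decs F \<Longrightarrow> \<exists>\<beta>\<in>below \<alpha>'. deg d = of_nat_vec \<beta>"
      using F(1) by (rule forest_deg_nat) blast
    have "\<alpha>' = \<alpha>" using \<alpha>'(1) F(2) of_nat_vec_eq_iff by metis
    moreover have "set_mset (decs F) \<subseteq> S"
    proof
      fix d assume d: "d \<in># decs F"
      then obtain i where "i < M" "d \<in> P i" using F(1) by (auto simp: D_def)
      then show "d \<in> S" using \<alpha>'(3)[OF d] \<open>\<alpha>' = \<alpha>\<close> by (auto simp: S_def)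
    qed
    ultimately show "set_mset (decs F) \<subseteq> S \<and> size (decs F) \<le> total \<alpha>" using \<alpha>'(2) by simp
  qed
  then show ?thesis using finite_bounded_forests[OF \<open>finite S\<close>] by (rule finite_subset)
qed

text \<open>
  A series all of whose terms with less than \<open>m\<close> vertices have decorations in \<open>D\<close>. The bound
  serves to show this for the \<open>Y\<^sub>i\<close> by induction on \<open>m\<close>.
\<close>

definition supp :: "nat \<Rightarrow> ('d, 'k) fseries \<Rightarrow> bool" where
  "supp m x \<longleftrightarrow> (\<forall>F. size (decs F) < m \<longrightarrow> fcoeff x F \<noteq> 0 \<longrightarrow> set_mset (decs F) \<subseteq> D)"

lemma supp_fconst: "supp m (fconst c)"
  by (simp add: supp_def fcoeff_simps)

lemma supp_one: "supp m 1"
  by (simp add: supp_def fcoeff_simps)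

lemma supp_add: "supp m x \<Longrightarrow> supp m y \<Longrightarrow> supp m (x + y)"
  unfolding supp_def fcoeff_simps by (metis add_0)

lemma supp_mult:
  assumes "supp m x" "supp m y"
  shows "supp m (x * y)"
  unfolding supp_def
proof (intro allI impI)
  fix F assume F: "size (decs F) < m" "fcoeff (x * y) F \<noteq> 0"
  then obtain A where A: "A \<subseteq># F" "fcoeff x A \<noteq> 0" "fcoeff y (F - A) \<noteq> 0"
    unfolding times_fseries.rep_eq
    by (metis (mono_tags, lifting) mem_Collect_eq mult_not_zero sum.neutral)
  then have "size (decs A) < m" "size (decs (F - A)) < m"
    using size_decs_diff[OF A(1)] F by linarith+
  then have "set_mset (decs A) \<subseteq> D" "set_mset (decs (F - A)) \<subseteq> D"
    using assms A by (auto simp: supp_def)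
  then show "set_mset (decs F) \<subseteq> D"
    using decs_add[of A "F - A"] A(1) by (simp add: subset_mset.add_diff_inverse)
qed

lemma supp_power: "supp m x \<Longrightarrow> supp m (x ^ p)"
  by (induction p) (simp_all add: supp_one supp_mult)

lemma supp_prod: "(\<And>i. i \<in> I \<Longrightarrow> supp m (f i)) \<Longrightarrow> supp m (\<Prod>i\<in>I. f i)"
  by (induction I rule: infinite_finite_induct) (simp_all add: supp_one supp_mult)

lemma supp_fps_eval:
  assumes "supp m x"
  shows "supp m (fps_eval f x)"
  unfolding supp_def
proof (intro allI impI)
  fix F assume F: "size (decs F) < m" "fcoeff (fps_eval f x) F \<noteq> 0"
  then obtain p where "fcoeff (x ^ p) F \<noteq> 0"
    unfolding fps_eval_def Abs_fseries_inverse[OF UNIV_I]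
      by (metis (no_types, lifting) mult_not_zero sum.neutral)
  then show "set_mset (decs F) \<subseteq> D"
    using F(1) supp_power[OF assms, of p] unfolding supp_def by blast
qed

lemma supp_Y: "i < M \<Longrightarrow> supp m (Y i)"
proof (induction m arbitrary: i)
  case (Suc m)
  show ?case unfolding supp_def
  proof (intro allI impI)
    fix F assume F: "size (decs F) < Suc m" "fcoeff (Y i) F \<noteq> 0"
    then obtain d G where G: "F = {#Node d G#}" using Y_nontree[OF Suc.prems, of F] by blast
    have d: "d \<in> P i" "fcoeff (\<Prod>j<M. E j ^ n d j) G \<noteq> 0"
      using F Y_tree[OF Suc.prems, of d G] by (auto simp: G split: if_splits)
    have "supp m (\<Prod>j<M. E j ^ n d j)"
      unfolding E_def using Suc.IH by (intro supp_prod supp_power supp_fps_eval) auto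
    then have "set_mset (decs G) \<subseteq> D"
      using d F by (auto simp: supp_def G tree_decs_Node)
    then show "set_mset (decs F) \<subseteq> D"
      using d Suc.prems by (auto simp: G tree_decs_Node D_def)
  qed
qed (simp add: supp_def)

text \<open>
  Only for these series are the homogeneous components known to be finite sums, and hence not
  affected by the conversion to polynomial mappings.
\<close>

definition supported :: "('d, 'k) fseries \<Rightarrow> bool" where
  "supported x \<longleftrightarrow> (\<forall>m. supp m x)"

lemma supportedD: "supported x \<Longrightarrow> fcoeff x F \<noteq> 0 \<Longrightarrow> set_mset (decs F) \<subseteq> D"
  unfolding supported_def supp_def by blast

abbreviation hom :: "('d, 'k) fseries \<Rightarrow> nat vec \<Rightarrow> ('d, 'k) tree_alg" where
  "hom \<equiv> hom_component N deg"

lemma lookup_hom: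
  assumes "supported x" "\<alpha> \<in> carrier_vec N"
  shows "Poly_Mapping.lookup (hom x \<alpha>) F = (if \<delta> F = of_nat_vec \<alpha> then fcoeff x F else 0)"
proof -
  have "{F. (if \<delta> F = of_nat_vec \<alpha> then fcoeff x F else 0) \<noteq> 0} \<subseteq>
      {F. set_mset (decs F) \<subseteq> D \<and> \<delta> F = of_nat_vec \<alpha>}"
    using supportedD[OF assms(1)] by (auto split: if_splits)
  then have "finite {F. (if \<delta> F = of_nat_vec \<alpha> then fcoeff x F else 0) \<noteq> 0}"
    using finite_degree[OF assms(2)] by (rule finite_subset)
  then show ?thesis
    by (simp add: hom_component_def Abs_poly_mapping_inverse)
qed

lemma hom_add:
  assumes "supported x" "supported y" "\<alpha> \<in> carrier_vec N"
  shows "hom (x + y) \<alpha> = hom x \<alpha> + hom y \<alpha>"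
proof -
  have "supported (x + y)" using assms by (simp add: supported_def supp_add)
  then show ?thesis
    using assms by (intro poly_mapping_eqI) (simp add: lookup_hom lookup_add fcoeff_simps)
qed

lemma forest_deg_eq_0_iff: "set_mset (decs F) \<subseteq> D \<Longrightarrow> \<delta> F = 0\<^sub>v N \<longleftrightarrow> F = {#}"
proof
  assume F: "set_mset (decs F) \<subseteq> D" "\<delta> F = 0\<^sub>v N"
  obtain \<alpha> where \<alpha>: "\<alpha> \<in> carrier_vec N" "\<delta> F = of_nat_vec \<alpha>" "size (decs F) \<le> total \<alpha>"
    using F(1) by (rule forest_deg_nat) blast
  then have "\<alpha> = 0\<^sub>v N" using F(2) by (auto simp: vec_eq_iff)
  then show "F = {#}" using \<alpha>(3) by (simp add: total_def)
qed simp

lemma hom_fconst: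
  assumes "\<alpha> \<in> carrier_vec N"
  shows "hom (fconst c) \<alpha> = (if \<alpha> = 0\<^sub>v N then Poly_Mapping.single {#} c else 0)"
proof -
  have "\<delta> {#} = of_nat_vec \<alpha> \<longleftrightarrow> \<alpha> = 0\<^sub>v N"
    using assms by (auto simp: vec_eq_iff)
  then show ?thesis
    using assms by (intro poly_mapping_eqI)
      (auto simp: lookup_hom supported_def supp_fconst fcoeff_simps lookup_single when_def)
qed

lemma hom_mult:
  assumes x: "supported x" and y: "supported y" and \<gamma>: "\<gamma> \<in> carrier_vec N"
  shows "hom (x * y) \<gamma> = (\<Sum>\<beta>\<in>below \<gamma>. hom x \<beta> * hom y (\<gamma> - \<beta>))"
proof (rule poly_mapping_eqI)
  fix F
  let ?x = "\<lambda>\<beta> A. if \<delta> A = of_nat_vec \<beta> then fcoeff x A else 0"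
    and ?y = "\<lambda>\<beta> A. if \<delta> A = of_nat_vec \<beta> then fcoeff y A else 0"
  have inner: "(\<Sum>\<beta>\<in>below \<gamma>. ?x \<beta> A * ?y (\<gamma> - \<beta>) (F - A)) =
      (if \<delta> F = of_nat_vec \<gamma> then fcoeff x A * fcoeff y (F - A) else 0)" if A: "A \<subseteq># F" for A
  proof (cases "fcoeff x A = 0 \<or> fcoeff y (F - A) = 0")
    case True
    then show ?thesis by auto
  next
    case False
    then obtain \<alpha> \<beta> where \<alpha>: "\<alpha> \<in> carrier_vec N" "\<delta> A = of_nat_vec \<alpha>"
      and \<beta>: "\<beta> \<in> carrier_vec N" "\<delta> (F - A) = of_nat_vec \<beta>"
      using supportedD[OF x] supportedD[OF y] by (metis forest_deg_nat)
    have "\<delta> F = \<delta> A + \<delta> (F - A)" using A by (simp flip: forest_deg_add)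
    then have F: "\<delta> F = of_nat_vec (\<alpha> + \<beta>)" using \<alpha> \<beta> by (simp add: of_nat_vec_add)
    have iff: "\<alpha> + \<beta> = \<gamma> \<longleftrightarrow> \<alpha> \<in> below \<gamma> \<and> \<beta> = \<gamma> - \<alpha>"
      using \<alpha> \<beta> \<gamma> by (auto simp: below_def vec_eq_iff)
    have "(\<Sum>\<beta>'\<in>below \<gamma>. ?x \<beta>' A * ?y (\<gamma> - \<beta>') (F - A)) =
       (\<Sum>\<beta>'\<in>below \<gamma>. if \<alpha> = \<beta>' then (if \<beta> = \<gamma> - \<alpha> then fcoeff x A * fcoeff y (F - A) else 0) else
         0)"
      by (intro sum.cong refl) (auto simp: \<alpha>(2) \<beta>(2) of_nat_vec_eq_iff)
    also have "\<dots> = (if \<alpha> + \<beta> = \<gamma> then fcoeff x A * fcoeff y (F - A) else 0)"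
      by (simp add: finite_below iff)
    finally show ?thesis by (simp add: F of_nat_vec_eq_iff)
  qed
  have "Poly_Mapping.lookup (hom (x * y) \<gamma>) F = (if \<delta> F = of_nat_vec \<gamma> then fcoeff (x *
      y) F else 0)"
    using x y \<gamma> by (intro lookup_hom) (auto simp: supported_def supp_mult)
  also have "\<dots> = (\<Sum>A | A \<subseteq># F. if \<delta> F = of_nat_vec \<gamma> then fcoeff x A * fcoeff y (F - A) else 0)"
    by (simp add: times_fseries.rep_eq)
  also have "\<dots> = (\<Sum>A | A \<subseteq># F. \<Sum>\<beta>\<in>below \<gamma>. ?x \<beta> A * ?y (\<gamma> - \<beta>) (F - A))"
    by (intro sum.cong refl inner[symmetric]) simp
  also have "\<dots> = (\<Sum>\<beta>\<in>below \<gamma>. \<Sum>A | A \<subseteq># F. ?x \<beta> A * ?y (\<gamma> - \<beta>) (F - A))"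
    by (rule sum.swap)
  also have "\<dots> = (\<Sum>\<beta>\<in>below \<gamma>. Poly_Mapping.lookup (hom x \<beta> * hom y (\<gamma> - \<beta>)) F)"
  proof (intro sum.cong refl)
    fix \<beta> assume "\<beta> \<in> below \<gamma>"
    then have "\<beta> \<in> carrier_vec N" "\<gamma> - \<beta> \<in> carrier_vec N" using \<gamma> by (auto simp: below_def)
    then show "(\<Sum>A | A \<subseteq># F. ?x \<beta> A * ?y (\<gamma> - \<beta>) (F - A)) =
        Poly_Mapping.lookup (hom x \<beta> * hom y (\<gamma> - \<beta>)) F"
      by (simp only: lookup_mult_forest lookup_hom x y)
  qed
  finally show "Poly_Mapping.lookup (hom (x * y) \<gamma>) F =
      Poly_Mapping.lookup (\<Sum>\<beta>\<in>below \<gamma>. hom x \<beta> * hom y (\<gamma> - \<beta>)) F"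
    by (simp add: lookup_sum)
qed

text \<open>The subalgebra generated by the components of total degree at most \<open>m\<close>.\<close>

definition components_upto :: "nat \<Rightarrow> ('d, 'k) tree_alg set" where
  "components_upto m = generated_subalgebra
     {hom (Y i) \<alpha> | i \<alpha>. i < M \<and> \<alpha> \<in> carrier_vec N \<and> total \<alpha> \<le> m}"

lemma components_upto_mono: "m \<le> m' \<Longrightarrow> components_upto m \<subseteq> components_upto m'"
  unfolding components_upto_def by (rule generated_subalgebra_mono) fastforce

lemma subalgebra_components_upto: "subalgebra (components_upto m)"
  unfolding components_upto_def by (rule subalgebra_generated)

text \<open>
  Series supported on \<open>D\<close> whose homogeneous components are polynomials in those of the \<open>Y\<^sub>i\<close> of at
  most the same total degree.
\<close>

definition good :: "('d, 'k) fseries \<Rightarrow> bool" where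
  "good x \<longleftrightarrow> supported x \<and> (\<forall>\<alpha>\<in>carrier_vec N. hom x \<alpha> \<in> components_upto (total \<alpha>))"

lemma good_fconst: "good (fconst c)"
proof -
  have "Poly_Mapping.single {#} c * 1 \<in> components_upto m" for m
    using subalgebra_generated unfolding components_upto_def
    by (intro subalgebra_closed)
  then show ?thesis
    using subalgebra_closed(5)[OF subalgebra_generated]
    by (auto simp: good_def supported_def supp_fconst hom_fconst components_upto_def)
qed

lemma good_one: "good 1"
  using good_fconst[of 1] by simp

lemma good_add: "good x \<Longrightarrow> good y \<Longrightarrow> good (x + y)"
  unfolding good_def
  by (auto simp: hom_add supported_def supp_add components_upto_def intro: generated_subalgebra.add)

lemma good_mult:
  assumes "good x" "good y"
  shows "good (x * y)"
proof -
  have "hom (x * y) \<alpha> \<in> components_upto (total \<alpha>)" if \<alpha>: "\<alpha> \<in> carrier_vec N" for \<alpha>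
  proof -
    have "hom x \<beta> * hom y (\<alpha> - \<beta>) \<in> components_upto (total \<alpha>)" if \<beta>: "\<beta> \<in> below \<alpha>" for \<beta>
    proof -
      have c: "\<beta> \<in> carrier_vec N" "\<alpha> - \<beta> \<in> carrier_vec N" using \<alpha> \<beta> by (auto simp: below_def)
      then have "total \<alpha> = total \<beta> + total (\<alpha> - \<beta>)"
        using below_add_diff(1)[OF \<alpha> \<beta>] total_add by metis
      then have "components_upto (total \<beta>) \<subseteq> components_upto (total \<alpha>)"
        "components_upto (total (\<alpha> - \<beta>)) \<subseteq> components_upto (total \<alpha>)"
        by (auto intro!: components_upto_mono)
      then have "hom x \<beta> \<in> components_upto (total \<alpha>)" "hom y (\<alpha> - \<beta>) \<in> components_upto (total \<alpha>)"
        using assms c by (auto simp: good_def)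
      then show ?thesis unfolding components_upto_def by (rule generated_subalgebra.mult)
    qed
    then have "(\<Sum>\<beta>\<in>below \<alpha>. hom x \<beta> * hom y (\<alpha> - \<beta>)) \<in> components_upto (total \<alpha>)"
      unfolding components_upto_def by (intro subalgebra_closed(6)[OF subalgebra_generated])
    then show ?thesis using assms \<alpha> by (simp add: hom_mult good_def)
  qed
  then show ?thesis using assms by (simp add: good_def supported_def supp_mult)
qed

lemma good_power: "good x \<Longrightarrow> good (x ^ p)"
  by (induction p) (simp_all add: good_one good_mult)

lemma good_prod: "(\<And>i. i \<in> I \<Longrightarrow> good (f i)) \<Longrightarrow> good (\<Prod>i\<in>I. f i)"
  by (induction I rule: infinite_finite_induct) (simp_all add: good_one good_mult)

lemma good_fps_eval:
  assumes x: "good x" and x0: "fcoeff x {#} = 0"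
  shows "good (fps_eval f x)"
proof -
  have supp: "supported (fps_eval f x)" "supported (x ^ p)" for p
    using x by (simp_all add: good_def supported_def supp_fps_eval supp_power)
  have "hom (fps_eval f x) \<alpha> \<in> components_upto (total \<alpha>)" if \<alpha>: "\<alpha> \<in> carrier_vec N" for \<alpha>
  proof -
    have "hom (fps_eval f x) \<alpha> =
        (\<Sum>p\<le>total \<alpha>. Poly_Mapping.single 0 (fps_nth f p) * hom (x ^ p) \<alpha>)"
    proof (rule poly_mapping_eqI)
      fix F
      have "fcoeff (fps_eval f x) F = (\<Sum>p\<le>total \<alpha>. fps_nth f p * fcoeff (x ^ p) F)" if F:
          "\<delta> F = of_nat_vec \<alpha>"
      proof (cases "set_mset (decs F) \<subseteq> D")
        case True
        then obtain \<beta> where "\<delta> F = of_nat_vec \<beta>" "size (decs F) \<le> total \<beta>"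
            by (rule forest_deg_nat) blast
        then have "size F \<le> total \<alpha>"
          using F size_le_size_decs[of F] by (simp add: of_nat_vec_eq_iff)
        then show ?thesis by (rule fcoeff_fps_eval[OF x0])
      next
        case False
        then have "fcoeff (fps_eval f x) F = 0" "\<And>p. fcoeff (x ^ p) F = 0"
          using supportedD supp by blast+
        then show ?thesis by simp
      qed
      then show "Poly_Mapping.lookup (hom (fps_eval f x) \<alpha>) F =
        Poly_Mapping.lookup (\<Sum>p\<le>total \<alpha>. Poly_Mapping.single 0 (fps_nth f p) * hom (x ^ p) \<alpha>) F"
        using \<alpha> by (simp add: lookup_hom supp lookup_sum lookup_scale)
    qed
    also have "\<dots> \<in> components_upto (total \<alpha>)"
    proof -
      have "hom (x ^ p) \<alpha> \<in> components_upto (total \<alpha>)" for p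
        using good_power[OF x, of p] \<alpha> by (simp add: good_def)
      then show ?thesis
        unfolding components_upto_def
        by (intro subalgebra_closed(6)[OF subalgebra_generated] generated_subalgebra.scale)
    qed
    finally show ?thesis .
  qed
  then show ?thesis using supp by (simp add: good_def)
qed

lemma good_Y: "i < M \<Longrightarrow> good (Y i)"
  unfolding good_def components_upto_def
  by (auto simp: supported_def supp_Y intro!: generated_subalgebra.gen)

lemma good_W_U: "i < M \<Longrightarrow> good (W i * U v)"
  unfolding W_def U_def
  by (intro good_mult good_add good_one good_fconst good_Y good_prod good_fps_eval)
      (auto simp: Y_empty)

lemma hom_Y_zero: "i < M \<Longrightarrow> hom (Y i) (0\<^sub>v N) = 0"
proof (rule poly_mapping_eqI)
  fix F assume i: "i < M"
  have "fcoeff (Y i) F = 0" if "\<delta> F = 0\<^sub>v N"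
  proof (rule ccontr)
    assume *: "fcoeff (Y i) F \<noteq> 0"
    then have "F = {#}"
      using forest_deg_eq_0_iff[of F] supportedD[of "Y i" F] good_Y[OF i] that
        by (auto simp: good_def)
    then show False using * by (simp add: Y_empty i)
  qed
  moreover have "of_nat_vec (0\<^sub>v N) = 0\<^sub>v N" by auto
  ultimately show "Poly_Mapping.lookup (hom (Y i) (0\<^sub>v N)) F = Poly_Mapping.lookup 0 F"
    using good_Y[OF i] by (simp add: lookup_hom good_def)
qed

lemma coproduct_hom_Y:
  assumes i: "i < M" and \<alpha>: "\<alpha> \<in> carrier_vec N"
  shows "coproduct (hom (Y i) \<alpha>) = tensor (hom (Y i) \<alpha>) 1 +
    (\<Sum>\<beta>\<in>below \<alpha>. tensor (hom (W i * U (of_nat_vec \<beta>)) (\<alpha> - \<beta>)) (hom (Y i) \<beta>))"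
proof (rule poly_mapping_eqI, clarify)
  fix F G
  let ?l = Poly_Mapping.lookup
  have supp: "supported (Y i)" "supported (W i * U v)" for v
    using good_Y[OF i] good_W_U[OF i] by (simp_all add: good_def)
  have "?l (coproduct (hom (Y i) \<alpha>)) (F, G) =
      (\<Sum>H\<in>Poly_Mapping.keys (hom (Y i) \<alpha>). ?l (hom (Y i) \<alpha>) H * ?l (forest_coproduct H) (F, G))"
    by (simp add: coproduct_eq lin_ext_def lookup_sum lookup_scale)
  also have "\<dots> = (\<Sum>H\<in>Poly_Mapping.keys (hom (Y i) \<alpha>) \<union> {H. decs H = decs F + decs G}.
      ?l (hom (Y i) \<alpha>) H * ?l (forest_coproduct H) (F, G))"
    by (rule sum.mono_neutral_left) (auto simp: in_keys_iff)
  also have "\<dots> = (\<Sum>H | decs H = decs F + decs G. ?l (hom (Y i) \<alpha>) H *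
      ?l (forest_coproduct H) (F, G))"
    by (rule sum.mono_neutral_right) (auto simp: lookup_forest_coproduct_eq_0)
  also have "\<dots> = (\<Sum>H | decs H = decs F + decs G. if \<delta> F + \<delta> G = of_nat_vec \<alpha>
      then fcoeff (Y i) H * ?l (forest_coproduct H) (F, G) else 0)"
  proof (intro sum.cong refl)
    fix H assume "H \<in> {H. decs H = decs F + decs G}"
    then have "\<delta> H = \<delta> F + \<delta> G"
      using forest_deg_cong_decs[of H "F + G"] by (simp add: forest_deg_add)
    then show "?l (hom (Y i) \<alpha>) H * ?l (forest_coproduct H) (F, G) =
      (if \<delta> F + \<delta> G = of_nat_vec \<alpha> then fcoeff (Y i) H * ?l (forest_coproduct H) (F, G) else 0)"
      using \<alpha> by (simp add: lookup_hom supp)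
  qed
  also have "\<dots> = (if \<delta> F + \<delta> G = of_nat_vec \<alpha> then series_coproduct (Y i) F G else 0)"
    by (simp add: series_coproduct_def)
  also have "\<dots> = (if \<delta> F = of_nat_vec \<alpha> \<and> G = {#} then fcoeff (Y i) F else 0) +
      (if \<delta> F + \<delta> G = of_nat_vec \<alpha> then fcoeff (W i * U (\<delta> G)) F * fcoeff (Y i) G else 0)"
    using \<alpha> by (auto simp: series_coproduct_Y[OF i])
  also have "(if \<delta> F + \<delta> G = of_nat_vec \<alpha> then fcoeff (W i * U (\<delta> G)) F * fcoeff (Y i) G else 0) =
    (\<Sum>\<beta>\<in>below \<alpha>. (if \<delta> F = of_nat_vec (\<alpha> - \<beta>) then fcoeff (W i * U (of_nat_vec \<beta>)) F else 0) *
       (if \<delta> G = of_nat_vec \<beta> then fcoeff (Y i) G else 0))"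
  proof (cases "fcoeff (Y i) G = 0")
    case False
    then obtain \<beta> where \<beta>: "\<beta> \<in> carrier_vec N" "\<delta> G = of_nat_vec \<beta>"
      using supportedD[OF supp(1)] by (metis forest_deg_nat)
    let ?c = "fcoeff (W i * U (of_nat_vec \<beta>)) F * fcoeff (Y i) G"
    have iff: "\<delta> F + of_nat_vec \<beta> = of_nat_vec \<alpha> \<longleftrightarrow> \<beta> \<in> below \<alpha> \<and> \<delta> F = of_nat_vec (\<alpha> - \<beta>)" if
        "?c \<noteq> 0"
    proof -
      have "fcoeff (W i * U (of_nat_vec \<beta>)) F \<noteq> 0" using that by auto
      then obtain \<gamma> where \<gamma>: "\<gamma> \<in> carrier_vec N" "\<delta> F = of_nat_vec \<gamma>"
        using supportedD[OF supp(2)] by (metis forest_deg_nat)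
      have "\<gamma> + \<beta> = \<alpha> \<longleftrightarrow> \<beta> \<in> below \<alpha> \<and> \<gamma> = \<alpha> - \<beta>"
        using \<gamma> \<beta> \<alpha> by (auto simp: below_def vec_eq_iff)
      then show ?thesis
        using \<gamma> \<beta> by (metis of_nat_vec_add of_nat_vec_eq_iff)
    qed
    have "(\<Sum>\<beta>'\<in>below \<alpha>. (if \<delta> F = of_nat_vec (\<alpha> - \<beta>') then fcoeff (W i * U (of_nat_vec \<beta>')) F else
        0) *
       (if \<delta> G = of_nat_vec \<beta>' then fcoeff (Y i) G else 0)) =
      (\<Sum>\<beta>'\<in>below \<alpha>. if \<beta> = \<beta>' then (if \<delta> F = of_nat_vec (\<alpha> - \<beta>) then ?c else 0) else 0)"
      by (intro sum.cong refl) (auto simp: \<beta>(2) of_nat_vec_eq_iff)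
    also have "\<dots> = (if \<delta> F + of_nat_vec \<beta> = of_nat_vec \<alpha> then ?c else 0)"
    proof (cases "?c = 0")
      case True
      then show ?thesis by (simp only: if_cancel sum.neutral_const)
    next
      case False
      then show ?thesis using iff by (auto simp: finite_below)
    qed
    finally show ?thesis by (simp add: \<beta>(2))
  qed simp
  also have "\<dots> = (\<Sum>\<beta>\<in>below \<alpha>. ?l (tensor (hom (W i * U (of_nat_vec \<beta>)) (\<alpha> - \<beta>)) (hom (Y i) \<beta>))
      (F, G))"
  proof (intro sum.cong refl)
    fix \<beta> assume "\<beta> \<in> below \<alpha>"
    then have "\<beta> \<in> carrier_vec N" "\<alpha> - \<beta> \<in> carrier_vec N" using \<alpha> by (auto simp: below_def)
    then show "(if \<delta> F = of_nat_vec (\<alpha> - \<beta>) then fcoeff (W i * U (of_nat_vec \<beta>)) F else 0) *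
       (if \<delta> G = of_nat_vec \<beta> then fcoeff (Y i) G else 0) =
       ?l (tensor (hom (W i * U (of_nat_vec \<beta>)) (\<alpha> - \<beta>)) (hom (Y i) \<beta>)) (F, G)"
      by (simp only: lookup_tensor lookup_hom supp)
  qed
  also have "(if \<delta> F = of_nat_vec \<alpha> \<and> G = {#} then fcoeff (Y i) F else 0) =
      ?l (tensor (hom (Y i) \<alpha>) 1) (F, G)"
    using \<alpha> by (auto simp: lookup_tensor lookup_hom supp lookup_one when_def)
  finally show "?l (coproduct (hom (Y i) \<alpha>)) (F, G) = ?l (tensor (hom (Y i) \<alpha>) 1 +
    (\<Sum>\<beta>\<in>below \<alpha>. tensor (hom (W i * U (of_nat_vec \<beta>)) (\<alpha> - \<beta>)) (hom (Y i) \<beta>))) (F, G)"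
    by (simp add: lookup_add lookup_sum)
qed

text \<open>
  The antipode of a component of degree \<open>\<alpha>\<close> is determined by antipodes of components of smaller
  degree.
\<close>

lemma antipode_hom_Y:
  "i < M \<Longrightarrow> \<alpha> \<in> carrier_vec N \<Longrightarrow> antipode (hom (Y i) \<alpha>) \<in> components_upto (total \<alpha>)"
proof (induction "total \<alpha>" arbitrary: i \<alpha> rule: less_induct)
  case less
  let ?S = "\<lambda>x. lin_ext (\<lambda>(F, G). antipode (basis F) * basis G) x :: ('d, 'k) tree_alg"
  note sub = subalgebra_closed[OF subalgebra_components_upto]
  have tensor: "?S (tensor x y) = antipode x * y" for x y :: "('d, 'k) tree_alg"
  proof -
    have "?S (tensor x y) = lin_ext (\<lambda>F. forest_antipode F * y) x"
      unfolding tensor_def lin_ext_comp by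
        (simp add: antipode_basis lin_ext_basis_id flip: mult_lin_ext)
    also have "\<dots> = y * antipode x"
      by (simp add: antipode_def mult_lin_ext mult.commute)
    finally show ?thesis by (simp only: mult.commute)
  qed
  have IH: "antipode x \<in> components_upto (total \<alpha>)" if "x \<in> components_upto m" "m < total \<alpha>" for x m
    using that(1) unfolding components_upto_def[of m]
  proof induction
    case (gen x)
    then obtain j \<gamma> where x: "x = hom (Y j) \<gamma>" "j < M" "\<gamma> \<in> carrier_vec N" "total \<gamma> \<le> m" by blast
    then have "antipode x \<in> components_upto (total \<gamma>)" using less that(2) by auto
    then show ?case using components_upto_mono[of "total \<gamma>" "total \<alpha>"] x(4) that(2) by auto
  next
    case (scale x c)
    then show ?case unfolding antipode_scale by (intro sub)
  qed (auto simp: antipode_one antipode_add antipode_mult intro: sub)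
  let ?u = "\<lambda>\<beta>. hom (W i * U (of_nat_vec \<beta>)) (\<alpha> - \<beta>)"
  have "?S (coproduct (hom (Y i) \<alpha>)) = Poly_Mapping.single 0 (counit (hom (Y i) \<alpha>))"
    using is_antipode_antipode[where 'd = 'd and 'k = 'k, of UNIV]
    by (simp add: is_antipode_def H_trees_def)
  then have "antipode (hom (Y i) \<alpha>) + (\<Sum>\<beta>\<in>below \<alpha>. antipode (?u \<beta>) * hom (Y i) \<beta>) =
      Poly_Mapping.single 0 (counit (hom (Y i) \<alpha>))"
    by (simp only: coproduct_hom_Y less.prems lin_ext_add lin_ext_sum tensor mult_1_right)
  then have S: "antipode (hom (Y i) \<alpha>) = Poly_Mapping.single 0 (counit (hom (Y i) \<alpha>)) * 1 +
      - (\<Sum>\<beta>\<in>below \<alpha>. antipode (?u \<beta>) * hom (Y i) \<beta>)"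
    by (simp add: eq_diff_eq)
  have "antipode (?u \<beta>) * hom (Y i) \<beta> \<in> components_upto (total \<alpha>)" if \<beta>: "\<beta> \<in> below \<alpha>" for \<beta>
  proof -
    have c: "\<beta> \<in> carrier_vec N" "\<alpha> - \<beta> \<in> carrier_vec N"
      using \<beta> less.prems by (auto simp: below_def)
    have tot: "total \<alpha> = total \<beta> + total (\<alpha> - \<beta>)"
      using below_add_diff(1)[OF less.prems(2) \<beta>] total_add c by metis
    show ?thesis
    proof (cases "\<beta> = 0\<^sub>v N")
      case True
      then show ?thesis using sub(5) by (simp add: hom_Y_zero less.prems)
    next
      case False
      then have "total (\<alpha> - \<beta>) < total \<alpha>" using tot total_eq_0_iff[OF c(1)] by simp
      moreover have "?u \<beta> \<in> components_upto (total (\<alpha> - \<beta>))"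
        using good_W_U[OF less.prems(1)] c by (simp add: good_def)
      moreover have "hom (Y i) \<beta> \<in> components_upto (total \<alpha>)"
        using good_Y[OF less.prems(1)] c components_upto_mono[of "total \<beta>" "total \<alpha>"] tot
        by (auto simp: good_def)
      ultimately show ?thesis using IH sub(3) by blast
    qed
  qed
  then have "(\<Sum>\<beta>\<in>below \<alpha>. antipode (?u \<beta>) * hom (Y i) \<beta>) \<in> components_upto (total \<alpha>)"
    by (rule sub(6))
  then have "Poly_Mapping.single 0 (counit (hom (Y i) \<alpha>)) * 1 +
      - (\<Sum>\<beta>\<in>below \<alpha>. antipode (?u \<beta>) * hom (Y i) \<beta>) \<in> components_upto (total \<alpha>)"
    by (rule sub(2)[OF sub(4)[OF sub(1)] sub(7)])
  with S show ?case by simp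
qed

theorem hopf_subalgebra_components:
  "hopf_subalgebra D (generated_subalgebra {hom (Y i) \<alpha> | i \<alpha>. i < M \<and> \<alpha> \<in> carrier_vec N})"
proof -
  let ?G = "{hom (Y i) \<alpha> | i \<alpha>. i < M \<and> \<alpha> \<in> carrier_vec N}"
  let ?A = "generated_subalgebra ?G"
  have upto: "components_upto m \<subseteq> ?A" for m
    unfolding components_upto_def by (rule generated_subalgebra_mono) blast
  have "?G \<subseteq> H_trees D"
  proof clarify
    fix i and \<alpha> :: "nat vec"
    assume "i < M" "\<alpha> \<in> carrier_vec N"
    then have "set_mset (decs F) \<subseteq> D" if "Poly_Mapping.lookup (hom (Y i) \<alpha>) F \<noteq> 0" for F
      using good_Y[of i] that supportedD[of "Y i" F]
        by (simp add: good_def lookup_hom split: if_splits)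
    then show "hom (Y i) \<alpha> \<in> H_trees D"
      by (simp add: H_trees_def in_keys_iff)
  qed
  then have "?A \<subseteq> H_trees D"
    using generated_subalgebra_minimal[OF _ subalgebra_H_trees] by blast
  moreover have "coproduct x \<in> tensor_square ?A" if "x \<in> ?A" for x
  proof (rule coproduct_generated_subalgebra[OF _ that])
    fix y assume "y \<in> ?G"
    then obtain i \<alpha> where y: "y = hom (Y i) \<alpha>" and i: "i < M" and \<alpha>: "\<alpha> \<in> carrier_vec N" by blast
    have Y: "hom (Y i) \<beta> \<in> ?A" if "\<beta> \<in> carrier_vec N" for \<beta>
      using i that by (blast intro: generated_subalgebra.gen)
    show "coproduct y \<in> tensor_square ?A"
      unfolding y coproduct_hom_Y[OF i \<alpha>]
    proof (intro tensor_square_add tensor_in_square tensor_squareI finite_below conjI Y \<alpha>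
        generated_subalgebra.one)
      fix \<beta> assume "\<beta> \<in> below \<alpha>"
      then have c: "\<beta> \<in> carrier_vec N" "\<alpha> - \<beta> \<in> carrier_vec N" using \<alpha> by (auto simp: below_def)
      then show "hom (W i * U (of_nat_vec \<beta>)) (\<alpha> - \<beta>) \<in> ?A"
        using good_W_U[OF i] upto by (auto simp: good_def)
      show "\<beta> \<in> carrier_vec N" by (rule c)
    qed
  qed
  moreover have "antipode x \<in> ?A" if "x \<in> ?A" for x
    using that
  proof induction
    case (gen x)
    then show ?case using antipode_hom_Y upto by blast
  next
    case (scale x c)
    then show ?case unfolding antipode_scale by (intro generated_subalgebra.scale)
  qed (auto simp: antipode_one antipode_add antipode_mult intro: generated_subalgebra.intros)
  ultimately show ?thesis
    unfolding hopf_subalgebra_def using is_antipode_antipode subalgebra_generated by blast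
qed

end

section \<open>Degrees and vertex numbers of one-particle irreducible graphs\<close>

lemma (in vec_space) full_rank_distinct_cols:
  assumes A: "A \<in> carrier_mat n nc" and rank: "rank A = nc"
  shows "distinct (cols A)"
proof -
  obtain S where S: "maximal S (\<lambda>T. T \<subseteq> set (cols A) \<and> lin_indpt T)"
    using maximal_exists[of "(\<lambda>T. T \<subseteq> set (cols A) \<and> lin_indpt T)" "card (set (cols A))" "{}"]
    by (meson List.finite_set card_mono empty_iff empty_subsetI finite_lin_indpt2 rev_finite_subset)
  then have "nc \<le> card (set (cols A))"
    using rank_card_indpt[OF A S] rank by (simp add: card_mono maximal_def)
  then show ?thesis
    using A card_length[of "cols A"] by (intro card_distinct) (auto intro: antisym)
qed

lemma full_rank_left_inverse:
  fixes C :: "rat mat"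
  assumes C: "C \<in> carrier_mat N k" and rank: "vec_space.rank N C = k"
  obtains L where "L \<in> carrier_mat k N" "L * C = 1\<^sub>m k"
proof -
  have inj: "v = 0\<^sub>v k" if "v \<in> carrier_vec k" "C *\<^sub>v v = 0\<^sub>v N" for v
    using vec_space.full_rank_distinct_cols[OF C rank] vec_space.full_rank_lin_indpt[OF C rank]
      vec_space.lin_depI[OF C that(1) _ that(2)] by blast
  \<comment> \<open>Over the rationals \<open>C\<^sup>T C\<close> is invertible, since \<open>C\<^sup>T C v = 0\<close> makes the sum of the squares of
    the
    entries of \<open>C v\<close> vanish.\<close>
  define B where "B = C\<^sup>T * C"
  have CT: "C\<^sup>T \<in> carrier_mat k N" using C by simp
  have B: "B \<in> carrier_mat k k" unfolding B_def using C by simp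
  have "det B \<noteq> 0"
  proof
    assume "det B = 0"
    then obtain v where v: "v \<in> carrier_vec k" "v \<noteq> 0\<^sub>v k" "B *\<^sub>v v = 0\<^sub>v k"
      using det_0_iff_vec_prod_zero_field[OF B] by auto
    let ?w = "C *\<^sub>v v"
    have w: "?w \<in> carrier_vec N" using C v by simp
    have "?w \<bullet> ?w = (C\<^sup>T *\<^sub>v ?w) \<bullet> v"
      using transpose_vec_mult_scalar[OF C v(1) w] by simp
    also have "C\<^sup>T *\<^sub>v ?w = 0\<^sub>v k"
      using v(3) assoc_mult_mat_vec[OF CT C v(1)] by (simp add: B_def)
    finally have "(\<Sum>r<N. ?w $ r * ?w $ r) = 0"
      using v(1) w C by (simp add: scalar_prod_def atLeast0LessThan)
    then have "\<forall>r<N. ?w $ r = 0"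
      by (subst (asm) sum_nonneg_eq_0_iff) auto
    then have "?w = 0\<^sub>v N" using C by (intro eq_vecI) auto
    then show False using inj v by blast
  qed
  then obtain D where D: "D \<in> carrier_mat k k" "D * B = 1\<^sub>m k"
    using det_non_zero_imp_unit[OF B, of "()"] unfolding Units_def ring_mat_def by auto
  have "(D * C\<^sup>T) * C = 1\<^sub>m k"
    using D assoc_mult_mat[OF D(1) CT C] by (simp add: B_def)
  then show ?thesis using D(1) CT by (intro that[of "D * C\<^sup>T"]) auto
qed

subsection \<open>Counting half-edges\<close>

lemma count_type_mset:
  "finite X \<Longrightarrow> count (type_mset G X) h = card {e \<in> X. ty G e = h}"
  by (simp add: type_mset_def count_image_mset vimage_def Collect_conj_eq Int_commute)

lemma components_1PI:
  assumes "is_1PI T G"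
  shows "components G = {G}"
proof -
  have conn: "{w \<in> verts G. (v, w) \<in> (adjacency G (internal G))\<^sup>*} = verts G" if "v \<in> verts G" for v
    using assms that by (auto simp: is_1PI_def connected_by_def)
  have "{e \<in> hedges G. src G e \<in> verts G} = hedges G"
    using assms by (auto simp: is_1PI_def wf_graph_def)
  then have "(let W = {w \<in> verts G. (v, w) \<in> (adjacency G (internal G))\<^sup>*}
      in G\<lparr>hedges := {e \<in> hedges G. src G e \<in> W}, verts := W\<rparr>) = G" if "v \<in> verts G" for v
    using conn[OF that] by simp
  moreover have "verts G \<noteq> {}" using assms by (simp add: is_1PI_def)
  ultimately show ?thesis unfolding components_def by (auto simp: image_iff)
qed

lemma is_feynman_1PI: "is_1PI T G \<Longrightarrow> is_feynman T G"
  using components_1PI[of T G] by (simp add: is_feynman_def) (simp add: is_1PI_def)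

lemma s_count_1PI:
  "is_1PI T (rep_fgraph x) \<Longrightarrow> s_count s x = (if ext_type (rep_fgraph x) = s then 1 else 0)"
proof -
  assume "is_1PI T (rep_fgraph x)"
  then have "{D \<in> components (rep_fgraph x). ext_type D = s} =
      (if ext_type (rep_fgraph x) = s then {rep_fgraph x} else {})"
    by (auto simp: components_1PI)
  then show ?thesis by (simp add: s_count_def)
qed

lemma not_1PI_one_graph: "\<not> is_1PI T (rep_fgraph (one_graph :: 'h fgraph))"
proof
  assume G: "is_1PI T (rep_fgraph (one_graph :: 'h fgraph))"
  have "wf_graph (empty_graph :: 'h pregraph)" by (simp add: wf_graph_def empty_graph_def)
  then have "graph_iso (rep_fgraph (one_graph :: 'h fgraph)) empty_graph"
    unfolding one_graph_def
    by (intro Quotient3_rep_abs[OF Quotient3_fgraph] graph_iso_refl)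
  then have "hedges (rep_fgraph (one_graph :: 'h fgraph)) = {}"
    by (auto simp: graph_iso_def empty_graph_def bij_betw_def)
  with G show False by (simp add: is_1PI_def)
qed

text \<open>
  Counting the half-edges of type \<open>h\<close> by their source vertices on the one hand, and as external
  half-edges and halves of internal edges on the other.
\<close>

lemma half_edge_count:
  assumes T: "feynman_theory T" and G: "is_1PI T (rep_fgraph x)" and h: "h \<in> htypes T"
  defines "s \<equiv> {#h, iota T h#}"
  shows "(\<Sum>v\<in>vtypes T. v_count v x * count v h) = count (ext_type (rep_fgraph x)) h +
      e_count s x * count s h"
proof -
  define G where "G = rep_fgraph x"
  note G = G[folded G_def]
  have fin: "finite (hedges G)" "finite (verts G)" "finite (vtypes T)"
    using G T by (auto simp: is_1PI_def wf_graph_def feynman_theory_def)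
  have wf: "invol G e \<in> hedges G" "invol G (invol G e) = e" "src G e \<in> verts G" "ty G e \<in> htypes T"
    if "e \<in> hedges G" for e
    using G that by (auto simp: is_1PI_def wf_graph_def)
  let ?E = "{e \<in> hedges G. ty G e = h}"
  let ?I = "{e \<in> hedges G. invol G e \<noteq> e \<and> ty G e = h}"
  have "(\<Sum>v\<in>vtypes T. v_count v x * count v h) =
      (\<Sum>v\<in>vtypes T. \<Sum>w\<in>{w \<in> verts G. vertex_type G w = v}. count (vertex_type G w) h)"
    by (intro sum.cong refl) (simp add: v_count_def G_def Let_def)
  also have "\<dots> = (\<Sum>w\<in>verts G. count (vertex_type G w) h)"
    using G fin by (intro sum.group) (auto simp: is_1PI_def)
  also have "\<dots> = (\<Sum>w\<in>verts G. card {e \<in> ?E. src G e = w})"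
    using fin by (intro sum.cong refl) (simp add: vertex_type_def count_type_mset, intro
      arg_cong[of _ _ card], auto)
  also have "\<dots> = (\<Sum>w\<in>verts G. \<Sum>e\<in>{e \<in> ?E. src G e = w}. 1)"
    by simp
  also have "\<dots> = (\<Sum>e\<in>?E. 1)"
    using fin wf by (intro sum.group) auto
  also have "\<dots> = card ?E" by simp
  also have "?E = {e \<in> external G. ty G e = h} \<union> ?I"
    by (auto simp: external_def)
  also have "card \<dots> = card {e \<in> external G. ty G e = h} + card ?I"
    using fin by (intro card_Un_disjoint) (auto simp: external_def)
  also have "card {e \<in> external G. ty G e = h} = count (ext_type G) h"
    using fin by (simp add: ext_type_def count_type_mset external_def)
  also have "card ?I = e_count s x * count s h"
  proof -
    have int: "internal G = (\<lambda>e. {e, invol G e}) ` {e \<in> hedges G. invol G e \<noteq> e}"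
      by (auto simp: internal_def)
    have "card ?I = (\<Sum>e\<in>?I. 1)" by simp
    also have "\<dots> = (\<Sum>\<epsilon>\<in>internal G. \<Sum>e\<in>{e \<in> ?I. {e, invol G e} = \<epsilon>}. 1)"
      using fin by (intro sum.group[symmetric]) (auto simp: int)
    also have "\<dots> = (\<Sum>\<epsilon>\<in>internal G. count (type_mset G \<epsilon>) h)"
    proof (intro sum.cong refl)
      fix \<epsilon> assume "\<epsilon> \<in> internal G"
      then obtain e where e: "e \<in> hedges G" "invol G e \<noteq> e" "\<epsilon> = {e, invol G e}" by (auto simp: int)
      then have "{e' \<in> ?I. {e', invol G e'} = \<epsilon>} = {e' \<in> \<epsilon>. ty G e' = h}"
        using wf[OF e(1)] by (auto simp: doubleton_eq_iff)
      then show "(\<Sum>e'\<in>{e' \<in> ?I. {e', invol G e'} = \<epsilon>}. 1) = count (type_mset G \<epsilon>) h"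
        using e by (simp add: count_type_mset)
    qed
    \<comment> \<open>An internal edge with a half of type \<open>h\<close> has type \<open>s\<close>, because \<open>\<iota>\<close> is an involution.\<close>
    also have "\<dots> = (\<Sum>\<epsilon>\<in>internal G. if type_mset G \<epsilon> = s then count s h else 0)"
    proof (intro sum.cong refl)
      fix \<epsilon> assume "\<epsilon> \<in> internal G"
      then obtain e where e: "e \<in> hedges G" "invol G e \<noteq> e" "\<epsilon> = {e, invol G e}" by (auto simp: int)
      have "ty G (invol G e) = iota T (ty G e)" using G e by (auto simp: is_1PI_def)
      then have ty: "type_mset G \<epsilon> = {#ty G e, iota T (ty G e)#}"
        using e by (simp add: type_mset_def)
      have "iota T (iota T (ty G e)) = ty G e"
        using T wf[OF e(1)] by (simp add: feynman_theory_def)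
      then have "type_mset G \<epsilon> = s" if "h \<in># type_mset G \<epsilon>"
        using that unfolding ty s_def by (auto simp: add_mset_commute)
      then show "count (type_mset G \<epsilon>) h = (if type_mset G \<epsilon> = s then count s h else 0)"
        by (auto simp: count_eq_zero_iff)
    qed
    also have "\<dots> = card {\<epsilon> \<in> internal G. type_mset G \<epsilon> = s} * count s h"
      using fin by (simp add: int flip: sum.inter_filter)
    finally show ?thesis by (simp add: e_count_def G_def Let_def)
  qed
  finally show ?thesis by (simp add: G_def)
qed

lemma enumerates_inj:
  assumes T: "feynman_theory T" and t: "enumerates T t"
  shows "inj_on t {..<ntypes T}"
proof -
  have disj: "vtypes T \<inter> etypes T = {}"
    using T by (fastforce simp: feynman_theory_def etypes_def)
  have "t ` ({..<nverts T} - X) \<subseteq> vtypes T" "t ` ({nverts T..<ntypes T} - X) \<subseteq> etypes T" for X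
    using t unfolding enumerates_def bij_betw_def by blast+
  then have "t ` ({..<nverts T} - {nverts T..<ntypes T}) \<inter> t ` ({nverts T..<ntypes T} - {..<nverts
      T}) = {}"
    using disj by (meson disjoint_iff subsetD)
  moreover have "inj_on t {..<nverts T}" "inj_on t {nverts T..<ntypes T}"
    using t unfolding enumerates_def bij_betw_def by blast+
  moreover have "{..<ntypes T} = {..<nverts T} \<union> {nverts T..<ntypes T}"
    by (auto simp: nverts_def ntypes_def)
  ultimately show ?thesis by (simp only: inj_on_Un)
qed

lemma enumerates_edge:
  assumes "enumerates T t" "nverts T \<le> j" "j < ntypes T"
  obtains h where "h \<in> htypes T" "t j = {#h, iota T h#}"
proof -
  have "t j \<in> etypes T"
    using assms bij_betwE[of t "{nverts T..<ntypes T}" "etypes T"] by (simp add: enumerates_def)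
  then show ?thesis using that by (auto simp: etypes_def)
qed

text \<open>
  On the graphs with external structure of the \<open>i\<close>-th type, the degree is the image under \<open>C\<close> of
  the numbers of vertices corrected by the external vertex.
\<close>

lemma graph_deg_1PI:
  assumes T: "feynman_theory T" and t: "enumerates T t" and C: "C \<in> carrier_mat N (nverts T)"
    and G: "is_1PI T (rep_fgraph x)" and i: "i < ntypes T" "ext_type (rep_fgraph x) = t i"
  shows "graph_deg T t C x =
    C *\<^sub>v vec (nverts T) (\<lambda>j. of_nat (v_count (t j) x) - (if j = i then 1 else 0))"
proof -
  have k: "nverts T \<le> ntypes T" by (simp add: nverts_def ntypes_def)
  have s: "s_count (t j) x = (if j = i then 1 else 0)" if "j < ntypes T" for j
    using enumerates_inj[OF T t] i that by (auto simp: s_count_1PI[OF G] inj_on_def)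
  let ?u = "vec (nverts T) (\<lambda>j. if j = i then 1 else 0 :: rat)"
  have "pad_zero T C *\<^sub>v S_vec T t x = C *\<^sub>v ?u"
  proof (rule eq_vecI)
    fix r assume "r < dim_vec (C *\<^sub>v ?u)"
    then have r: "r < dim_row C" by simp
    have "(pad_zero T C *\<^sub>v S_vec T t x) $ r =
       (\<Sum>j<ntypes T. (if j < nverts T then C $$ (r, j) else 0) * (if j = i then 1 else 0))"
      using r by (auto simp: pad_zero_def S_vec_def scalar_prod_def s atLeast0LessThan intro!:
        sum.cong)
    also have "\<dots> = (\<Sum>j<nverts T. C $$ (r, j) * (if j = i then 1 else 0))"
      using k by (intro sum.mono_neutral_cong_right) auto
    finally show "(pad_zero T C *\<^sub>v S_vec T t x) $ r = (C *\<^sub>v ?u) $ r"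
      using r C by (simp add: scalar_prod_def atLeast0LessThan)
  qed (simp add: pad_zero_def)
  then have "graph_deg T t C x = C *\<^sub>v (V_vec T t x - ?u)"
    unfolding graph_deg_def using C by (simp add: V_vec_def mult_minus_distrib_mat_vec[of C N
      "nverts T"])
  also have "V_vec T t x - ?u = vec (nverts T) (\<lambda>j. of_nat (v_count (t j) x) - (if j =
      i then 1 else 0))"
    by (auto simp: V_vec_def)
  finally show ?thesis .
qed

text \<open>
  Hence, when \<open>C\<close> has full rank, all numbers of vertices and of internal edges are linear
  functions of the degree, up to a correction for the external structure.
\<close>

lemma exponents_linear:
  assumes T: "feynman_theory T" and t: "enumerates T t" and C: "C \<in> carrier_mat N (nverts T)"
    and rank: "vec_space.rank N C = nverts T"
  obtains A :: "nat \<Rightarrow> rat vec" where "\<And>j. A j \<in> carrier_vec N"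
    "\<And>i j x. i < ntypes T \<Longrightarrow> j < ntypes T \<Longrightarrow> is_1PI T (rep_fgraph x) \<Longrightarrow> ext_type (rep_fgraph x) = t i \<Longrightarrow>
      of_nat (if j < nverts T then v_count (t j) x else e_count (t j) x) =
        A j \<bullet> graph_deg T t C x + (if j = i then if j < nverts T then 1 else - 1 else 0)"
proof -
  let ?k = "nverts T"
  obtain L where L: "L \<in> carrier_mat ?k N" "L * C = 1\<^sub>m ?k"
    using C rank by (rule full_rank_left_inverse)
  obtain h where h: "\<And>j. ?k \<le> j \<Longrightarrow> j < ntypes T \<Longrightarrow> h j \<in> htypes T \<and> t j = {#h j, iota T (h j)#}"
  proof -
    have "\<exists>h. ?k \<le> j \<longrightarrow> j < ntypes T \<longrightarrow> h \<in> htypes T \<and> t j = {#h, iota T h#}" for j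
      using enumerates_edge[OF t, of j] by blast
    then show ?thesis using that by metis
  qed
  \<comment> \<open>The coefficient of the number of vertices of the \<open>l\<close>-th type
    in the \<open>j\<close>-th exponent. An edge type
    \<open>{h, \<iota> h}\<close> with \<open>\<iota> h = h\<close> contains \<open>h\<close> twice, hence the denominator.\<close>
  define m :: "nat \<Rightarrow> nat \<Rightarrow> rat" where "m j l = (if j < ?k then if l = j then 1 else 0
    else of_nat (count (t l) (h j)) / of_nat (count (t j) (h j)))" for j l
  define A where "A j = L\<^sup>T *\<^sub>v vec ?k (m j)" for j
  have "of_nat (if j < ?k then v_count (t j) x else e_count (t j) x) =
      A j \<bullet> graph_deg T t C x + (if j = i then if j < ?k then 1 else - 1 else 0)"
    if i: "i < ntypes T" and j: "j < ntypes T" and G: "is_1PI T (rep_fgraph x)"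
      and ext: "ext_type (rep_fgraph x) = t i" for i j x
  proof -
    let ?w = "vec ?k (\<lambda>l. of_nat (v_count (t l) x) - (if l = i then 1 else 0) :: rat)"
    have "A j \<bullet> graph_deg T t C x = vec ?k (m j) \<bullet> (L *\<^sub>v (C *\<^sub>v ?w))"
      unfolding A_def graph_deg_1PI[OF T t C G i ext]
      by (rule transpose_vec_mult_scalar[OF L(1)]) (use C in auto)
    also have "L *\<^sub>v (C *\<^sub>v ?w) = ?w"
      using assoc_mult_mat_vec[OF L(1) C, of ?w] L(2) by simp
    also have "vec ?k (m j) \<bullet> ?w = (\<Sum>l<?k. m j l * of_nat (v_count (t l) x)) - (if i < ?k then m j
        i else 0)"
      by (simp add: scalar_prod_def atLeast0LessThan right_diff_distrib sum_subtractf
          if_distrib[of "(*) _"] cong: if_cong)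
    finally have A: "A j \<bullet> graph_deg T t C x =
      (\<Sum>l<?k. m j l * of_nat (v_count (t l) x)) - (if i < ?k then m j i else 0)" .
    show ?thesis
    proof (cases "j < ?k")
      case True
      then show ?thesis by (auto simp: A m_def if_distrib[of "\<lambda>a. a * _"] cong: if_cong)
    next
      case False
      let ?h = "h j" and ?c = "count (t j) (h j)"
      have hj: "?h \<in> htypes T" "t j = {#?h, iota T ?h#}" using h[of j] j False by auto
      then have c: "?c \<noteq> 0" by simp
      have bij: "bij_betw t {..<?k} (vtypes T)" using t by (simp add: enumerates_def)
      have "(\<Sum>l<?k. v_count (t l) x * count (t l) ?h) = (\<Sum>v\<in>vtypes T. v_count v x * count v ?h)"
        by (rule sum.reindex_bij_betw[OF bij])
      also have "\<dots> = count (t i) ?h + e_count (t j) x * ?c"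
        using half_edge_count[OF T G hj(1)] hj(2) ext by simp
      finally have "of_nat (\<Sum>l<?k. v_count (t l) x * count (t l) ?h) =
          (of_nat (count (t i) ?h + e_count (t j) x * ?c) :: rat)"
        by simp
      moreover have "(\<Sum>l<?k. m j l * of_nat (v_count (t l) x)) =
          of_nat (\<Sum>l<?k. v_count (t l) x * count (t l) ?h) / of_nat ?c"
        using False by (simp add: m_def sum_divide_distrib mult.commute)
      ultimately have sum: "(\<Sum>l<?k. m j l * of_nat (v_count (t l) x)) =
          of_nat (count (t i) ?h) / of_nat ?c + of_nat (e_count (t j) x)"
        using c by (simp add: add_divide_distrib)
      have "of_nat (count (t i) ?h) / of_nat ?c = (if i = j then 1 else 0 :: rat)" if "\<not> i < ?k"
      proof (cases "?h \<in># t i")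
        case True
        have hi: "h i \<in> htypes T" "t i = {#h i, iota T (h i)#}" using h[of i] i that by auto
        have "iota T (iota T (h i)) = h i" using T hi by (simp add: feynman_theory_def)
        with True have "t i = t j" unfolding hi(2) hj(2) by (auto simp: add_mset_commute)
        then have "i = j" using enumerates_inj[OF T t] i j by (auto simp: inj_on_def)
        then show ?thesis using c by simp
      next
        case nin: False
        then have "i \<noteq> j" using c by (auto simp: count_eq_zero_iff)
        then show ?thesis using nin by (simp add: not_in_iff)
      qed
      moreover have "m j i = of_nat (count (t i) ?h) / of_nat ?c" using False by (simp add: m_def)
      ultimately show ?thesis using False by (auto simp: A sum)
    qed
  qed
  moreover have "A j \<in> carrier_vec N" for j using L by (simp add: A_def)
  ultimately show ?thesis by (rule that[rotated])
qed


section \<open>The Dyson-Schwinger system of a theory of Feynman graphs\<close>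

lemma prod_exponents_eq:
  fixes Z :: "nat \<Rightarrow> ('h fgraph, 'k::field_char_0) fseries"
  assumes Z: "\<And>j. j < ntypes T \<Longrightarrow> fcoeff (Z j) {#} = 0"
  shows "(\<Prod>j<nverts T. (1 + Z j) ^ v_count (t j) x) *
      (\<Prod>j=nverts T..<ntypes T. fps_eval (inverse (1 - fps_X) ^ e_count (t j) x) (Z j)) =
    (\<Prod>j<ntypes T. fps_eval (F_series 1 (if j < nverts T then 1 else -1)) (Z j) ^
      (if j < nverts T then v_count (t j) x else e_count (t j) x))"
    (is "?V * ?E = (\<Prod>j<_. ?f j)")
proof -
  have k: "nverts T \<le> ntypes T" by (simp add: nverts_def ntypes_def)
  have "?V = (\<Prod>j<nverts T. ?f j)"
  proof (intro prod.cong refl)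
    fix j assume "j \<in> {..<nverts T}"
    then show "(1 + Z j) ^ v_count (t j) x = ?f j"
      using k fps_eval_linear[OF Z, of j 1] by (simp add: F_series_vertex)
  qed
  moreover have "?E = (\<Prod>j=nverts T..<ntypes T. ?f j)"
    by (intro prod.cong refl) (simp add: F_series_edge fps_eval_power Z)
  moreover have "(\<Prod>j<nverts T. ?f j) * (\<Prod>j=nverts T..<ntypes T. ?f j) = (\<Prod>j<ntypes T. ?f j)"
    using k by (subst prod.union_disjoint[symmetric]) (auto intro!: prod.cong)
  ultimately show ?thesis by simp
qed

lemma pair_deg_of_rat:
  "a \<in> carrier_vec N \<Longrightarrow> \<alpha> \<in> carrier_vec N \<Longrightarrow>
    pair_deg (map_vec of_rat a) \<alpha> = (of_rat (a \<bullet> of_nat_vec \<alpha>) :: 'k::field_char_0)"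
  by (auto simp: pair_deg_def scalar_prod_def of_rat_sum of_rat_mult)

theorem theorem42:
  fixes T :: "'h feyn_theory"
    and t :: "nat \<Rightarrow> 'h multiset"
    and N :: nat
    and C :: "rat mat"
  assumes "feynman_theory T"
    and "enumerates T t"
    and "C \<in> carrier_mat N (card (vtypes T))"
    and "connected_gradation T N (graph_deg T t C)"
    and "vec_space.rank N C = card (vtypes T)"
  shows "hopf_subalgebra (all_primitives TYPE('k::field_char_0) T t)
           (dse_algebra T t N (graph_deg T t C) :: ('h fgraph, 'k) tree_alg set) \<and>
         dse_is_deg1 TYPE('k) T t N (graph_deg T t C)"
proof
  let ?k = "nverts T" and ?M = "ntypes T" and ?deg = "graph_deg T t C"
  define n where "n x j = (if j < ?k then v_count (t j) x else e_count (t j) x)" for x j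
  define b :: "nat \<Rightarrow> 'k" where "b j = (if j < ?k then 1 else -1)" for j
  define P where "P = primitives TYPE('k) T t"
  have "C \<in> carrier_mat N ?k" "vec_space.rank N C = ?k"
    using assms by (simp_all add: nverts_def)
  then obtain A where A: "\<And>j. A j \<in> carrier_vec N"
    and exponent: "\<And>i j x. i < ?M \<Longrightarrow> j < ?M \<Longrightarrow> is_1PI T (rep_fgraph x) \<Longrightarrow>
      ext_type (rep_fgraph x) = t i \<Longrightarrow>
      of_nat (n x j) = A j \<bullet> ?deg x + (if j = i then if j < ?k then 1 else - 1 else 0)"
    unfolding n_def by (rule exponents_linear[OF assms(1,2)]) blast
  define \<l> :: "nat \<Rightarrow> rat vec \<Rightarrow> 'k" where "\<l> j v = of_rat (A j \<bullet> v)" for j v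
  have n: "of_nat (n x j) = \<l> j (?deg x) + (if j = i then b i else 0)"
    if "i < ?M" "j < ?M" "x \<in> P i" for i j x
  proof -
    have "(of_nat (n x j) :: 'k) = of_rat (of_nat (n x j))" by simp
    also have "\<dots> = \<l> j (?deg x) + (if j = i then b i else 0)"
      using that exponent[of i j x]
      by (simp add: P_def primitives_def \<l>_def b_def of_rat_add)
    finally show ?thesis .
  qed
  have deg: "\<exists>\<alpha>\<in>carrier_vec N. ?deg x = of_nat_vec \<alpha>" "?deg x \<noteq> 0\<^sub>v N" if "x \<in> P i" for x i
    using assms(4) that is_feynman_1PI[of T "rep_fgraph x"] not_1PI_one_graph[of T]
    by (auto simp: P_def primitives_def connected_gradation_def)
  have rhs: "dse_rhs T t i Z = fsum (P i) (\<lambda>x. graft x (\<Prod>j<?M. fps_eval (F_series 1 (b j)) (Z j) ^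
      n x j))"
    if "\<And>j. j < ?M \<Longrightarrow> fcoeff (Z j) {#} = 0" for i Z
    unfolding dse_rhs_def P_def b_def n_def
    by (intro arg_cong[of _ _ "fsum _"] ext arg_cong[of _ _ "graft _"] prod_exponents_eq that)
  define Y :: "nat \<Rightarrow> ('h fgraph, 'k) fseries" where "Y = dse_solution T t"
  have Y: "Y i = dse_rhs T t i Y" if "i < ?M" for i
    using theI'[OF dse_solution_unique[of T t, where 'k = 'k]] that
    by (simp add: Y_def dse_solution_def dse_solves_def)
  have Y0: "fcoeff (Y i) {#} = 0" if "i < ?M" for i
    by (subst Y[OF that]) (simp add: dse_rhs_def fcoeff_fsum_graft_nontree)
  interpret graded_system ?M N P ?deg b \<l> n Y
  proof
    show "\<l> j (u + v) = \<l> j u + \<l> j v" if "u \<in> carrier_vec N" "v \<in> carrier_vec N" for j u v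
      using scalar_prod_add_distrib[OF A that] by (simp add: \<l>_def of_rat_add)
    show "finite {d \<in> P i. ?deg d = of_nat_vec \<alpha>}" if "\<alpha> \<in> carrier_vec N" for i \<alpha>
    proof (rule finite_subset)
      show "{d \<in> P i. ?deg d = of_nat_vec \<alpha>} \<subseteq> {x. is_feynman T (rep_fgraph x) \<and> ?deg x =
          of_nat_vec \<alpha>}"
        by (auto simp: P_def primitives_def is_feynman_1PI)
      show "finite {x. is_feynman T (rep_fgraph x) \<and> ?deg x = of_nat_vec \<alpha>}"
        using assms(4) that by (simp add: connected_gradation_def)
    qed
    show "Y i = fsum (P i) (\<lambda>d. graft d (\<Prod>j<?M. fps_eval (F_series 1 (b j)) (Y j) ^ n d j))"
      if "i < ?M" for i
      using Y[OF that] rhs[of Y i] Y0 by simp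
  qed (use n deg in \<open>auto simp: b_def\<close>)
  show "hopf_subalgebra (all_primitives TYPE('k) T t) (dse_algebra T t N ?deg
      :: ('h fgraph, 'k) tree_alg set)"
    using hopf_subalgebra_components[unfolded D_def]
      unfolding P_def all_primitives_def dse_algebra_def Y_def .
  show "dse_is_deg1 TYPE('k) T t N ?deg"
  proof -
    \<comment> \<open>The class with index 0 is empty, and the class with index \<open>q > 0\<close> consists of the unknown
      \<open>q - 1\<close>, as the unknowns are numbered from 0.\<close>
    define p :: "'k deg1_params" where "p = \<lparr>parts = ?M, part = (\<lambda>q. if q = 0 then {} else {q - 1}),
      vecA = (\<lambda>q. map_vec of_rat (A (q - 1))), scb = (\<lambda>q. b (q - 1)), scb0 = (\<lambda>_ _. 0)\<rparr>"
    have p: "parts p = ?M" "part p 0 = {}" "\<And>j. part p (Suc j) = {j}"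
        "\<And>j. vecA p (Suc j) = map_vec of_rat (A j)" "\<And>j. scb p (Suc j) = b j"
      by (simp_all add: p_def)
    have part_of: "part_of p i = Suc i" if "i < ?M" for i
      unfolding part_of_def using that by (intro the_equality) (auto simp: p_def split: if_splits)
    have "x \<in> (\<Union>q\<le>parts p. part p q)" if "x < ?M" for x
      using that by (intro UN_I[of "Suc x"]) (simp_all add: p)
    moreover have "(\<Union>q\<le>parts p. part p q) \<subseteq> {..<?M}"
      by (auto simp: p_def)
    ultimately have "(\<Union>q\<le>parts p. part p q) = {..<?M}" by blast
    then have "is_deg1_params N ?M p"
      unfolding is_deg1_params_def using A by (auto simp: p_def disjoint_family_on_def)
    then have "is_deg1_prelie N ?M p (\<lambda>(j, \<beta>) (i, \<alpha>).
      let q = part_of p j; r = part_of p i in Poly_Mapping.single (i, \<alpha> + \<beta>)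
        (if q = 0 then 0
         else if r = 0 then pair_deg (vecA p q) \<alpha> + scb0 p i q
         else pair_deg (vecA p q) \<alpha> + (if r = q then scb p q else 0)))"
      by (simp add: is_deg1_prelie_def Let_def)
    moreover have "dse_rhs T t i Z = deg1_rhs N p (dse_B T t ?deg) i Z"
      if i: "i < ?M" and Z: "\<And>j. j < ?M \<Longrightarrow> fcoeff (Z j) {#} = 0" for i and Z ::
        "nat \<Rightarrow> ('h fgraph, 'k) fseries"
    proof -
      define f where "f \<alpha> = (1 + fconst (b i) * Z i) *
        (\<Prod>j<?M. fps_eval (F_series (pair_deg (map_vec of_rat (A j)) \<alpha>) (b j)) (Z j))" for \<alpha>
      obtain a where a: "\<And>x. x \<in> P i \<Longrightarrow> a x \<in> carrier_vec N \<and> ?deg x = of_nat_vec (a x)"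
        using deg(1) by metis
      have "deg1_rhs N p (dse_B T t ?deg) i Z = fsum (carrier_vec N - {0\<^sub>v N})
         (\<lambda>\<alpha>. fsum {x \<in> P i. ?deg x = of_nat_vec \<alpha>} (\<lambda>x. graft x (f \<alpha>)))"
        using i
        by (simp add: deg1_rhs_def dse_B_def P_def f_def p part_of mult.commute
            prod.atLeast1_atMost_eq)
      also have "\<dots> = fsum (P i) (\<lambda>x. graft x (f (a x)))"
      proof (rule fsum_fsum_graft)
        fix x assume x: "x \<in> P i"
        have "a x \<noteq> 0\<^sub>v N"
          using a[OF x] deg(2)[OF x] by (auto simp: vec_eq_iff)
        then show "a x \<in> carrier_vec N - {0\<^sub>v N}" using a[OF x] by simp
        show "?deg x = of_nat_vec \<alpha> \<longleftrightarrow> \<alpha> = a x" for \<alpha>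
          using a[OF x] of_nat_vec_eq_iff by metis
      qed
      also have "\<dots> = fsum (P i) (\<lambda>x. graft x (\<Prod>j<?M. fps_eval (F_series 1 (b j)) (Z j) ^ n x j))"
      proof -
        have "f (a x) = (\<Prod>j<?M. fps_eval (F_series 1 (b j)) (Z j) ^ n x j)" if x: "x \<in> P i" for x
        proof -
          have "pair_deg (map_vec of_rat (A j)) (a x) = \<l> j (?deg x)" for j
            using pair_deg_of_rat[OF A, of "a x" j] a[OF x] by (simp add: \<l>_def)
          then show ?thesis
            unfolding f_def
            using prod_F_series_exponents[where Z = Z and n = "n x" and b = b and
                c = "\<lambda>j. \<l> j (?deg x)", OF i Z n[OF i _ x]] by simp
        qed
        then show ?thesis
          by (intro fsum_cong) simp
      qed
      also have "\<dots> = dse_rhs T t i Z"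
        using Z by (simp add: rhs)
      finally show ?thesis by simp
    qed
    ultimately show ?thesis
      unfolding dse_is_deg1_def by blast
  qed
qed

end
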